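(* Let $\tau\in\mathbb C$ with $\operatorname{Im}\tau>0$ and $\lambda\in\mathbb C\setminus(\mathbb Z+\tau\mathbb Z)$. The commutation relations of the Lie algebra $\mathfrak u_\tau(\widehat{\mathfrak{sl}}_2)$ in terms of half-currents can be written in the form: \begin{multline*} [\mathcal L_{\lambda,1}^\pm(u),\mathcal L_{\lambda,2}^\pm(v)]=[\mathcal L_{\lambda,1}^\pm(u)+\mathcal L_{\lambda,2}^\pm(v),\mathfrak r_\lambda^+(u-v)]+H_1\frac{\partial}{\partial\lambda}\mathcal L_{\lambda,2}^\pm(v)-H_2\frac{\partial}{\partial\lambda}\mathcal L_{\lambda,1}^\pm(u)\\ +h\frac{\partial}{\partial\lambda}\mathfrak r_\lambda^+(u-v)-c\cdot\frac{\partial}{\partial\tau}\mathfrak r_\lambda^+(u-v) \end{multline*} (the same sign throughout), and \begin{multline*} [\mathcal L_{\lambda,1}^+(u),\mathcal L_{\lambda,2}^-(v)]=[\mathcal L_{\lambda,1}^+(u)+\mathcal L_{\lambda,2}^-(v),\mathfrak r_\lambda^+(u-v)]+H_1\frac{\partial}{\partial\lambda}\mathcal L_{\lambda,2}^-(v)-H_2\frac{\partial}{\partial\lambda}\mathcal L_{\lambda,1}^+(u)\\ +h\frac{\partial}{\partial\lambda}\mathfrak r_\lambda^+(u-v)+c\cdot\Big(\frac{\partial}{\partial u}-\frac{\partial}{\partial\tau}\Big)\mathfrak r_\lambda^+(u-v), \end{multline*} where $H=\begin{pmatrix}1&0\\0&-1\end{pmatrix}$ and $h=\hat h[j_0]$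 with $j_0(u)=1$. One also has $$[H+h,\mathcal L_\lambda^\pm(u)]=0.$$
   Context: Theta function: $\theta$ is the odd entire function with $\theta(u+1)=-\theta(u)$, $\theta(u+\tau)=-e^{-2\pi i u-\pi i\tau}\theta(u)$, $\theta'(0)=1$. Test functions: $K$ is the algebra of entire functions $s$ on $\mathbb C$ with $s(u+1)=s(u)$ and $|s(u)|\le Ce^{p|\operatorname{Im}u|}$ for some constants $C,p>0$ depending on $s$, with scalar product $\langle s,t\rangle=\int_{-1/2+\alpha}^{1/2+\alpha}\frac{du}{2\pi i}s(u)t(u)$ (independent of $\alpha\in\mathbb C$). A sequence $s_n\in K$ tends to zero if there are common $C,p>0$ with $|s_n(u)|\le Ce^{p|\operatorname{Im}u|}$ and $s_n(u)\to0$ for all $u$. Distributions are continuous linear functionals on $K$ (or on tensor powers); $\langle a(u)\rangle_u=\langle a(u),1\rangle$; subscripts on brackets denote partial action. Vector-valued distributions are linear maps from test functions to the vector space. Shifts: $\langle a(u-z),s(u)\rangle_u=\langle a(u),s(u+z)\rangle_u$, regarded also as a two-variable distribution by $\langle a(u-z),s(u)t(z)\rangle=\big\langle\langle a(u-z),s(u)\rangle_u,t(z)\big\rangle_z$. Lie algebra: $\mathfrak{sl}_2$ has basis $h,e,f$ with $[h,e]=2e$, $[h,f]=-2f$, $[e,f]=h$ and invariant form with $(h,h)=2$, $(e,f)=1$, $(h,e)=(h,f)=(e,e)=(f,f)=0$. As a vector space $\mathfrak u_\tau(\widehat{\mathfrak{sl}}_2)=(\mathfrak{sl}_2\otimes K)\oplus\mathbb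 C c\oplus\mathbb C d$. Writing $\hat x[s]=x\otimes s$ for $x\in\mathfrak{sl}_2$, $s\in K$, the bracket is: $c$ is central, $[d,\hat x[s]]=\hat x[s']$, and $$[\hat x[s],\hat y[t]]=[x,y]\otimes st+c\,(x,y)\langle s',t\rangle .$$ The total current $x(u)$ ($x\in\{h,e,f\}$) is the Lie-algebra-valued distribution $\langle x(u),s(u)\rangle=\hat x[s]$. Green distributions: for $s\in K$, $$\langle\mathcal G_\lambda^+(u-z),s(u)\rangle_u=\int_{-\operatorname{Im}\tau<\operatorname{Im}(u-z)<0}\frac{du}{2\pi i}\frac{\theta(u-z+\lambda)}{\theta(u-z)\theta(\lambda)}s(u),$$ $$\langle\mathcal G_\lambda^-(u-z),s(u)\rangle_u=\int_{0<\operatorname{Im}(u-z)<\operatorname{Im}\tau}\frac{du}{2\pi i}\frac{\theta(u-z+\lambda)}{\theta(u-z)\theta(\lambda)}s(u),$$ $$\langle\mathcal G(u-z),s(u)\rangle_u=\int_{-\operatorname{Im}\tau<\operatorname{Im}(u-z)<0}\frac{du}{2\pi i}\frac{\theta'(u-z)}{\theta(u-z)}s(u),$$ the integrals being over horizontal segments of unit length (oriented in the direction of increasing real part) on which the indicated inequality holds. Half-currents: $h^+(u)=\langle\mathcal G(u-v)h(v)\rangle_v$, $h^-(u)=-\langle\mathcal G(v-u)h(v)\rangle_v$, $e_\lambda^\pm(u)=\langle\mathcal G_\lambda^\pm(u-v)e(v)\rangle_v$, $f_\lambda^\pm(u)=\langle\mathcal G_{-\lambda}^\pm(u-v)f(v)\rangle_v$.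 Here $\langle a(u,v)x(v)\rangle_v$ is the Lie-algebra-valued distribution in $u$ whose value on $s$ is $\hat x\big[\langle a(u,v),s(u)\rangle_u\big]$ (a function of $v$). $L$-operators and $r$-matrix: $$\mathcal L_\lambda^\pm(u)=\begin{pmatrix}\frac12h^\pm(u)&f_\lambda^\pm(u)\\ e_\lambda^\pm(u)&-\frac12h^\pm(u)\end{pmatrix},$$ $$\mathfrak r_\lambda^+(u-v)=\begin{pmatrix}\frac12\mathcal G(u-v)&0&0&0\\0&-\frac12\mathcal G(u-v)&\mathcal G_{-\lambda}^+(u-v)&0\\0&\mathcal G_\lambda^+(u-v)&-\frac12\mathcal G(u-v)&0\\0&0&0&\frac12\mathcal G(u-v)\end{pmatrix}$$ acting in $\mathbb C^2\otimes\mathbb C^2$ with the standard ordered basis. Conventions: subscripts $1,2$ indicate the tensor factor of $\operatorname{End}\mathbb C^2\otimes\operatorname{End}\mathbb C^2$ in which a $2\times2$ matrix acts (e.g. $H_1=H\otimes1$, $H_2=1\otimes H$). Matrix entries with values in the Lie algebra are regarded as elements of its universal enveloping algebra, so commutators are taken in $\operatorname{End}(\mathbb C^2)^{\otimes2}$ (respectively $\operatorname{End}\mathbb C^2$) tensored with the universal enveloping algebra; in $[H+h,\cdot]$, $H$ stands for $H\otimes1$ and $h$ for $1\otimes h$. Equalities are equalities of distributions in $u$ (and $v$) with values in this algebra; $\partial/\partial u$ is the distributional derivative, and $\partial/\partial\lambda$, $\partial/\partial\tau$ are derivatives of the distributions with respect to the parameters $\lambda$ and $\tau$. A product of a two-variable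 Green distribution with a current in one of its variables is defined by $\langle a(u,v)x(v),s(u)t(v)\rangle=\langle x(v),t(v)\langle a(u,v),s(u)\rangle_u\rangle$, and analogously in the other variable. *)

theory Defs
  imports "HOL-Complex_Analysis.Complex_Analysis" "HOL-Library.Poly_Mapping"
begin

no_notation fps_nth (infixl \<open>$\<close> 75)

section \<open>Complex vector spaces and Lie algebras\<close>

class complex_space = ab_group_add +
  fixes scaleC :: "complex \<Rightarrow> 'a \<Rightarrow> 'a"  (infixr \<open>*\<^sub>C\<close> 75)
  assumes scaleC_add_right: "a *\<^sub>C (x + y) = a *\<^sub>C x + a *\<^sub>C y"
    and scaleC_add_left: "(a + b) *\<^sub>C x = a *\<^sub>C x + b *\<^sub>C x"
    and scaleC_scaleC: "a *\<^sub>C b *\<^sub>C x = (a * b) *\<^sub>C x"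
    and scaleC_one: "1 *\<^sub>C x = x"

class complex_lie_algebra = complex_space +
  fixes lie :: "'a \<Rightarrow> 'a \<Rightarrow> 'a"
  assumes lie_add_left: "lie (x + y) z = lie x z + lie y z"
    and lie_add_right: "lie x (y + z) = lie x y + lie x z"
    and lie_scaleC_left: "lie (a *\<^sub>C x) y = a *\<^sub>C lie x y"
    and lie_scaleC_right: "lie x (a *\<^sub>C y) = a *\<^sub>C lie x y"
    and lie_self: "lie x x = 0"
    and lie_jacobi: "lie x (lie y z) + lie y (lie z x) + lie z (lie x y) = 0"


section \<open>Universal enveloping algebras\<close>

text \<open>
  Words over \<open>'a\<close> under concatenation form the free monoid (written additively, as
  \<^theory>\<open>HOL-Library.Poly_Mapping\<close> requires), so \<open>'a word \<Rightarrow>\<^sub>0 complex\<close> is the free unital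
  associative algebra on the set \<open>'a\<close>.  Dividing by the linearity relations gives the tensor
  algebra of the vector space \<open>'a\<close>, and dividing by the commutator relations as well gives its
  universal enveloping algebra.
\<close>

datatype 'a word = Word (letters: "'a list")

instantiation word :: (type) monoid_add
begin
definition zero_word :: "'a word" where "zero_word = Word []"
definition plus_word :: "'a word \<Rightarrow> 'a word \<Rightarrow> 'a word"
  where "plus_word v w = Word (letters v @ letters w)"
instance by standard (simp_all add: zero_word_def plus_word_def)
end

lemma word_add_eq_0_iff: "v + w = 0 \<longleftrightarrow> v = 0 \<and> w = 0" for v w :: "'a word"
  by (cases v; cases w) (simp add: zero_word_def plus_word_def)

lemma word_single_neq_0: "Word [x] \<noteq> 0" "0 \<noteq> Word [x]"
  by (simp_all add: zero_word_def)

definition free_gen :: "'a \<Rightarrow> 'a word \<Rightarrow>\<^sub>0 complex"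
  where "free_gen x = Poly_Mapping.single (Word [x]) 1"

definition free_const :: "complex \<Rightarrow> 'a word \<Rightarrow>\<^sub>0 complex"
  where "free_const a = Poly_Mapping.single 0 a"

inductive uea_ideal :: "('a::complex_lie_algebra word \<Rightarrow>\<^sub>0 complex) \<Rightarrow> bool"
  where
    "uea_ideal (free_gen (x + y) - free_gen x - free_gen y)"
  | "uea_ideal (free_gen (a *\<^sub>C x) - free_const a * free_gen x)"
  | "uea_ideal (free_gen x * free_gen y - free_gen y * free_gen x - free_gen (lie x y))"
  | "uea_ideal p \<Longrightarrow> uea_ideal q \<Longrightarrow> uea_ideal (p + q)"
  | "uea_ideal p \<Longrightarrow> uea_ideal (q * p)"
  | "uea_ideal p \<Longrightarrow> uea_ideal (p * q)"

lemma uea_ideal_0: "uea_ideal 0"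
  using uea_ideal.intros(5)[OF uea_ideal.intros(1), of 0] by simp

lemma uea_ideal_uminus: "uea_ideal p \<Longrightarrow> uea_ideal (- p)"
  using uea_ideal.intros(5)[of p "- 1"] by simp

lemma uea_ideal_diff: "uea_ideal p \<Longrightarrow> uea_ideal q \<Longrightarrow> uea_ideal (p - q)"
  using uea_ideal.intros(4)[of p "- q"] uea_ideal_uminus[of q] by simp

lemma lookup_mult_0:
  fixes p q :: "'a word \<Rightarrow>\<^sub>0 complex"
  shows "Poly_Mapping.lookup (p * q) 0 = Poly_Mapping.lookup p 0 * Poly_Mapping.lookup q 0"
proof -
  have *: "(Poly_Mapping.lookup q r when (0 = v + r)) = (if v = 0 then (Poly_Mapping.lookup q 0 when r = 0) else 0)"
    for v r :: "'a word"
    using word_add_eq_0_iff[of v r] by (auto simp: when_def eq_commute[of 0])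
  have "(\<Sum>r. Poly_Mapping.lookup q r when (0 = v + r)) = (Poly_Mapping.lookup q 0 when v = 0)" for v
    unfolding * by (cases "v = 0") (simp_all add: when_def)
  then have "Poly_Mapping.lookup (p * q) 0 = (\<Sum>v. Poly_Mapping.lookup p v * (Poly_Mapping.lookup q 0 when v = 0))"
    by (simp add: lookup_mult)
  also have "\<dots> = Sum_any (\<lambda>v :: 'a word. (Poly_Mapping.lookup p 0 * Poly_Mapping.lookup q 0) when v = 0)"
    by (intro arg_cong[of _ _ Sum_any] ext) (simp add: when_def)
  also have "\<dots> = Poly_Mapping.lookup p 0 * Poly_Mapping.lookup q 0"
    by simp
  finally show ?thesis .
qed

lemma uea_ideal_lookup_0: "uea_ideal p \<Longrightarrow> Poly_Mapping.lookup p 0 = 0"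
  by (induction rule: uea_ideal.induct)
    (simp_all add: lookup_mult_0 lookup_add lookup_minus free_gen_def lookup_single
      word_single_neq_0)

lemma not_uea_ideal_1: "\<not> uea_ideal 1"
  using uea_ideal_lookup_0[of 1] by auto

quotient_type (overloaded) 'a uea = "'a::complex_lie_algebra word \<Rightarrow>\<^sub>0 complex" /
    "\<lambda>p q. uea_ideal (p - q)"
proof (rule equivpI)
  show "reflp (\<lambda>p q. uea_ideal (p - q :: 'a word \<Rightarrow>\<^sub>0 complex))"
    by (simp add: reflp_def uea_ideal_0)
  show "symp (\<lambda>p q. uea_ideal (p - q :: 'a word \<Rightarrow>\<^sub>0 complex))"
    by (rule sympI) (use uea_ideal_uminus in fastforce)
  show "transp (\<lambda>p q. uea_ideal (p - q :: 'a word \<Rightarrow>\<^sub>0 complex))"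
    by (rule transpI) (use uea_ideal.intros(4) in fastforce)
qed

instantiation uea :: (complex_lie_algebra) ring_1
begin
lift_definition zero_uea :: "'a uea" is 0 .
lift_definition one_uea :: "'a uea" is 1 .
lift_definition plus_uea :: "'a uea \<Rightarrow> 'a uea \<Rightarrow> 'a uea" is "(+)"
  by (metis add_diff_add uea_ideal.intros(4))
lift_definition minus_uea :: "'a uea \<Rightarrow> 'a uea \<Rightarrow> 'a uea" is "(-)"
proof -
  fix a b c d :: "'a word \<Rightarrow>\<^sub>0 complex"
  assume "uea_ideal (a - b)" "uea_ideal (c - d)"
  then have "uea_ideal ((a - b) - (c - d))" by (rule uea_ideal_diff)
  then show "uea_ideal (a - c - (b - d))" by (simp add: algebra_simps)
qed
lift_definition uminus_uea :: "'a uea \<Rightarrow> 'a uea" is uminus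
  using uea_ideal_uminus by fastforce
lift_definition times_uea :: "'a uea \<Rightarrow> 'a uea \<Rightarrow> 'a uea" is "(*)"
proof -
  fix a b c d :: "'a word \<Rightarrow>\<^sub>0 complex"
  assume "uea_ideal (a - b)" "uea_ideal (c - d)"
  then have "uea_ideal ((a - b) * c + b * (c - d))"
    by (intro uea_ideal.intros(4) uea_ideal.intros(5,6))
  then show "uea_ideal (a * c - b * d)" by (simp add: algebra_simps)
qed
instance
proof
  fix a b c :: "'a uea"
  show "a + b + c = a + (b + c)" by transfer (simp add: uea_ideal_0 algebra_simps)
  show "a + b = b + a" by transfer (simp add: uea_ideal_0 algebra_simps)
  show "0 + a = a" by transfer (simp add: uea_ideal_0)
  show "- a + a = 0" by transfer (simp add: uea_ideal_0)
  show "a - b = a + - b" by transfer (simp add: uea_ideal_0)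
  show "a * b * c = a * (b * c)" by transfer (simp add: uea_ideal_0 mult.assoc)
  show "1 * a = a" by transfer (simp add: uea_ideal_0)
  show "a * 1 = a" by transfer (simp add: uea_ideal_0)
  show "(a + b) * c = a * c + b * c" by transfer (simp add: uea_ideal_0 distrib_right)
  show "a * (b + c) = a * b + a * c" by transfer (simp add: uea_ideal_0 distrib_left)
  show "(0::'a uea) \<noteq> 1"
    by transfer (use not_uea_ideal_1 uea_ideal_uminus in fastforce)
qed
end

instantiation uea :: (complex_lie_algebra) complex_space
begin
lift_definition scaleC_uea :: "complex \<Rightarrow> 'a uea \<Rightarrow> 'a uea" is "\<lambda>a p. free_const a * p"
  by (metis right_diff_distrib uea_ideal.intros(5))
instance
proof
  fix a b :: complex and x y :: "'a uea"
  show "a *\<^sub>C (x + y) = a *\<^sub>C x + a *\<^sub>C y"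
    by transfer (simp add: uea_ideal_0 distrib_left)
  show "(a + b) *\<^sub>C x = a *\<^sub>C x + b *\<^sub>C x"
    by transfer (simp add: uea_ideal_0 free_const_def single_add distrib_right)
  show "a *\<^sub>C b *\<^sub>C x = (a * b) *\<^sub>C x"
    by transfer (simp add: uea_ideal_0 free_const_def mult_single flip: mult.assoc)
  show "1 *\<^sub>C x = x"
    by transfer (simp add: uea_ideal_0 free_const_def)
qed
end

lift_definition uea_of :: "'a::complex_lie_algebra \<Rightarrow> 'a uea" is free_gen .

lemma uea_of_lie: "uea_of x * uea_of y - uea_of y * uea_of x = uea_of (lie x y)"
  by transfer (rule uea_ideal.intros(3))


section \<open>Test functions\<close>

definition seg_int :: "real \<Rightarrow> (complex \<Rightarrow> complex) \<Rightarrow> complex"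
  where "seg_int y f =
    contour_integral (linepath (Complex (- 1/2) y) (Complex (1/2) y)) f / (2 * of_real pi * \<i>)"

definition exp_bounded :: "(complex \<Rightarrow> complex) \<Rightarrow> bool"
  where "exp_bounded s \<longleftrightarrow> (\<exists>C>0. \<exists>p>0. \<forall>u. cmod (s u) \<le> C * exp (p * \<bar>Im u\<bar>))"

lemma exp_bounded_const: "exp_bounded (\<lambda>_. a)"
proof -
  have "cmod a \<le> (cmod a + 1) * exp (1 * \<bar>Im u\<bar>)" for u
    using mult_mono[of "cmod a" "cmod a + 1" 1 "exp (1 * \<bar>Im u\<bar>)"] by simp
  moreover have "cmod a + 1 > 0" by (simp add: add_nonneg_pos)
  ultimately show ?thesis unfolding exp_bounded_def by (meson zero_less_one)
qed

lemma exp_bounded_add: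
  assumes "exp_bounded s" "exp_bounded t"
  shows "exp_bounded (\<lambda>u. s u + t u)"
proof -
  obtain C p where C: "C > 0" "p > 0" "\<And>u. cmod (s u) \<le> C * exp (p * \<bar>Im u\<bar>)"
    using assms(1) unfolding exp_bounded_def by blast
  obtain D q where D: "D > 0" "q > 0" "\<And>u. cmod (t u) \<le> D * exp (q * \<bar>Im u\<bar>)"
    using assms(2) unfolding exp_bounded_def by blast
  have "cmod (s u + t u) \<le> (C + D) * exp ((p + q) * \<bar>Im u\<bar>)" for u
  proof -
    have "cmod (s u + t u) \<le> C * exp (p * \<bar>Im u\<bar>) + D * exp (q * \<bar>Im u\<bar>)"
      using norm_triangle_ineq[of "s u" "t u"] C(3)[of u] D(3)[of u] by linarith
    also have "\<dots> \<le> C * exp ((p + q) * \<bar>Im u\<bar>) + D * exp ((p + q) * \<bar>Im u\<bar>)"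
      using C(1,2) D(1,2) by (intro add_mono mult_left_mono) (auto intro: mult_right_mono)
    finally show ?thesis by (simp add: distrib_right)
  qed
  then show ?thesis unfolding exp_bounded_def
    using C(1,2) D(1,2) by (meson add_pos_pos)
qed

lemma exp_bounded_mult:
  assumes "exp_bounded s" "exp_bounded t"
  shows "exp_bounded (\<lambda>u. s u * t u)"
proof -
  obtain C p where C: "C > 0" "p > 0" "\<And>u. cmod (s u) \<le> C * exp (p * \<bar>Im u\<bar>)"
    using assms(1) unfolding exp_bounded_def by blast
  obtain D q where D: "D > 0" "q > 0" "\<And>u. cmod (t u) \<le> D * exp (q * \<bar>Im u\<bar>)"
    using assms(2) unfolding exp_bounded_def by blast
  have "cmod (s u * t u) \<le> (C * D) * exp ((p + q) * \<bar>Im u\<bar>)" for u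
    using mult_mono[OF C(3)[of u] D(3)[of u]] C(1)
    by (simp add: norm_mult algebra_simps exp_add)
  then show ?thesis unfolding exp_bounded_def
    using C(1,2) D(1,2) by (meson add_pos_pos mult_pos_pos)
qed

lemma exp_bounded_shift:
  assumes "exp_bounded s"
  shows "exp_bounded (\<lambda>u. s (u + z))"
proof -
  obtain C p where C: "C > 0" "p > 0" "\<And>u. cmod (s u) \<le> C * exp (p * \<bar>Im u\<bar>)"
    using assms unfolding exp_bounded_def by blast
  have "cmod (s (u + z)) \<le> (C * exp (p * \<bar>Im z\<bar>)) * exp (p * \<bar>Im u\<bar>)" for u
  proof -
    have "cmod (s (u + z)) \<le> C * exp (p * \<bar>Im (u + z)\<bar>)" by (rule C(3))
    also have "\<dots> \<le> C * exp (p * (\<bar>Im z\<bar> + \<bar>Im u\<bar>))"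
      using C(1,2) by (intro mult_left_mono) (auto intro!: mult_left_mono)
    finally show ?thesis by (simp add: distrib_left exp_add mult_ac)
  qed
  moreover have "C * exp (p * \<bar>Im z\<bar>) > 0" using C(1) by simp
  ultimately show ?thesis unfolding exp_bounded_def using C(2) by blast
qed

lemma exp_bounded_deriv:
  assumes "s holomorphic_on UNIV" "exp_bounded s"
  shows "exp_bounded (deriv s)"
proof -
  obtain C p where C: "C > 0" "p > 0" "\<And>u. cmod (s u) \<le> C * exp (p * \<bar>Im u\<bar>)"
    using assms(2) unfolding exp_bounded_def by blast
  have "cmod (deriv s u) \<le> (C * exp p) * exp (p * \<bar>Im u\<bar>)" for u
  proof -
    have "cmod ((deriv ^^ 1) s u) \<le> fact 1 * ((C * exp p) * exp (p * \<bar>Im u\<bar>)) / 1 ^ 1"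
    proof (rule Cauchy_inequality)
      show "s holomorphic_on ball u 1" using assms(1) holomorphic_on_subset by blast
      show "continuous_on (cball u 1) s"
        using assms(1) holomorphic_on_imp_continuous_on continuous_on_subset by blast
      fix x :: complex assume x: "norm (u - x) = 1"
      have "\<bar>Im x\<bar> \<le> 1 + \<bar>Im u\<bar>"
        using abs_Im_le_cmod[of "u - x"] x by simp
      then have "C * exp (p * \<bar>Im x\<bar>) \<le> C * exp (p * (1 + \<bar>Im u\<bar>))"
        using C(1,2) by (intro mult_left_mono) (auto intro!: mult_left_mono)
      then show "norm (s x) \<le> (C * exp p) * exp (p * \<bar>Im u\<bar>)"
        using C(3)[of x] by (simp add: distrib_left exp_add mult_ac)
    qed simp
    then show ?thesis by simp
  qed
  moreover have "C * exp p > 0" using C(1) by simp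
  ultimately show ?thesis unfolding exp_bounded_def using C(2) by blast
qed

lemma deriv_periodic:
  fixes s :: "complex \<Rightarrow> complex"
  assumes "s holomorphic_on UNIV" "\<And>u. s (u + 1) = s u"
  shows "deriv s (u + 1) = deriv s u"
proof -
  have "(s has_field_derivative deriv s (u + 1)) (at (u + 1))"
    using assms(1) by (simp add: holomorphic_derivI)
  then have "((\<lambda>w. s (w + 1)) has_field_derivative deriv s (u + 1)) (at u)"
    by (subst (asm) DERIV_shift)
  then have "(s has_field_derivative deriv s (u + 1)) (at u)"
    using assms(2) by simp
  then show ?thesis by (metis DERIV_imp_deriv)
qed

typedef ktest = "{s :: complex \<Rightarrow> complex.
    s holomorphic_on UNIV \<and> (\<forall>u. s (u + 1) = s u) \<and> exp_bounded s}"
  morphisms kapp Abs_ktest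
  by (rule exI[of _ "\<lambda>_. 0"]) (simp add: exp_bounded_const)

setup_lifting type_definition_ktest

instantiation ktest :: comm_ring_1
begin
lift_definition zero_ktest :: ktest is "\<lambda>_. 0" by (simp add: exp_bounded_const)
lift_definition one_ktest :: ktest is "\<lambda>_. 1" by (simp add: exp_bounded_const)
lift_definition plus_ktest :: "ktest \<Rightarrow> ktest \<Rightarrow> ktest" is "\<lambda>s t u. s u + t u"
  by (auto intro!: holomorphic_intros exp_bounded_add)
lift_definition times_ktest :: "ktest \<Rightarrow> ktest \<Rightarrow> ktest" is "\<lambda>s t u. s u * t u"
  by (auto intro!: holomorphic_intros exp_bounded_mult)
lift_definition uminus_ktest :: "ktest \<Rightarrow> ktest" is "\<lambda>s u. - s u"
  by (auto intro!: holomorphic_intros simp: exp_bounded_def)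
definition minus_ktest :: "ktest \<Rightarrow> ktest \<Rightarrow> ktest" where "minus_ktest s t = s + - t"
instance
  by standard (simp_all add: minus_ktest_def, (transfer, simp add: algebra_simps fun_eq_iff)+)
end

instantiation ktest :: complex_space
begin
lift_definition scaleC_ktest :: "complex \<Rightarrow> ktest \<Rightarrow> ktest" is "\<lambda>a s u. a * s u"
  by (auto intro!: holomorphic_intros exp_bounded_mult exp_bounded_const)
instance by standard (transfer, simp add: algebra_simps fun_eq_iff)+
end

lift_definition kdiff :: "ktest \<Rightarrow> ktest" is deriv
  by (auto intro!: holomorphic_intros exp_bounded_deriv deriv_periodic)

text \<open>The test function \<open>u \<mapsto> s(u + z)\<close>.\<close>

lift_definition kshift :: "complex \<Rightarrow> ktest \<Rightarrow> ktest" is "\<lambda>z s u. s (u + z)"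
proof (intro conjI allI)
  fix z and s :: "complex \<Rightarrow> complex"
  assume s: "s holomorphic_on UNIV \<and> (\<forall>u. s (u + 1) = s u) \<and> exp_bounded s"
  have "s \<circ> (\<lambda>u. u + z) holomorphic_on UNIV"
    by (rule holomorphic_on_compose_gen[of _ _ _ UNIV]) (auto intro!: holomorphic_intros simp: s)
  then show "(\<lambda>u. s (u + z)) holomorphic_on UNIV" by (simp add: comp_def)
  show "s (u + 1 + z) = s (u + z)" for u
    using s by (metis add.commute add.left_commute)
  show "exp_bounded (\<lambda>u. s (u + z))" using s exp_bounded_shift by blast
qed

text \<open>
  The scalar product is the integral over \<open>[-1/2 + \<alpha>, 1/2 + \<alpha>]\<close> for \<open>\<alpha> = 0\<close>; by periodicity and
  Cauchy's theorem the choice of \<open>\<alpha>\<close> is immaterial.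
\<close>

definition sprod :: "ktest \<Rightarrow> ktest \<Rightarrow> complex"
  where "sprod s t = seg_int 0 (\<lambda>u. kapp s u * kapp t u)"

lemma kapp_holomorphic: "kapp s holomorphic_on A"
  using kapp[of s] holomorphic_on_subset by blast

lemma kapp_continuous: "continuous_on A (kapp s)"
  by (rule holomorphic_on_imp_continuous_on[OF kapp_holomorphic])

lemma kapp_integrable: "(\<lambda>u. kapp s u) contour_integrable_on linepath a b"
  by (intro contour_integrable_continuous_linepath kapp_continuous)

lemma sprod_eq: "sprod s t = seg_int 0 (kapp (s * t))"
  by (simp add: sprod_def times_ktest.rep_eq)

lemma seg_int_kapp_add: "seg_int y (kapp (s + t)) = seg_int y (kapp s) + seg_int y (kapp t)"
  by (simp add: seg_int_def plus_ktest.rep_eq contour_integral_add kapp_integrable add_divide_distrib)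

lemma seg_int_kapp_scale: "seg_int y (kapp (a *\<^sub>C s)) = a * seg_int y (kapp s)"
  by (simp add: seg_int_def scaleC_ktest.rep_eq contour_integral_lmul kapp_integrable)

lemma seg_int_kdiff: "seg_int 0 (kapp (kdiff s)) = 0"
proof -
  let ?a = "Complex (- 1/2) 0" and ?b = "Complex (1/2) 0"
  have "(deriv (kapp s) has_contour_integral
      (kapp s (pathfinish (linepath ?a ?b)) - kapp s (pathstart (linepath ?a ?b)))) (linepath ?a ?b)"
    by (rule contour_integral_primitive[of UNIV])
      (auto intro: holomorphic_derivI[OF kapp_holomorphic])
  moreover have "kapp s ?b = kapp s ?a"
  proof -
    have "?b = ?a + 1" by (simp add: complex_eq_iff)
    then show ?thesis using kapp[of s] by simp
  qed
  ultimately show ?thesis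
    by (simp add: seg_int_def kdiff.rep_eq contour_integral_unique)
qed

lemma kapp_field_differentiable: "kapp s field_differentiable at u"
  by (rule holomorphic_on_imp_differentiable_at[of _ UNIV]) (auto intro: kapp_holomorphic)

lemma kdiff_add: "kdiff (s + t) = kdiff s + kdiff t"
  by (rule kapp_inject[THEN iffD1])
    (simp add: kdiff.rep_eq plus_ktest.rep_eq fun_eq_iff deriv_add kapp_field_differentiable)

lemma kdiff_scale: "kdiff (a *\<^sub>C s) = a *\<^sub>C kdiff s"
  by (rule kapp_inject[THEN iffD1])
    (simp add: kdiff.rep_eq scaleC_ktest.rep_eq fun_eq_iff deriv_cmult kapp_field_differentiable)

lemma kdiff_mult: "kdiff (s * t) = kdiff s * t + s * kdiff t"
  by (rule kapp_inject[THEN iffD1])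
    (simp add: kdiff.rep_eq times_ktest.rep_eq plus_ktest.rep_eq fun_eq_iff deriv_mult
      kapp_field_differentiable)

lemma kmult_scaleC_left: "(a *\<^sub>C s) * t = a *\<^sub>C (s * t)" for s t :: ktest
  by transfer (simp add: mult_ac)

lemma kmult_scaleC_right: "s * (a *\<^sub>C t) = a *\<^sub>C (s * t)" for s t :: ktest
  by transfer (simp add: mult_ac)

lemma sprod_add_left: "sprod (s + t) r = sprod s r + sprod t r"
  by (simp add: sprod_eq distrib_right seg_int_kapp_add)

lemma sprod_scale_left: "sprod (a *\<^sub>C s) r = a * sprod s r"
  by (simp add: sprod_eq kmult_scaleC_left seg_int_kapp_scale)

lemma sprod_commute: "sprod s t = sprod t s"
  by (simp add: sprod_eq mult.commute)

lemma sprod_kdiff_mult: "sprod (kdiff s) t = - sprod s (kdiff t)"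
  using seg_int_kdiff[of "s * t"]
  by (simp add: sprod_eq kdiff_mult seg_int_kapp_add add_eq_0_iff2)


lemma sprod_add_right: "sprod r (s + t) = sprod r s + sprod r t"
  by (simp add: sprod_commute[of r] sprod_add_left)

lemma sprod_scale_right: "sprod r (a *\<^sub>C s) = a * sprod r s"
  by (simp add: sprod_commute[of r] sprod_scale_left)

lemma sprod_uminus_left: "sprod (- s) r = - sprod s r"
  using sprod_add_left[of s "- s" r] sprod_scale_left[of 0 s r]
    sprod_add_left[of 0 0 r] by (simp add: add_eq_0_iff2)

lemma sprod_uminus_right: "sprod r (- s) = - sprod r s"
  by (simp add: sprod_commute[of r] sprod_uminus_left)

lemma sprod_mult_assoc: "sprod (s * t) r = sprod s (t * r)"
  by (simp add: sprod_eq mult.assoc)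

lemma kdiff_uminus: "kdiff (- s) = - kdiff s"
  using kdiff_add[of s "- s"] kdiff_add[of 0 0] by (simp add: add_eq_0_iff)


lemma kscale_0: "a *\<^sub>C (0::ktest) = 0" "0 *\<^sub>C s = (0::ktest)"
  by (transfer, simp)+

lemma kdiff_0: "kdiff 0 = 0"
  using kdiff_add[of 0 0] by simp

lemma sprod_0: "sprod 0 s = 0" "sprod s 0 = 0"
  using sprod_add_left[of 0 0 s] by (simp_all add: sprod_commute[of s])

lemma kscale_uminus: "a *\<^sub>C (- s) = - (a *\<^sub>C s)" "(- a) *\<^sub>C s = - (a *\<^sub>C s)" for s :: ktest
  by (transfer, simp)+

lemma kscale_diff: "a *\<^sub>C (s - t) = a *\<^sub>C s - a *\<^sub>C t" "(a - b) *\<^sub>C s = a *\<^sub>C s - b *\<^sub>C s"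
  for s t :: ktest
  by (simp_all add: diff_conv_add_uminus scaleC_add_right scaleC_add_left kscale_uminus del: add_uminus_conv_diff)

lemma kdiff_diff: "kdiff (s - t) = kdiff s - kdiff t"
  using kdiff_add[of s "- t"] by (simp add: kdiff_uminus)

lemma sprod_diff: "sprod (s - t) r = sprod s r - sprod t r" "sprod r (s - t) = sprod r s - sprod r t"
  using sprod_add_left[of s "- t" r] sprod_add_right[of r s "- t"]
  by (simp_all add: sprod_uminus_left sprod_uminus_right)

lemma sprod_kdiff_cyclic: "sprod (kdiff a) (b * c) + sprod (kdiff b) (a * c) + sprod (kdiff c) (a * b) = 0"
  using seg_int_kdiff[of "a * (b * c)"]
  by (simp add: sprod_eq kdiff_mult seg_int_kapp_add algebra_simps)

section \<open>The Lie algebras\<close>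

text \<open>\<open>Sl2 a b c\<close> stands for \<open>a h + b e + c f\<close>.\<close>

datatype sl2 = Sl2 (coef_h: complex) (coef_e: complex) (coef_f: complex)

instantiation sl2 :: complex_lie_algebra
begin
definition "0 = Sl2 0 0 0"
definition "x + y = Sl2 (coef_h x + coef_h y) (coef_e x + coef_e y) (coef_f x + coef_f y)"
definition "- x = Sl2 (- coef_h x) (- coef_e x) (- coef_f x)"
definition "x - y = Sl2 (coef_h x - coef_h y) (coef_e x - coef_e y) (coef_f x - coef_f y)"
definition "a *\<^sub>C x = Sl2 (a * coef_h x) (a * coef_e x) (a * coef_f x)"
definition "lie x y = Sl2
  (coef_e x * coef_f y - coef_f x * coef_e y)
  (2 * (coef_h x * coef_e y - coef_e x * coef_h y))
  (- 2 * (coef_h x * coef_f y - coef_f x * coef_h y))"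
instance
  by standard
    (simp_all add: zero_sl2_def plus_sl2_def uminus_sl2_def minus_sl2_def scaleC_sl2_def lie_sl2_def
      sl2.expand algebra_simps)
end

definition sl2_h :: sl2 where "sl2_h = Sl2 1 0 0"
definition sl2_e :: sl2 where "sl2_e = Sl2 0 1 0"
definition sl2_f :: sl2 where "sl2_f = Sl2 0 0 1"

definition sl2_form :: "sl2 \<Rightarrow> sl2 \<Rightarrow> complex"
  where "sl2_form x y = 2 * coef_h x * coef_h y + coef_e x * coef_f y + coef_f x * coef_e y"

lemma sl2_brackets:
  "lie sl2_h sl2_e = 2 *\<^sub>C sl2_e" "lie sl2_h sl2_f = (- 2) *\<^sub>C sl2_f" "lie sl2_e sl2_f = sl2_h"
  by (simp_all add: sl2_h_def sl2_e_def sl2_f_def lie_sl2_def scaleC_sl2_def)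

lemma sl2_form_basis:
  "sl2_form sl2_h sl2_h = 2" "sl2_form sl2_e sl2_f = 1" "sl2_form sl2_h sl2_e = 0"
  "sl2_form sl2_h sl2_f = 0" "sl2_form sl2_e sl2_e = 0" "sl2_form sl2_f sl2_f = 0"
  by (simp_all add: sl2_h_def sl2_e_def sl2_f_def sl2_form_def)

text \<open>\<open>Affine p q r a b\<close> stands for \<open>h \<otimes> p + e \<otimes> q + f \<otimes> r + a c + b d\<close>.\<close>

datatype affine_sl2 = Affine (part_h: ktest) (part_e: ktest) (part_f: ktest)
  (part_c: complex) (part_d: complex)

instantiation affine_sl2 :: complex_lie_algebra
begin
definition "0 = Affine 0 0 0 0 0"
definition "X + Y = Affine (part_h X + part_h Y) (part_e X + part_e Y) (part_f X + part_f Y)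
  (part_c X + part_c Y) (part_d X + part_d Y)"
definition "- X = Affine (- part_h X) (- part_e X) (- part_f X) (- part_c X) (- part_d X)"
definition "X - Y = Affine (part_h X - part_h Y) (part_e X - part_e Y) (part_f X - part_f Y)
  (part_c X - part_c Y) (part_d X - part_d Y)"
definition "a *\<^sub>C X = Affine (a *\<^sub>C part_h X) (a *\<^sub>C part_e X) (a *\<^sub>C part_f X)
  (a * part_c X) (a * part_d X)"
definition "lie X Y = Affine
  (part_e X * part_f Y - part_f X * part_e Y
    + part_d X *\<^sub>C kdiff (part_h Y) - part_d Y *\<^sub>C kdiff (part_h X))
  (2 *\<^sub>C (part_h X * part_e Y - part_e X * part_h Y)
    + part_d X *\<^sub>C kdiff (part_e Y) - part_d Y *\<^sub>C kdiff (part_e X))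
  ((- 2) *\<^sub>C (part_h X * part_f Y - part_f X * part_h Y)
    + part_d X *\<^sub>C kdiff (part_f Y) - part_d Y *\<^sub>C kdiff (part_f X))
  (2 * sprod (kdiff (part_h X)) (part_h Y) + sprod (kdiff (part_e X)) (part_f Y)
    + sprod (kdiff (part_f X)) (part_e Y))
  0"
instance
proof
  fix x y z :: affine_sl2 and a b :: complex
  note defs = zero_affine_sl2_def plus_affine_sl2_def uminus_affine_sl2_def minus_affine_sl2_def
    scaleC_affine_sl2_def
  note lin = scaleC_add_right scaleC_add_left scaleC_scaleC kscale_diff kscale_uminus kscale_0
    kmult_scaleC_left kmult_scaleC_right kdiff_add kdiff_diff kdiff_scale kdiff_uminus kdiff_0
    sprod_add_left sprod_add_right sprod_diff sprod_scale_left sprod_scale_right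
    sprod_uminus_left sprod_uminus_right sprod_0
  show "x + y + z = x + (y + z)" "x + y = y + x" "0 + x = x" "- x + x = 0" "x - y = x + - y"
    by (simp_all add: defs add_ac)
  show "a *\<^sub>C (x + y) = a *\<^sub>C x + a *\<^sub>C y" "(a + b) *\<^sub>C x = a *\<^sub>C x + b *\<^sub>C x"
    "a *\<^sub>C b *\<^sub>C x = (a * b) *\<^sub>C x" "1 *\<^sub>C x = x"
    by (simp_all add: defs scaleC_add_right scaleC_add_left scaleC_scaleC scaleC_one
        algebra_simps)
  show "lie (x + y) z = lie x z + lie y z" "lie x (y + z) = lie x y + lie x z"
    by (simp_all add: defs lie_affine_sl2_def lin algebra_simps)
  show "lie (a *\<^sub>C x) y = a *\<^sub>C lie x y" "lie x (a *\<^sub>C y) = a *\<^sub>C lie x y"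
    by (simp_all add: defs lie_affine_sl2_def lin algebra_simps)
  show "lie x x = 0"
    using sprod_kdiff_mult[of "part_h x" "part_h x"] sprod_kdiff_mult[of "part_e x" "part_f x"]
      sprod_commute[of "part_h x"] sprod_commute[of "part_e x"]
    by (simp add: defs lie_affine_sl2_def kscale_0 algebra_simps)
  show "lie x (lie y z) + lie y (lie z x) + lie z (lie x y) = 0"
  proof (rule affine_sl2.expand, intro conjI)
    let ?J = "lie x (lie y z) + lie y (lie z x) + lie z (lie x y)"
    show "part_h ?J = part_h 0"
      by (simp add: defs lie_affine_sl2_def lin kdiff_mult algebra_simps)
    show "part_e ?J = part_e 0"
      by (simp add: defs lie_affine_sl2_def lin kdiff_mult algebra_simps)
    show "part_f ?J = part_f 0"
      by (simp add: defs lie_affine_sl2_def lin kdiff_mult algebra_simps)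
    show "part_d ?J = part_d 0"
      by (simp add: defs lie_affine_sl2_def)
    note cyc = sprod_kdiff_cyclic[of "part_h x" "part_e y" "part_f z"]
      sprod_kdiff_cyclic[of "part_h x" "part_f y" "part_e z"]
      sprod_kdiff_cyclic[of "part_e x" "part_h y" "part_f z"]
      sprod_kdiff_cyclic[of "part_e x" "part_f y" "part_h z"]
      sprod_kdiff_cyclic[of "part_f x" "part_h y" "part_e z"]
      sprod_kdiff_cyclic[of "part_f x" "part_e y" "part_h z"]
    have "part_c ?J = 0"
      using cyc
      apply (simp add: defs lie_affine_sl2_def lin sprod_commute[of "kdiff a" "kdiff b" for a b]
          algebra_simps)
      apply algebra
      done
    then show "part_c ?J = part_c 0" by (simp add: defs)
  qed
qed
end

text \<open>The element \<open>x \<otimes> s\<close>.\<close>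

definition hat :: "sl2 \<Rightarrow> ktest \<Rightarrow> affine_sl2"
  where "hat x s = Affine (coef_h x *\<^sub>C s) (coef_e x *\<^sub>C s) (coef_f x *\<^sub>C s) 0 0"

definition aff_c :: affine_sl2 where "aff_c = Affine 0 0 0 1 0"
definition aff_d :: affine_sl2 where "aff_d = Affine 0 0 0 0 1"

lemma affine_brackets:
  "lie (hat x s) (hat y t) = hat (lie x y) (s * t) + (sl2_form x y * sprod (kdiff s) t) *\<^sub>C aff_c"
  "lie aff_d (hat x s) = hat x (kdiff s)"
  "lie aff_c X = 0"
  by (simp_all add: hat_def aff_c_def aff_d_def lie_affine_sl2_def zero_affine_sl2_def
      plus_affine_sl2_def scaleC_affine_sl2_def lie_sl2_def sl2_form_def kscale_0 kdiff_0 sprod_0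
      scaleC_one kdiff_scale sprod_scale_left sprod_scale_right kmult_scaleC_left kmult_scaleC_right
      scaleC_scaleC kscale_diff kscale_uminus scaleC_add_right scaleC_add_left
      algebra_simps)

definition aff_h0 :: affine_sl2 where "aff_h0 = hat sl2_h 1"


section \<open>Distributions\<close>

text \<open>
  A distribution with values in a vector space \<open>'v\<close> is a map \<open>ktest \<Rightarrow> 'v\<close>.  A distribution in two
  variables \<open>u, v\<close> is determined by its values on the products \<open>s(u) t(v)\<close>, and is represented
  by the bilinear map \<open>ktest \<Rightarrow> ktest \<Rightarrow> 'v\<close> sending \<open>s\<close> and \<open>t\<close> to that value.
\<close>

type_synonym dist = "ktest \<Rightarrow> complex"
type_synonym kernel = "ktest \<Rightarrow> ktest \<Rightarrow> complex"

text \<open>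
  The kernel \<open>a(u - z)\<close>: its value on \<open>s(u) t(z)\<close> is
  \<open>\<langle>\<langle>a(u - z), s(u)\<rangle>\<^sub>u, t(z)\<rangle>\<^sub>z\<close> with \<open>\<langle>a(u - z), s(u)\<rangle>\<^sub>u = \<langle>a(u), s(u + z)\<rangle>\<^sub>u\<close>.
\<close>

definition diff_kernel :: "dist \<Rightarrow> kernel"
  where "diff_kernel a s t = seg_int 0 (\<lambda>z. a (kshift z s) * kapp t z)"

text \<open>
  Partial actions \<open>\<langle>A(u,v), s(u)\<rangle>\<^sub>u\<close> and \<open>\<langle>A(u,v), t(v)\<rangle>\<^sub>v\<close>, as test functions in the remaining
  variable.  They are the test functions that represent the distributions \<open>t \<mapsto> A s t\<close> and
  \<open>s \<mapsto> A s t\<close> via the (nondegenerate) scalar product.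
\<close>

definition part_act_u :: "kernel \<Rightarrow> ktest \<Rightarrow> ktest"
  where "part_act_u A s = (THE r. \<forall>t. sprod r t = A s t)"

definition part_act_v :: "kernel \<Rightarrow> ktest \<Rightarrow> ktest"
  where "part_act_v A t = (THE r. \<forall>s. sprod r s = A s t)"

text \<open>The products \<open>A(u,v) x(u)\<close> and \<open>A(u,v) x(v)\<close>.\<close>

definition kernel_mult_u :: "kernel \<Rightarrow> (ktest \<Rightarrow> 'v) \<Rightarrow> ktest \<Rightarrow> ktest \<Rightarrow> 'v"
  where "kernel_mult_u A x s t = x (s * part_act_v A t)"

definition kernel_mult_v :: "kernel \<Rightarrow> (ktest \<Rightarrow> 'v) \<Rightarrow> ktest \<Rightarrow> ktest \<Rightarrow> 'v"
  where "kernel_mult_v A x s t = x (t * part_act_u A s)"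

text \<open>Convergence to zero in the space of test functions, and derivatives in this sense.\<close>

definition ktest_null :: "(nat \<Rightarrow> ktest) \<Rightarrow> bool"
  where "ktest_null s \<longleftrightarrow>
    (\<exists>C>0. \<exists>p>0. \<forall>n u. cmod (kapp (s n) u) \<le> C * exp (p * \<bar>Im u\<bar>)) \<and>
    (\<forall>u. (\<lambda>n. kapp (s n) u) \<longlonglongrightarrow> 0)"

definition has_kderiv :: "(complex \<Rightarrow> ktest) \<Rightarrow> ktest \<Rightarrow> complex \<Rightarrow> bool"
  where "has_kderiv F k l \<longleftrightarrow>
    (\<forall>\<epsilon>. (\<forall>n. \<epsilon> n \<noteq> 0) \<and> \<epsilon> \<longlonglongrightarrow> 0 \<longrightarrow>
      ktest_null (\<lambda>n. inverse (\<epsilon> n) *\<^sub>C (F (l + \<epsilon> n) - F l) - k))"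

definition kderiv :: "(complex \<Rightarrow> ktest) \<Rightarrow> complex \<Rightarrow> ktest"
  where "kderiv F l = (THE k. has_kderiv F k l)"

definition aff_deriv :: "(complex \<Rightarrow> affine_sl2) \<Rightarrow> complex \<Rightarrow> affine_sl2"
  where "aff_deriv F l = Affine
    (kderiv (\<lambda>l. part_h (F l)) l) (kderiv (\<lambda>l. part_e (F l)) l) (kderiv (\<lambda>l. part_f (F l)) l)
    (deriv (\<lambda>l. part_c (F l)) l) (deriv (\<lambda>l. part_d (F l)) l)"


section \<open>Theta function and Green distributions\<close>

definition is_theta :: "complex \<Rightarrow> (complex \<Rightarrow> complex) \<Rightarrow> bool"
  where "is_theta \<tau> f \<longleftrightarrow> f holomorphic_on UNIV \<and>
    (\<forall>u. f (- u) = - f u) \<and>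
    (\<forall>u. f (u + 1) = - f u) \<and>
    (\<forall>u. f (u + \<tau>) = - exp (- 2 * of_real pi * \<i> * u - of_real pi * \<i> * \<tau>) * f u) \<and>
    deriv f 0 = 1"

text \<open>For \<open>Im \<tau> > 0\<close> these conditions determine the function uniquely.\<close>

definition theta :: "complex \<Rightarrow> complex \<Rightarrow> complex"
  where "theta \<tau> = (THE f. is_theta \<tau> f)"

datatype sign = Plus | Minus

text \<open>
  The heights of the horizontal segments in the strips \<open>- Im \<tau> < Im w < 0\<close> and
  \<open>0 < Im w < Im \<tau>\<close>, where \<open>w = u - z\<close>.  The integrands below are holomorphic in these strips and
  have period 1, so any other segment of unit length in the strip gives the same integral.
\<close>

fun strip_height :: "sign \<Rightarrow> complex \<Rightarrow> real"
  where
    "strip_height Plus \<tau> = - Im \<tau> / 2"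
  | "strip_height Minus \<tau> = Im \<tau> / 2"

text \<open>The Green distributions at \<open>z = 0\<close>; \<^const>\<open>diff_kernel\<close> supplies the shift by \<open>z\<close>.\<close>

definition green_twisted :: "sign \<Rightarrow> complex \<Rightarrow> complex \<Rightarrow> dist"
  where "green_twisted \<sigma> \<tau> l s = seg_int (strip_height \<sigma> \<tau>)
    (\<lambda>w. theta \<tau> (w + l) / (theta \<tau> w * theta \<tau> l) * kapp s w)"

definition green :: "complex \<Rightarrow> dist"
  where "green \<tau> s = seg_int (strip_height Plus \<tau>)
    (\<lambda>w. deriv (theta \<tau>) w / theta \<tau> w * kapp s w)"


section \<open>Half-currents, \<open>L\<close>-operators and the \<open>r\<close>-matrix\<close>

text \<open>The distribution \<open>\<langle>A(u,v) x(v)\<rangle>\<^sub>v\<close> in \<open>u\<close>, where \<open>x(v)\<close> is the total current of \<open>x\<close>.\<close>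

definition smear :: "kernel \<Rightarrow> sl2 \<Rightarrow> ktest \<Rightarrow> affine_sl2"
  where "smear A x s = hat x (part_act_u A s)"

text \<open>\<open>\<lambda>s t. diff_kernel a t s\<close> is the kernel \<open>a(v - u)\<close>.\<close>

fun half_h :: "sign \<Rightarrow> complex \<Rightarrow> ktest \<Rightarrow> affine_sl2"
  where
    "half_h Plus \<tau> s = smear (diff_kernel (green \<tau>)) sl2_h s"
  | "half_h Minus \<tau> s = - smear (\<lambda>s t. diff_kernel (green \<tau>) t s) sl2_h s"

definition half_e :: "sign \<Rightarrow> complex \<Rightarrow> complex \<Rightarrow> ktest \<Rightarrow> affine_sl2"
  where "half_e \<sigma> \<tau> l = smear (diff_kernel (green_twisted \<sigma> \<tau> l)) sl2_e"

definition half_f :: "sign \<Rightarrow> complex \<Rightarrow> complex \<Rightarrow> ktest \<Rightarrow> affine_sl2"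
  where "half_f \<sigma> \<tau> l = smear (diff_kernel (green_twisted \<sigma> \<tau> (- l))) sl2_f"

definition L_op :: "sign \<Rightarrow> complex \<Rightarrow> complex \<Rightarrow> ktest \<Rightarrow> affine_sl2^2^2"
  where "L_op \<sigma> \<tau> l s = vector
    [vector [(1/2) *\<^sub>C half_h \<sigma> \<tau> s, half_f \<sigma> \<tau> l s],
     vector [half_e \<sigma> \<tau> l s, - ((1/2) *\<^sub>C half_h \<sigma> \<tau> s)]]"

definition L_mat :: "sign \<Rightarrow> complex \<Rightarrow> complex \<Rightarrow> ktest \<Rightarrow> affine_sl2 uea^2^2"
  where "L_mat \<sigma> \<tau> l s = map_matrix uea_of (L_op \<sigma> \<tau> l s)"

definition dlambda_L_mat :: "sign \<Rightarrow> complex \<Rightarrow> complex \<Rightarrow> ktest \<Rightarrow> affine_sl2 uea^2^2"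
  where "dlambda_L_mat \<sigma> \<tau> l s =
    (\<chi> i j. uea_of (aff_deriv (\<lambda>l. L_op \<sigma> \<tau> l s $ i $ j) l))"

text \<open>
  Matrices acting in \<open>\<complex>\<^sup>2 \<otimes> \<complex>\<^sup>2\<close> are indexed by pairs; the standard ordered basis corresponds to
  the order \<open>(1,1), (1,2), (2,1), (2,2)\<close>.
\<close>

definition tensor1 :: "'a::zero^2^2 \<Rightarrow> 'a^(2 \<times> 2)^(2 \<times> 2)"
  where "tensor1 M = (\<chi> i j. if snd i = snd j then M $ fst i $ fst j else 0)"

definition tensor2 :: "'a::zero^2^2 \<Rightarrow> 'a^(2 \<times> 2)^(2 \<times> 2)"
  where "tensor2 M = (\<chi> i j. if fst i = fst j then M $ snd i $ snd j else 0)"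

definition H_mat :: "'a::ring_1^2^2"
  where "H_mat = vector [vector [1, 0], vector [0, - 1]]"

type_synonym kernel_matrix = "kernel^(2 \<times> 2)^(2 \<times> 2)"

definition r_mat :: "complex \<Rightarrow> complex \<Rightarrow> kernel_matrix"
  where "r_mat \<tau> l = (\<chi> i j.
    if i = j then (\<lambda>s t. (if fst i = snd i then 1/2 else - 1/2) * diff_kernel (green \<tau>) s t)
    else if i = (1, 2) \<and> j = (2, 1) then diff_kernel (green_twisted Plus \<tau> (- l))
    else if i = (2, 1) \<and> j = (1, 2) then diff_kernel (green_twisted Plus \<tau> l)
    else (\<lambda>s t. 0))"

definition dlambda_r_mat :: "complex \<Rightarrow> complex \<Rightarrow> kernel_matrix"
  where "dlambda_r_mat \<tau> l = (\<chi> i j. (\<lambda>s t. deriv (\<lambda>l. (r_mat \<tau> l $ i $ j) s t) l))"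

definition dtau_r_mat :: "complex \<Rightarrow> complex \<Rightarrow> kernel_matrix"
  where "dtau_r_mat \<tau> l = (\<chi> i j. (\<lambda>s t. deriv (\<lambda>\<tau>. (r_mat \<tau> l $ i $ j) s t) \<tau>))"

definition du_r_mat :: "complex \<Rightarrow> complex \<Rightarrow> kernel_matrix"
  where "du_r_mat \<tau> l = (\<chi> i j. (\<lambda>s t. - (r_mat \<tau> l $ i $ j) (kdiff s) t))"

text \<open>The value on \<open>s(u) t(v)\<close> of \<open>x R(u,v)\<close>, for an element \<open>x\<close> of the Lie algebra.\<close>

definition kernel_times ::
    "affine_sl2 \<Rightarrow> kernel_matrix \<Rightarrow> ktest \<Rightarrow> ktest \<Rightarrow> affine_sl2 uea^(2 \<times> 2)^(2 \<times> 2)"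
  where "kernel_times x R s t = (\<chi> i j. (R $ i $ j) s t *\<^sub>C uea_of x)"

definition commutator :: "'a::ring_1^'n^'n \<Rightarrow> 'a^'n^'n \<Rightarrow> 'a^'n^'n"
  where "commutator A B = A ** B - B ** A"

text \<open>The values on \<open>s(u) t(v)\<close> of \<open>[X(u), R(u,v)]\<close> and \<open>[X(v), R(u,v)]\<close>.\<close>

definition comm_kernel_u ::
    "(ktest \<Rightarrow> 'a::ring_1^(2 \<times> 2)^(2 \<times> 2)) \<Rightarrow> kernel_matrix \<Rightarrow> ktest \<Rightarrow> ktest \<Rightarrow> 'a^(2 \<times> 2)^(2 \<times> 2)"
  where "comm_kernel_u X R s t = (\<chi> i j.
    (\<Sum>k\<in>UNIV. kernel_mult_u (R $ k $ j) (\<lambda>s. X s $ i $ k) s t) -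
    (\<Sum>k\<in>UNIV. kernel_mult_u (R $ i $ k) (\<lambda>s. X s $ k $ j) s t))"

definition comm_kernel_v ::
    "(ktest \<Rightarrow> 'a::ring_1^(2 \<times> 2)^(2 \<times> 2)) \<Rightarrow> kernel_matrix \<Rightarrow> ktest \<Rightarrow> ktest \<Rightarrow> 'a^(2 \<times> 2)^(2 \<times> 2)"
  where "comm_kernel_v X R s t = (\<chi> i j.
    (\<Sum>k\<in>UNIV. kernel_mult_v (R $ k $ j) (\<lambda>t. X t $ i $ k) s t) -
    (\<Sum>k\<in>UNIV. kernel_mult_v (R $ i $ k) (\<lambda>t. X t $ k $ j) s t))"

text \<open>
  A distribution in one of the variables \<open>u, v\<close> only is read as a distribution in both by
  multiplying with the constant function 1 of the other variable; on \<open>s(u) t(v)\<close> the latter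
  contributes the factor \<open>\<langle>1, s\<rangle>\<close> or \<open>\<langle>1, t\<rangle>\<close>.
\<close>

definition const_u :: "(ktest \<Rightarrow> 'a::complex_space^'n^'m) \<Rightarrow> ktest \<Rightarrow> ktest \<Rightarrow> 'a^'n^'m"
  where "const_u X s t = map_matrix ((*\<^sub>C) (sprod 1 s)) (X t)"

definition const_v :: "(ktest \<Rightarrow> 'a::complex_space^'n^'m) \<Rightarrow> ktest \<Rightarrow> ktest \<Rightarrow> 'a^'n^'m"
  where "const_v X s t = map_matrix ((*\<^sub>C) (sprod 1 t)) (X s)"

end

theory Submission
  imports Defs
begin

text \<open>
  A test function is entire, has period 1 and grows at most exponentially in the imaginary
  direction, so it is a trigonometric polynomial, a finite combination of
  \<open>e\<^sub>n(u) = exp (2 \<pi> \<i> n u)\<close> (\<open>ktest_eq_kexp_sum\<close>).  The Green kernels depend on \<open>u - v\<close> only and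
  therefore act diagonally on the \<open>e\<^sub>n\<close>; the whole statement becomes an identity between their
  eigenvalues.

  The eigenvalues come from shifting contours.  Crossing the height 0 contributes the residue 1 of
  the simple pole there, and the quasi-periodicity of \<open>\<theta>\<close> relates the segment above to the segment
  one period \<open>\<tau>\<close> below it.  Together these two linear equations give, with \<open>q = exp (2 \<pi> \<i> \<tau>)\<close> and
  \<open>x = exp (2 \<pi> \<i> \<lambda>)\<close>, the eigenvalue \<open>c\<^sub>n(\<lambda>) = 1 / (1 - q^n / x)\<close> of the kernel
  \<open>\<G>\<^sub>\<lambda>\<^sup>+\<close>, the eigenvalue \<open>c\<^sub>n(\<lambda>) - 1\<close> of \<open>\<G>\<^sub>\<lambda>\<^sup>-\<close>, and \<open>a\<^sub>n = 1 / (1 - q^n)\<close> for \<open>\<G>\<close> if \<open>n \<noteq> 0\<close>; for \<open>n = 0\<close> the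
  second equation degenerates, and \<open>a\<^sub>0 = 1/2\<close> because \<open>\<theta>' / \<theta>\<close> is odd
  (\<open>green_twisted_kexp\<close>, \<open>green_kexp\<close>).

  Every component of the relations outside the centre is an instance of one addition formula
  (\<open>multiplier_addition\<close>),
  \<open>a\<^sub>n c\<^sub>m = c\<^sub>n\<^sub>+\<^sub>m (a\<^sub>n + c\<^sub>m - 1) - [n = 0] c\<^sub>m (c\<^sub>m - 1)\<close>,
  together with the reflections \<open>a\<^sub>-\<^sub>n = 1 - a\<^sub>n\<close> and \<open>c\<^sub>-\<^sub>n(-\<lambda>) = 1 - c\<^sub>n(\<lambda>)\<close>.  The term with \<open>n = 0\<close> is
  a multiple of \<open>\<partial>c\<^sub>m / \<partial>\<lambda> = - 2 \<pi> \<i> c\<^sub>m (c\<^sub>m - 1)\<close> and produces the derivatives with respect to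
  \<open>\<lambda>\<close>.  The cocycle evaluates to \<open>n a\<^sub>n a\<^sub>-\<^sub>n = - n a\<^sub>n (a\<^sub>n - 1)\<close>, which up to \<open>2 \<pi> \<i>\<close> is
  \<open>- \<partial>a\<^sub>n / \<partial>\<tau>\<close>; likewise for the \<open>c\<^sub>n\<close>.  If the two signs differ, one factor is lowered by 1 and
  the additional term \<open>n a\<^sub>n\<close> is the derivative with respect to \<open>u\<close>.

  What remains is that \<open>\<theta>\<close> exists, is unique, and has simple zeros exactly at the lattice points.
  The infinite product for it supplies existence and the zeros; Liouville's theorem, applied to the
  quotient of two candidates, supplies uniqueness.
\<close>

section \<open>The theta function\<close>

definition period_lattice :: "complex \<Rightarrow> complex set"
  where "period_lattice \<tau> = {of_int m + of_int n * \<tau> | m n. True}"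

text \<open>
  The \<open>q\<close>-Pochhammer symbol \<open>(x; q)\<^sub>\<infinity>\<close>.
\<close>

definition euler_prod :: "complex \<Rightarrow> complex \<Rightarrow> complex"
  where "euler_prod q x = prodinf (\<lambda>n. 1 - q ^ n * x)"

lemma convergent_euler_prod:
  assumes "cmod q < 1"
  shows "convergent_prod (\<lambda>n. 1 - q ^ n * x)"
proof -
  have "summable (\<lambda>n. cmod ((1 - q ^ n * x) - 1))"
    using assms by (auto simp: norm_mult norm_power intro!: summable_mult2 summable_geometric)
  then show ?thesis
    by (intro abs_convergent_prod_imp_convergent_prod) (simp only: abs_convergent_prod_conv_summable)
qed

lemma euler_prod_LIMSEQ:
  assumes "cmod q < 1"
  shows "(\<lambda>n. \<Prod>i\<le>n. 1 - q ^ i * x) \<longlonglongrightarrow> euler_prod q x"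
  unfolding euler_prod_def by (rule convergent_prod_LIMSEQ[OF convergent_euler_prod[OF assms]])

lemma euler_prod_shift:
  assumes "cmod q < 1"
  shows "euler_prod q x = (1 - x) * euler_prod q (q * x)"
proof -
  have "(\<Prod>i\<le>Suc n. 1 - q ^ i * x) = (1 - x) * (\<Prod>i\<le>n. 1 - q ^ i * (q * x))" for n
    by (simp only: prod.atMost_Suc_shift) (simp add: mult_ac)
  then have "(\<lambda>n. (1 - x) * (\<Prod>i\<le>n. 1 - q ^ i * (q * x))) \<longlonglongrightarrow> euler_prod q x"
    using LIMSEQ_Suc[OF euler_prod_LIMSEQ[OF assms, of x]] by simp
  moreover have "(\<lambda>n. (1 - x) * (\<Prod>i\<le>n. 1 - q ^ i * (q * x))) \<longlonglongrightarrow>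
      (1 - x) * euler_prod q (q * x)"
    by (intro tendsto_mult_left euler_prod_LIMSEQ assms)
  ultimately show ?thesis by (rule LIMSEQ_unique)
qed

lemma euler_prod_nonzero:
  assumes "cmod q < 1" "\<And>n. q ^ n * x \<noteq> 1"
  shows "euler_prod q x \<noteq> 0"
  unfolding euler_prod_def
  by (rule prodinf_nonzero[OF convergent_euler_prod[OF assms(1)]]) (use assms(2) in fastforce)

lemma euler_prod_holomorphic:
  assumes "cmod q < 1"
  shows "euler_prod q holomorphic_on UNIV"
proof (rule holomorphic_uniform_sequence)
  show "(\<lambda>x. \<Prod>i<n. 1 - q ^ i * x) holomorphic_on UNIV" for n
    by (intro holomorphic_intros)
  fix x :: complex
  have "uniform_limit (cball x 1) (\<lambda>n x. \<Prod>i<n. 1 - q ^ i * x) (euler_prod q) sequentially"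
  proof -
    have "uniformly_convergent_on (cball x 1) (\<lambda>N y. \<Sum>n<N. norm ((1 - q ^ n * y) - 1))"
    proof (rule Weierstrass_m_test'_ev)
      show "\<forall>\<^sub>F n in sequentially. \<forall>y\<in>cball x 1.
          norm (norm ((1 - q ^ n * y) - 1)) \<le> (cmod x + 1) * cmod q ^ n"
      proof (intro always_eventually allI ballI)
        fix n y assume "y \<in> cball x 1"
        then have "cmod y \<le> cmod x + 1"
          using norm_triangle_ineq2[of y x] by (simp add: dist_norm norm_minus_commute)
        then show "norm (norm ((1 - q ^ n * y) - 1)) \<le> (cmod x + 1) * cmod q ^ n"
          by (simp add: norm_mult norm_power mult.commute mult_right_mono)
      qed
      show "summable (\<lambda>n. (cmod x + 1) * cmod q ^ n)"
        using assms by (intro summable_mult summable_geometric) auto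
    qed
    then have "uniformly_convergent_on (cball x 1) (\<lambda>N y. \<Prod>n<N. 1 - q ^ n * y)"
      by (intro uniformly_convergent_on_prod') (auto intro!: continuous_intros)
    then obtain g where g: "uniform_limit (cball x 1) (\<lambda>N y. \<Prod>n<N. 1 - q ^ n * y) g sequentially"
      by (auto simp: uniformly_convergent_on_def)
    have "g y = euler_prod q y" if "y \<in> cball x 1" for y
    proof -
      have "(\<lambda>N. \<Prod>n<N. 1 - q ^ n * y) \<longlonglongrightarrow> g y"
        by (rule tendsto_uniform_limitI[OF g that])
      then show ?thesis
        using euler_prod_LIMSEQ[OF assms, of y] LIMSEQ_lessThan_iff_atMost LIMSEQ_unique by blast
    qed
    then show ?thesis
      by (intro uniform_limit_cong'[THEN iffD1, OF _ _ g]) auto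
  qed
  then show "\<exists>d>0. cball x d \<subseteq> UNIV \<and>
      uniform_limit (cball x d) (\<lambda>n x. \<Prod>i<n. 1 - q ^ i * x) (euler_prod q) sequentially"
    by (intro exI[of _ 1]) auto
qed auto

definition exp2pi :: "complex \<Rightarrow> complex"
  where "exp2pi \<tau> = exp (2 * of_real pi * \<i> * \<tau>)"

lemma cmod_exp2pi: "Im \<tau> > 0 \<Longrightarrow> cmod (exp2pi \<tau>) < 1"
  by (simp add: exp2pi_def)

text \<open>
  Jacobi's triple product without the factor that depends on \<open>\<tau>\<close> only; the exponential turns the
  first factor \<open>1 - exp (2 \<pi> \<i> u)\<close> into a sine (\<open>theta_prod_eq\<close>), which makes the function odd.
\<close>

definition theta_prod :: "complex \<Rightarrow> complex \<Rightarrow> complex"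
  where "theta_prod \<tau> u = exp (- (of_real pi * \<i> * u)) * euler_prod (exp2pi \<tau>) (exp2pi u)
    * euler_prod (exp2pi \<tau>) (exp2pi (\<tau> - u))"

lemma exp2pi_add: "exp2pi (a + b) = exp2pi a * exp2pi b"
  by (simp add: exp2pi_def distrib_left exp_add)

lemma exp2pi_eq_1_iff: "exp2pi u = 1 \<longleftrightarrow> (\<exists>m::int. u = of_int m)"
proof -
  have "exp2pi u = 1 \<longleftrightarrow> Im u = 0 \<and> (\<exists>m::int. Re u = of_int m)"
    unfolding exp2pi_def exp_eq_1 by simp
  then show ?thesis by (auto simp: complex_eq_iff)
qed

lemma exp2pi_int: "exp2pi (of_int m) = 1"
  using exp2pi_eq_1_iff by blast

lemma exp2pi_holomorphic: "g holomorphic_on A \<Longrightarrow> (\<lambda>u. exp2pi (g u)) holomorphic_on A"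
  unfolding exp2pi_def by (intro holomorphic_intros)

lemma euler_prod_compose_holomorphic:
  assumes "Im \<tau> > 0" "g holomorphic_on UNIV"
  shows "(\<lambda>u. euler_prod (exp2pi \<tau>) (g u)) holomorphic_on UNIV"
  using holomorphic_on_compose_gen[OF assms(2) euler_prod_holomorphic[OF cmod_exp2pi[OF assms(1)]]]
  by (simp add: comp_def)

lemma theta_prod_holomorphic:
  assumes "Im \<tau> > 0"
  shows "theta_prod \<tau> holomorphic_on UNIV"
  unfolding theta_prod_def
  by (intro holomorphic_on_mult euler_prod_compose_holomorphic[OF assms] exp2pi_holomorphic
      holomorphic_intros)

text \<open>
  Splitting off the sine exhibits the oddness and the simple zero at 0 at once.
\<close>

lemma theta_prod_eq:
  assumes "Im \<tau> > 0"
  shows "theta_prod \<tau> u = - 2 * \<i> * sin (of_real pi * u) *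
    (euler_prod (exp2pi \<tau>) (exp2pi (\<tau> + u)) * euler_prod (exp2pi \<tau>) (exp2pi (\<tau> - u)))"
proof -
  have "exp (- (of_real pi * \<i> * u)) * (1 - exp2pi u) = - 2 * \<i> * sin (of_real pi * u)"
  proof -
    have "exp2pi u = exp (\<i> * (of_real pi * u)) * exp (\<i> * (of_real pi * u))"
      by (simp add: exp2pi_def mult_ac flip: exp_add)
    moreover have "exp (- (of_real pi * \<i> * u)) = inverse (exp (\<i> * (of_real pi * u)))"
      by (simp add: mult_ac flip: exp_minus)
    moreover have "sin (of_real pi * u) =
        (exp (\<i> * (of_real pi * u)) - inverse (exp (\<i> * (of_real pi * u)))) / (2 * \<i>)"
      by (simp only: sin_exp_eq exp_minus)
    moreover have "inverse z * (1 - z * z) = - 2 * \<i> * ((z - inverse z) / (2 * \<i>))" if "z \<noteq> 0" for z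
    proof -
      have "inverse z * (1 - z * z) = inverse z - z"
        using that by (simp add: right_diff_distrib flip: mult.assoc)
      moreover have "- 2 * \<i> * ((z - inverse z) / (2 * \<i>)) = inverse z - z" by simp
      ultimately show ?thesis by simp
    qed
    ultimately show ?thesis by (simp only: exp_not_eq_zero not_False_eq_True)
  qed
  then show ?thesis
    unfolding theta_prod_def euler_prod_shift[OF cmod_exp2pi[OF assms], of "exp2pi u"] exp2pi_add
    by (simp only: mult.assoc[symmetric])
qed

lemma theta_prod_odd: "Im \<tau> > 0 \<Longrightarrow> theta_prod \<tau> (- u) = - theta_prod \<tau> u"
  by (simp add: theta_prod_eq)

lemma theta_prod_add_1: "theta_prod \<tau> (u + 1) = - theta_prod \<tau> u"
proof -
  have "exp2pi (u + 1) = exp2pi u" "exp2pi (\<tau> - (u + 1)) = exp2pi (\<tau> - u)"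
    using exp2pi_int[of 1] exp2pi_int[of "-1"] exp2pi_add[of u 1] exp2pi_add[of "\<tau> - u" "-1"]
    by (simp_all add: algebra_simps)
  moreover have "exp (- (of_real pi * \<i> * (u + 1))) = - exp (- (of_real pi * \<i> * u))"
    by (simp add: distrib_left exp_add exp_minus exp_diff)
  ultimately show ?thesis by (simp add: theta_prod_def)
qed

text \<open>
  Adding \<open>\<tau>\<close> moves one factor from the first product to the second, by \<open>euler_prod_shift\<close>.
\<close>

lemma theta_prod_add_tau:
  assumes "Im \<tau> > 0"
  shows "theta_prod \<tau> (u + \<tau>) =
    - exp (- 2 * of_real pi * \<i> * u - of_real pi * \<i> * \<tau>) * theta_prod \<tau> u"
proof -
  let ?P = "euler_prod (exp2pi \<tau>)"
  have *: "?P (exp2pi (- u)) = (1 - exp2pi (- u)) * ?P (exp2pi (\<tau> - u))"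
    using euler_prod_shift[OF cmod_exp2pi[OF assms], of "exp2pi (- u)"]
    by (simp flip: exp2pi_add)
  have A: "exp (- (of_real pi * \<i> * (u + \<tau>))) * (1 - exp2pi (- u)) =
      - exp (- 2 * of_real pi * \<i> * u - of_real pi * \<i> * \<tau>) * (exp (- (of_real pi * \<i> * u)) * (1 - exp2pi u))"
  proof -
    have "exp2pi (- u) = 1 / exp2pi u" "exp (- 2 * of_real pi * \<i> * u - of_real pi * \<i> * \<tau>) =
        exp (- (of_real pi * \<i> * \<tau>)) / exp2pi u"
      "exp (- (of_real pi * \<i> * (u + \<tau>))) =
        exp (- (of_real pi * \<i> * \<tau>)) * exp (- (of_real pi * \<i> * u))"
      by (simp_all add: exp2pi_def exp_diff exp_minus distrib_left exp_add divide_simps)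
    moreover have "exp2pi u \<noteq> 0" by (simp add: exp2pi_def)
    ultimately show ?thesis by (simp only:) (simp add: divide_simps, simp add: algebra_simps)
  qed
  have B: "?P (exp2pi u) = (1 - exp2pi u) * ?P (exp2pi (u + \<tau>))"
    using euler_prod_shift[OF cmod_exp2pi[OF assms], of "exp2pi u"]
    by (simp add: add.commute flip: exp2pi_add)
  have "theta_prod \<tau> (u + \<tau>) = exp (- (of_real pi * \<i> * (u + \<tau>))) * (1 - exp2pi (- u)) *
      (?P (exp2pi (u + \<tau>)) * ?P (exp2pi (\<tau> - u)))"
    by (simp add: theta_prod_def * mult_ac)
  also have "\<dots> = - exp (- 2 * of_real pi * \<i> * u - of_real pi * \<i> * \<tau>) * theta_prod \<tau> u"
    unfolding A theta_prod_def B by (simp only: mult_ac)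
  finally show ?thesis .
qed

lemma theta_prod_zeros:
  assumes "Im \<tau> > 0" "theta_prod \<tau> u = 0"
  shows "u \<in> period_lattice \<tau>"
proof (rule ccontr)
  assume u: "u \<notin> period_lattice \<tau>"
  have pow: "exp2pi \<tau> ^ n * exp2pi v = exp2pi (of_nat n * \<tau> + v)" for n v
    by (simp add: exp2pi_def distrib_left exp_add exp_of_nat_mult[symmetric] mult_ac)
  have ne: "of_nat n * \<tau> + u \<noteq> of_int m" for n :: nat and m :: int
  proof
    assume "of_nat n * \<tau> + u = of_int m"
    then have "u = of_int m + of_int (- int n) * \<tau>" by (simp add: algebra_simps)
    then show False using u unfolding period_lattice_def by blast
  qed
  have ne': "of_nat n * \<tau> + (\<tau> - u) \<noteq> of_int m" for n :: nat and m :: int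
  proof
    assume "of_nat n * \<tau> + (\<tau> - u) = of_int m"
    then have "u = of_int (- m) + of_int (int n + 1) * \<tau>" by (simp add: algebra_simps)
    then show False using u unfolding period_lattice_def by blast
  qed
  have "euler_prod (exp2pi \<tau>) (exp2pi u) \<noteq> 0" "euler_prod (exp2pi \<tau>) (exp2pi (\<tau> - u)) \<noteq> 0"
    by (rule euler_prod_nonzero[OF cmod_exp2pi[OF assms(1)]]; simp add: pow exp2pi_eq_1_iff ne ne')+
  then show False using assms(2) by (simp add: theta_prod_def)
qed

lemma theta_prod_deriv_0:
  assumes "Im \<tau> > 0"
  shows "deriv (theta_prod \<tau>) 0 \<noteq> 0"
proof -
  let ?E = "\<lambda>u. euler_prod (exp2pi \<tau>) (exp2pi (\<tau> + u)) * euler_prod (exp2pi \<tau>) (exp2pi (\<tau> - u))"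
  have "?E holomorphic_on UNIV"
    by (intro holomorphic_on_mult euler_prod_compose_holomorphic[OF assms] exp2pi_holomorphic
        holomorphic_intros)
  then have E: "(?E has_field_derivative deriv ?E 0) (at 0)"
    by (simp add: holomorphic_derivI)
  have "((\<lambda>u. - 2 * \<i> * sin (of_real pi * u) * ?E u) has_field_derivative - 2 * \<i> * of_real pi * ?E 0) (at 0)"
    by (rule derivative_eq_intros E refl | simp)+
  then have d: "deriv (theta_prod \<tau>) 0 = - 2 * \<i> * of_real pi * ?E 0"
    unfolding theta_prod_eq[OF assms, abs_def] by (rule DERIV_imp_deriv)
  have "exp2pi \<tau> ^ n * exp2pi \<tau> \<noteq> 1" for n
  proof -
    have "cmod (exp2pi \<tau> ^ Suc n) < 1"
      using cmod_exp2pi[OF assms] by (simp only: norm_power power_Suc_less_one norm_ge_zero)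
        (metis norm_ge_zero power_Suc_less_one less_eq_real_def norm_eq_zero exp2pi_def exp_not_eq_zero)
    then show ?thesis by (metis norm_one less_irrefl power_Suc2)
  qed
  then have "euler_prod (exp2pi \<tau>) (exp2pi \<tau>) \<noteq> 0"
    by (intro euler_prod_nonzero cmod_exp2pi assms)
  then show ?thesis by (simp add: d)
qed

lemma is_theta_theta_prod:
  assumes "Im \<tau> > 0"
  shows "is_theta \<tau> (\<lambda>u. theta_prod \<tau> u / deriv (theta_prod \<tau>) 0)"
proof -
  have "(theta_prod \<tau> has_field_derivative deriv (theta_prod \<tau>) 0) (at 0)"
    by (rule holomorphic_derivI[OF theta_prod_holomorphic[OF assms]]) auto
  then have "((\<lambda>u. theta_prod \<tau> u / deriv (theta_prod \<tau>) 0) has_field_derivative 1) (at 0)"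
    using theta_prod_deriv_0[OF assms] by (metis DERIV_cdivide divide_self)
  then have "deriv (\<lambda>u. theta_prod \<tau> u / deriv (theta_prod \<tau>) 0) 0 = 1"
    by (rule DERIV_imp_deriv)
  moreover have "(\<lambda>u. theta_prod \<tau> u / deriv (theta_prod \<tau>) 0) holomorphic_on UNIV"
    using theta_prod_deriv_0[OF assms]
    by (intro holomorphic_on_divide theta_prod_holomorphic assms holomorphic_on_const)
  ultimately show ?thesis
    unfolding is_theta_def
    by (simp add: theta_prod_odd[OF assms] theta_prod_add_1 theta_prod_add_tau[OF assms])
qed

lemma periodic_of_int:
  fixes f :: "complex \<Rightarrow> 'a"
  assumes "\<And>u. f (u + p) = f u"
  shows "f (u + of_int n * p) = f u"
proof (induction n rule: int_induct[of _ 0])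
  case (step1 i)
  then show ?case using assms[of "u + of_int i * p"] by (simp add: algebra_simps)
next
  case (step2 i)
  then show ?case using assms[of "u + of_int (i - 1) * p"] by (simp add: algebra_simps)
qed simp

lemma lattice_periodic:
  fixes f :: "complex \<Rightarrow> 'a"
  assumes "\<And>u. f (u + 1) = f u" "\<And>u. f (u + \<tau>) = f u" "w \<in> period_lattice \<tau>"
  shows "f (u + w) = f u"
proof -
  obtain m n where w: "w = of_int m + of_int n * \<tau>"
    using assms(3) unfolding period_lattice_def by blast
  have "f (u + w) = f ((u + of_int m * 1) + of_int n * \<tau>)" by (simp add: w add.assoc)
  also have "\<dots> = f (u + of_int m * 1)" by (rule periodic_of_int, rule assms(2))
  also have "\<dots> = f u" by (rule periodic_of_int, rule assms(1))
  finally show ?thesis .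
qed

lemma zero_in_period_lattice: "0 \<in> period_lattice \<tau>"
proof -
  have "0 = of_int 0 + of_int 0 * \<tau>" by simp
  then show ?thesis unfolding period_lattice_def by blast
qed

lemma period_lattice_uminus: "u \<in> period_lattice \<tau> \<Longrightarrow> - u \<in> period_lattice \<tau>"
proof -
  assume "u \<in> period_lattice \<tau>"
  then obtain m n where "u = of_int m + of_int n * \<tau>" by (auto simp: period_lattice_def)
  then have "- u = of_int (- m) + of_int (- n) * \<tau>" by simp
  then show ?thesis unfolding period_lattice_def by blast
qed

lemma is_theta_lattice_zero:
  assumes "is_theta \<tau> f" "u \<in> period_lattice \<tau>"
  shows "f u = 0"
proof -
  have "(f (0 + u) = 0) = (f 0 = 0)"
    using assms(1) by (intro lattice_periodic[of "\<lambda>u. f u = 0", OF _ _ assms(2)]; simp add: is_theta_def)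
  moreover have "f (- 0) = - f 0" using assms(1) unfolding is_theta_def by blast
  then have "f 0 = 0" by simp
  ultimately show ?thesis by simp
qed

text \<open>
  Such a function takes all its values on the compact fundamental parallelogram, so Liouville's
  theorem applies.
\<close>

lemma entire_doubly_periodic_const:
  assumes "h holomorphic_on UNIV" "\<And>u. h (u + 1) = h u" "\<And>u. h (u + \<tau>) = h u" "Im \<tau> > 0"
  shows "h u = h v"
proof -
  let ?D = "(\<lambda>p. of_real (fst p) + of_real (snd p) * \<tau>) ` ({0..1::real} \<times> {0..1::real})"
  have "compact ?D"
    by (intro compact_continuous_image continuous_intros compact_Times compact_Icc)
  then have "compact (h ` ?D)"
    using assms(1) by (meson compact_continuous_image continuous_on_subset
        holomorphic_on_imp_continuous_on subset_UNIV)
  moreover have "range h \<subseteq> h ` ?D"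
  proof
    fix y assume "y \<in> range h"
    then obtain u where u: "y = h u" by blast
    define b where "b = Im u / Im \<tau>"
    define a where "a = Re u - b * Re \<tau>"
    have "u = of_real a + of_real b * \<tau>"
      using assms(4) by (simp add: complex_eq_iff a_def b_def)
    then have "u = (of_real (frac a) + of_real (frac b) * \<tau>) + (of_int \<lfloor>a\<rfloor> + of_int \<lfloor>b\<rfloor> * \<tau>)"
      by (simp add: frac_def algebra_simps)
    then have "y = h (of_real (frac a) + of_real (frac b) * \<tau>)"
      using lattice_periodic[of h \<tau> "of_int \<lfloor>a\<rfloor> + of_int \<lfloor>b\<rfloor> * \<tau>", OF assms(2,3)] u
      unfolding period_lattice_def by blast
    moreover have "(frac a, frac b) \<in> {0..1} \<times> {0..1}"
      using frac_lt_1[of a] frac_lt_1[of b] by auto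
    ultimately show "y \<in> h ` ?D" by force
  qed
  ultimately have "bounded (range h)" using bounded_subset compact_imp_bounded by blast
  then have "h constant_on UNIV" by (rule Liouville_theorem[OF assms(1)])
  then obtain c where "\<And>x. h x = c" unfolding constant_on_def by blast
  then show ?thesis by simp
qed

lemma entire_divided_difference:
  assumes "f holomorphic_on UNIV" "f a = (0::complex)"
  shows "(\<lambda>z. if z = a then deriv f a else f z / (z - a)) holomorphic_on UNIV"
  using pole_lemma_open[OF assms(1), of a] unfolding assms(2) diff_0_right by simp

text \<open>
  Both functions vanish on the lattice by oddness and quasi-periodicity, and \<open>g\<close> vanishes nowhere else.
  Since the derivatives at 0 are equal to 1, the quotient extends to the lattice with value 1, and it is
  doubly periodic because the two factors of automorphy cancel.
\<close>

lemma is_theta_unique: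
  assumes "Im \<tau> > 0" "is_theta \<tau> f" "is_theta \<tau> g" "\<And>u. g u = 0 \<Longrightarrow> u \<in> period_lattice \<tau>"
  shows "f = g"
proof -
  note f = assms(2)[unfolded is_theta_def] and g = assms(3)[unfolded is_theta_def]
  \<comment> \<open>At the common zeros the quotient is given the value 1, the quotient of the derivatives at 0.\<close>
  define h where "h u = (if g u = 0 then 1 else f u / g u)" for u
  have per: "h (u + 1) = h u" "h (u + \<tau>) = h u" for u
    using f g by (auto simp: h_def)
  have f0: "f 0 = 0" and g0: "g 0 = 0"
    using is_theta_lattice_zero[OF _ zero_in_period_lattice] assms(2,3) by blast+
  \<comment> \<open>Near 0 both functions are divided by \<open>z\<close>, after which the denominator does not vanish.\<close>
  define F where "F = (\<lambda>z. if z = 0 then deriv f 0 else f z / (z - 0))"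
  define G where "G = (\<lambda>z. if z = 0 then deriv g 0 else g z / (z - 0))"
  have hol: "F holomorphic_on UNIV" "G holomorphic_on UNIV"
    unfolding F_def G_def using f g f0 g0 by (intro entire_divided_difference; simp)+
  have "\<exists>d>0. \<forall>y. dist 0 y < d \<longrightarrow> G y \<noteq> 0"
  proof (rule continuous_on_open_avoid)
    show "continuous_on UNIV G" using hol(2) by (rule holomorphic_on_imp_continuous_on)
    show "G 0 \<noteq> 0" using g by (simp add: G_def)
  qed auto
  then obtain d where d: "d > 0" "\<And>y. y \<in> ball 0 d \<Longrightarrow> G y \<noteq> 0" by auto
  have "(\<lambda>z. F z / G z) holomorphic_on ball 0 d"
    using hol d(2) by (intro holomorphic_on_divide) (auto intro: holomorphic_on_subset)
  moreover have "F z / G z = h z" if "z \<in> ball 0 d" for z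
    using d(2)[OF that] f g g0 by (auto simp: F_def G_def h_def split: if_splits)
  ultimately have "h holomorphic_on ball 0 d" by (rule holomorphic_transform)
  then have diff0: "h field_differentiable at 0"
    using d(1) by (auto intro: holomorphic_on_imp_differentiable_at)
  have "h field_differentiable at u" for u
  proof (cases "g u = 0")
    case True
    \<comment> \<open>A translation by the lattice vector \<open>- u\<close> reduces this to the point 0.\<close>
    then have "- u \<in> period_lattice \<tau>" using assms(4) period_lattice_uminus by blast
    then have "h = h \<circ> (\<lambda>z. z - u)"
      using lattice_periodic[of h \<tau> "- u", OF per] by (simp add: fun_eq_iff)
    moreover have "h \<circ> (\<lambda>z. z - u) field_differentiable at u"
      using diff0 by (intro field_differentiable_compose) (auto intro!: derivative_intros)
    ultimately show ?thesis by simp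
  next
    case False
    have "open {z. g z \<noteq> 0}"
      using g by (intro open_Collect_neq holomorphic_on_imp_continuous_on continuous_on_const) auto
    moreover have "h holomorphic_on {z. g z \<noteq> 0}"
    proof -
      have "(\<lambda>z. f z / g z) holomorphic_on {z. g z \<noteq> 0}"
        using f g by (intro holomorphic_on_divide) (auto intro: holomorphic_on_subset)
      then show ?thesis by (rule holomorphic_transform) (simp add: h_def)
    qed
    ultimately show ?thesis using False holomorphic_on_imp_differentiable_at by blast
  qed
  then have "h holomorphic_on UNIV"
    by (simp add: holomorphic_on_def field_differentiable_at_within)
  then have h1: "h u = h 0" for u
    by (rule entire_doubly_periodic_const[OF _ per assms(1)])
  show ?thesis
  proof
    fix u
    show "f u = g u"
    proof (cases "g u = 0")
      case True
      then show ?thesis using assms(2,4) is_theta_lattice_zero by metis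
    next
      case False
      then show ?thesis using h1[of u] g0 by (simp add: h_def)
    qed
  qed
qed

lemma theta_eq_prod:
  assumes "Im \<tau> > 0"
  shows "theta \<tau> = (\<lambda>u. theta_prod \<tau> u / deriv (theta_prod \<tau>) 0)"
  unfolding theta_def
proof (rule the_equality)
  show "is_theta \<tau> (\<lambda>u. theta_prod \<tau> u / deriv (theta_prod \<tau>) 0)"
    by (rule is_theta_theta_prod[OF assms])
  fix f assume "is_theta \<tau> f"
  then show "f = (\<lambda>u. theta_prod \<tau> u / deriv (theta_prod \<tau>) 0)"
    by (rule is_theta_unique[OF assms _ is_theta_theta_prod[OF assms]])
      (use theta_prod_zeros[OF assms] theta_prod_deriv_0[OF assms] in simp)
qed

lemma is_theta_theta: "Im \<tau> > 0 \<Longrightarrow> is_theta \<tau> (theta \<tau>)"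
  by (simp only: theta_eq_prod is_theta_theta_prod)

lemma theta_eq_0_iff:
  assumes "Im \<tau> > 0"
  shows "theta \<tau> u = 0 \<longleftrightarrow> u \<in> period_lattice \<tau>"
proof
  assume "theta \<tau> u = 0"
  then show "u \<in> period_lattice \<tau>"
    using theta_prod_zeros[OF assms] theta_prod_deriv_0[OF assms] by (auto simp: theta_eq_prod[OF assms])
qed (rule is_theta_lattice_zero[OF is_theta_theta[OF assms]])

section \<open>Test functions are trigonometric polynomials\<close>

lift_definition kexp :: "int \<Rightarrow> ktest" is "\<lambda>n u. exp (2 * of_real pi * \<i> * of_int n * u)"
proof (intro conjI allI)
  fix n :: int
  show "(\<lambda>u. exp (2 * of_real pi * \<i> * of_int n * u)) holomorphic_on UNIV"
    by (intro holomorphic_intros)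
  fix u :: complex
  have "exp (2 * of_real pi * \<i> * of_int n * 1) = 1"
    unfolding exp_eq_1 by (auto intro: exI[of _ n])
  then show "exp (2 * of_real pi * \<i> * of_int n * (u + 1)) = exp (2 * of_real pi * \<i> * of_int n * u)"
    by (simp only: distrib_left exp_add) simp
next
  fix n :: int
  let ?p = "2 * pi * \<bar>real_of_int n\<bar> + 1"
  have "cmod (exp (2 * of_real pi * \<i> * of_int n * u)) \<le> 1 * exp (?p * \<bar>Im u\<bar>)" for u
  proof -
    have "- (2 * pi * real_of_int n * Im u) \<le> \<bar>2 * pi * real_of_int n * Im u\<bar>" by (rule abs_ge_minus_self)
    also have "\<dots> \<le> ?p * \<bar>Im u\<bar>" by (simp add: abs_mult distrib_right)
    finally show ?thesis by simp
  qed
  moreover have "?p > 0" by (simp add: add_nonneg_pos)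
  ultimately show "exp_bounded (\<lambda>u. exp (2 * of_real pi * \<i> * of_int n * u))"
    unfolding exp_bounded_def by (intro exI[of _ 1] exI[of _ ?p] conjI) auto
qed

lemma kapp_kexp: "kapp (kexp n) u = exp (2 * of_real pi * \<i> * of_int n * u)"
  by (simp add: kexp.rep_eq)

lemma kexp_mult: "kexp n * kexp m = kexp (n + m)"
  by (rule kapp_inject[THEN iffD1])
    (simp add: kexp.rep_eq times_ktest.rep_eq fun_eq_iff distrib_left distrib_right flip: exp_add)

lemma kexp_0: "kexp 0 = 1"
  by (rule kapp_inject[THEN iffD1]) (simp add: kexp.rep_eq one_ktest.rep_eq fun_eq_iff)

lemma kdiff_kexp: "kdiff (kexp n) = (2 * of_real pi * \<i> * of_int n) *\<^sub>C kexp n"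
proof -
  have "((\<lambda>u. exp (2 * of_real pi * \<i> * of_int n * u)) has_field_derivative
      2 * of_real pi * \<i> * of_int n * exp (2 * of_real pi * \<i> * of_int n * u)) (at u)" for u
    by (auto intro!: derivative_eq_intros)
  then have "deriv (\<lambda>u. exp (2 * of_real pi * \<i> * of_int n * u)) u =
      2 * of_real pi * \<i> * of_int n * exp (2 * of_real pi * \<i> * of_int n * u)" for u
    by (rule DERIV_imp_deriv)
  then show ?thesis
    by (intro kapp_inject[THEN iffD1])
      (simp add: kexp.rep_eq kdiff.rep_eq scaleC_ktest.rep_eq fun_eq_iff)
qed

lemma kdiff_1: "kdiff 1 = 0"
  using kdiff_kexp[of 0] by (simp add: kexp_0 kscale_0)

lemma kapp_diff: "kapp (s - t) u = kapp s u - kapp t u"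
  by (simp only: minus_ktest_def plus_ktest.rep_eq uminus_ktest.rep_eq) simp

lemma kapp_two_mult: "kapp (2 * s) u = 2 * kapp s u"
  by (simp only: mult_2 plus_ktest.rep_eq)

lemma ktest_eq_iff: "s = t \<longleftrightarrow> (\<forall>u. kapp s u = kapp t u)"
  by (subst kapp_inject[symmetric]) (rule fun_eq_iff)

lemma kapp_add_of_int: "kapp s (u + of_int n) = kapp s u"
proof (induction n rule: int_induct[of _ 0])
  case (step1 i)
  then show ?case using kapp[of s] by (simp flip: add.assoc)
next
  case (step2 i)
  have "kapp s (u + of_int (i - 1) + 1) = kapp s (u + of_int (i - 1))"
    using kapp[of s] by blast
  then show ?case using step2 by simp
qed simp

text \<open>
  The branch of the logarithm is immaterial, because different branches differ by a period.
\<close>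

lemma kapp_Ln:
  assumes "exp (2 * of_real pi * \<i> * u) = z"
  shows "kapp s (Ln z / (2 * of_real pi * \<i>)) = kapp s u"
proof -
  have "z \<noteq> 0" using assms by auto
  then have "exp (Ln z) = exp (2 * of_real pi * \<i> * u)" using assms by simp
  then obtain n :: int where "Ln z = 2 * of_real pi * \<i> * u + (of_int (2 * n) * pi) * \<i>"
    using exp_eq by blast
  then have "Ln z / (2 * of_real pi * \<i>) = u + of_int n"
    by (simp add: field_simps)
  then show ?thesis by (simp add: kapp_add_of_int)
qed

text \<open>
  Around each point \<open>a \<noteq> 0\<close> there is a holomorphic branch of the logarithm, namely \<open>Ln (z / a) + Ln a\<close>,
  and by \<open>kapp_Ln\<close> it defines the same function as the principal branch.
\<close>

lemma kapp_Ln_holomorphic: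
  "(\<lambda>z. kapp s (Ln z / (2 * of_real pi * \<i>))) holomorphic_on - {0}"
proof -
  let ?F = "\<lambda>z. kapp s (Ln z / (2 * of_real pi * \<i>))"
  have "?F field_differentiable at a" if a: "a \<noteq> 0" for a
  proof -
    \<comment> \<open>On the ball around \<open>a\<close> that reaches up to 0, the quotient \<open>z / a\<close> avoids the branch cut.\<close>
    let ?g = "\<lambda>z. (Ln (z / a) + Ln a) / (2 * of_real pi * \<i>)"
    have right: "Re (z / a) > 0" if "z \<in> ball a (cmod a)" for z
    proof -
      have "cmod (1 - z / a) = cmod (a - z) / cmod a"
        using a by (simp add: field_simps flip: norm_divide)
      also have "\<dots> < 1" using that a by (simp add: dist_norm)
      finally have "\<bar>Re (1 - z / a)\<bar> < 1" using abs_Re_le_cmod le_less_trans by blast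
      then show ?thesis by simp
    qed
    have g: "?g holomorphic_on ball a (cmod a)"
      using a right by (intro holomorphic_intros) (auto simp: complex_nonpos_Reals_iff, force)
    have "(\<lambda>z. kapp s (?g z)) holomorphic_on ball a (cmod a)"
      using holomorphic_on_compose_gen[OF g kapp_holomorphic[of s UNIV]] by (simp add: comp_def)
    moreover have "kapp s (?g z) = ?F z" if "z \<in> ball a (cmod a)" for z
    proof -
      have "z \<noteq> 0" using that by auto
      then have "exp (2 * of_real pi * \<i> * ?g z) = z"
        using a by (simp add: exp_add)
      then show ?thesis by (rule kapp_Ln[symmetric])
    qed
    ultimately have "?F holomorphic_on ball a (cmod a)" by (rule holomorphic_transform)
    then show ?thesis using a by (intro holomorphic_on_imp_differentiable_at) auto
  qed
  then show ?thesis
    by (auto simp: holomorphic_on_def intro: field_differentiable_at_within)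
qed

text \<open>
  A test function descends along \<open>u \<mapsto> exp (2 \<pi> \<i> u)\<close> to a function on the punctured plane.  The growth
  condition becomes a bound by powers of \<open>|z|\<close> at 0 and at infinity.  Multiplication with a power of \<open>z\<close>
  removes the singularity at 0, and what results is a polynomial by Liouville.
\<close>

lemma ktest_eq_kexp_sum: "\<exists>M N a. s = (\<Sum>k\<le>N. a k *\<^sub>C kexp (int k - int M))"
proof -
  obtain C p where C: "C > 0" "p > 0" "\<And>u. cmod (kapp s u) \<le> C * exp (p * \<bar>Im u\<bar>)"
    using kapp[of s] unfolding exp_bounded_def by blast
  obtain m :: nat where m: "p / (2 * pi) \<le> real m" using real_arch_simple by blast
  \<comment> \<open>\<open>z ^ m\<close> would make the singularity bounded; one more factor makes the function tend to 0.\<close>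
  define M where "M = Suc m"
  define F where "F = (\<lambda>z. kapp s (Ln z / (2 * of_real pi * \<i>)))"
  define G where "G = (\<lambda>z. z ^ M * F z)"
  have F: "cmod (F z) \<le> C * exp (real m * \<bar>ln (cmod z)\<bar>)" if "z \<noteq> 0" for z
  proof -
    have "\<bar>Im (Ln z / (2 * of_real pi * \<i>))\<bar> = \<bar>ln (cmod z)\<bar> / (2 * pi)"
      using that by (simp add: Im_divide power2_eq_square)
    then have "cmod (F z) \<le> C * exp (p / (2 * pi) * \<bar>ln (cmod z)\<bar>)"
      using C(3)[of "Ln z / (2 * of_real pi * \<i>)"] by (simp add: F_def)
    also have "\<dots> \<le> C * exp (real m * \<bar>ln (cmod z)\<bar>)"
      using C(1) mult_right_mono[OF m, of "\<bar>ln (cmod z)\<bar>"] by (intro mult_left_mono) simp_all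
    finally show ?thesis .
  qed
  have small: "cmod (G z) \<le> C * cmod z" if "cmod z \<le> 1" for z
  proof (cases "z = 0")
    case False
    then have "exp (real m * \<bar>ln (cmod z)\<bar>) = 1 / cmod z ^ m"
      using that by (simp add: exp_minus exp_of_nat_mult divide_simps)
    then have "cmod (G z) \<le> cmod z ^ M * (C * (1 / cmod z ^ m))"
      using mult_left_mono[OF F[OF False], of "cmod z ^ M"] by (simp add: G_def norm_mult norm_power)
    then show ?thesis using False by (simp add: M_def mult.commute)
  qed (simp add: G_def M_def)
  have large: "cmod (G z) \<le> C * cmod z ^ (M + m)" if "1 \<le> cmod z" for z
  proof -
    have "z \<noteq> 0" using that by auto
    then have "exp (real m * \<bar>ln (cmod z)\<bar>) = cmod z ^ m"
      using that by (simp add: exp_of_nat_mult)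
    then have "cmod (G z) \<le> cmod z ^ M * (C * cmod z ^ m)"
      using mult_left_mono[OF F[OF \<open>z \<noteq> 0\<close>], of "cmod z ^ M"] by (simp add: G_def norm_mult norm_power)
    then show ?thesis by (simp add: power_add mult_ac)
  qed
  have "G holomorphic_on UNIV"
  proof (rule no_isolated_singularity'[where K = "{0}"])
    fix z :: complex assume "z \<in> {0}"
    have "((\<lambda>z. C * cmod z) \<longlongrightarrow> C * cmod 0) (at 0)" by (intro tendsto_intros)
    then have "((\<lambda>z. C * cmod z) \<longlongrightarrow> 0) (at 0)" by simp
    moreover have "\<forall>\<^sub>F z in at 0. cmod (G z) \<le> C * cmod z"
      using small by (auto simp: eventually_at dist_norm intro!: exI[of _ 1])
    ultimately have "(G \<longlongrightarrow> 0) (at 0)" by (rule Lim_null_comparison[rotated])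
    moreover have "G 0 = 0" by (simp add: G_def M_def)
    ultimately show "(G \<longlongrightarrow> G z) (at z within UNIV)" using \<open>z \<in> {0}\<close> by simp
  next
    show "G holomorphic_on UNIV - {0}"
    proof -
      have "F holomorphic_on UNIV - {0}"
        unfolding F_def using kapp_Ln_holomorphic[of s] by (simp add: Compl_eq_Diff_UNIV)
      then show ?thesis unfolding G_def by (intro holomorphic_intros)
    qed
  qed auto
  then have G: "G z = (\<Sum>k\<le>M + m. (deriv ^^ k) G 0 / fact k * z ^ k)" for z
    using large by (rule Liouville_polynomial)
  define a where "a k = (deriv ^^ k) G 0 / fact k" for k
  have sum: "kapp (\<Sum>k\<in>A. t k) u = (\<Sum>k\<in>A. kapp (t k) u)" for A :: "nat set" and t u
    by (induction A rule: infinite_finite_induct) (simp_all add: zero_ktest.rep_eq plus_ktest.rep_eq)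
  have "kapp s u = kapp (\<Sum>k\<le>M + m. a k *\<^sub>C kexp (int k - int M)) u" for u
  proof -
    let ?z = "exp (2 * of_real pi * \<i> * u)"
    have pow: "?z ^ k = exp (2 * of_real pi * \<i> * of_nat k * u)" for k
      by (simp add: mult_ac flip: exp_of_nat_mult)
    have shift: "?z ^ k = ?z ^ M * exp (2 * of_real pi * \<i> * of_int (int k - int M) * u)" for k
      by (simp only: pow flip: exp_add) (rule arg_cong[of _ _ exp], simp add: algebra_simps)
    have "?z ^ M * kapp s u = (\<Sum>k\<le>M + m. a k * ?z ^ k)"
      using G[of ?z] kapp_Ln[of u ?z s] by (simp add: G_def F_def a_def)
    also have "\<dots> = ?z ^ M * (\<Sum>k\<le>M + m. a k * exp (2 * of_real pi * \<i> * of_int (int k - int M) * u))"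
      unfolding sum_distrib_left
      by (rule sum.cong[OF refl], subst shift, rule mult.left_commute)
    finally show ?thesis by (simp add: sum scaleC_ktest.rep_eq kapp_kexp)
  qed
  then have "s = (\<Sum>k\<le>M + m. a k *\<^sub>C kexp (int k - int M))"
    by (intro kapp_inject[THEN iffD1] ext)
  then show ?thesis by blast
qed

lemma ktest_induct [case_names kexp add scale]:
  assumes "\<And>n. P (kexp n)" "\<And>s t. P s \<Longrightarrow> P t \<Longrightarrow> P (s + t)" "\<And>a s. P s \<Longrightarrow> P (a *\<^sub>C s)"
  shows "P s"
proof -
  obtain M N a where s: "s = (\<Sum>k\<le>N. a k *\<^sub>C kexp (int k - int M))" using ktest_eq_kexp_sum by blast
  have "P 0" using assms(3)[OF assms(1), of 0 0] by (simp add: kscale_0)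
  then have "P (\<Sum>k\<in>A. a k *\<^sub>C kexp (int k - int M))" for A :: "nat set"
    by (induction A rule: infinite_finite_induct) (auto intro: assms)
  then show ?thesis by (simp add: s)
qed

lemma sprod_kexp: "sprod (kexp n) (kexp m) = (if n + m = 0 then 1 / (2 * of_real pi * \<i>) else 0)"
proof (cases "n + m = 0")
  case True
  have "seg_int 0 (kapp 1) = 1 / (2 * of_real pi * \<i>)"
    by (simp add: seg_int_def one_ktest.rep_eq[abs_def] complex_eq_iff Re_divide Im_divide)
  then show ?thesis using True by (simp add: sprod_eq kexp_mult kexp_0)
next
  case False
  have "2 * of_real pi * \<i> * of_int (n + m) * seg_int 0 (kapp (kexp (n + m))) = 0"
    using seg_int_kdiff[of "kexp (n + m)"] by (simp only: kdiff_kexp seg_int_kapp_scale)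
  then have "seg_int 0 (kapp (kexp (n + m))) = 0" using False by (simp flip: of_int_add)
  then show ?thesis using False by (simp add: sprod_eq kexp_mult)
qed

section \<open>Fourier multipliers\<close>

definition kcoef :: "ktest \<Rightarrow> int \<Rightarrow> complex"
  where "kcoef s n = 2 * of_real pi * \<i> * sprod s (kexp (- n))"

lemma kcoef_add: "kcoef (s + t) n = kcoef s n + kcoef t n"
  by (simp add: kcoef_def sprod_add_left distrib_left)

lemma kcoef_scale: "kcoef (a *\<^sub>C s) n = a * kcoef s n"
  by (simp add: kcoef_def sprod_scale_left)

lemma kcoef_kexp: "kcoef (kexp m) n = (if n = m then 1 else 0)"
  by (simp add: kcoef_def sprod_kexp)

lemma finite_kcoef: "finite {n. kcoef s n \<noteq> 0}"
proof (induction s rule: ktest_induct)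
  case (kexp n)
  then show ?case by (simp add: kcoef_kexp)
next
  case (add s t)
  have "{n. kcoef (s + t) n \<noteq> 0} \<subseteq> {n. kcoef s n \<noteq> 0} \<union> {n. kcoef t n \<noteq> 0}"
    by (auto simp: kcoef_add)
  then show ?case using add finite_subset by blast
next
  case (scale a s)
  have "{n. kcoef (a *\<^sub>C s) n \<noteq> 0} \<subseteq> {n. kcoef s n \<noteq> 0}" by (auto simp: kcoef_scale)
  then show ?case using scale finite_subset by blast
qed

text \<open>
  The Fourier multiplier with symbol \<open>\<phi>\<close>; only finitely many coefficients are nonzero.
\<close>

definition kmul :: "(int \<Rightarrow> complex) \<Rightarrow> ktest \<Rightarrow> ktest"
  where "kmul \<phi> s = (\<Sum>n | kcoef s n \<noteq> 0. (\<phi> n * kcoef s n) *\<^sub>C kexp n)"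

lemma kmul_eq_sum:
  assumes "finite A" "{n. kcoef s n \<noteq> 0} \<subseteq> A"
  shows "kmul \<phi> s = (\<Sum>n\<in>A. (\<phi> n * kcoef s n) *\<^sub>C kexp n)"
  unfolding kmul_def using assms by (intro sum.mono_neutral_left) (auto simp: kscale_0)

lemma kmul_add: "kmul \<phi> (s + t) = kmul \<phi> s + kmul \<phi> t"
proof -
  let ?A = "{n. kcoef s n \<noteq> 0} \<union> {n. kcoef t n \<noteq> 0}"
  have "finite ?A" by (simp add: finite_kcoef)
  moreover have "{n. kcoef (s + t) n \<noteq> 0} \<subseteq> ?A" by (auto simp: kcoef_add)
  ultimately show ?thesis
    by (simp add: kmul_eq_sum[of ?A] kcoef_add distrib_left scaleC_add_left sum.distrib)
qed

lemma ksum_scale: "(\<Sum>n\<in>A. a *\<^sub>C f n) = a *\<^sub>C (\<Sum>n\<in>A. f n)" for f :: "'b \<Rightarrow> ktest"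
  by (induction A rule: infinite_finite_induct) (simp_all add: kscale_0 scaleC_add_right)

lemma kmul_scale: "kmul \<phi> (a *\<^sub>C s) = a *\<^sub>C kmul \<phi> s"
proof -
  let ?A = "{n. kcoef s n \<noteq> 0}"
  have "kmul \<phi> (a *\<^sub>C s) = (\<Sum>n\<in>?A. (\<phi> n * kcoef (a *\<^sub>C s) n) *\<^sub>C kexp n)"
    by (rule kmul_eq_sum[OF finite_kcoef]) (auto simp: kcoef_scale)
  also have "\<dots> = (\<Sum>n\<in>?A. a *\<^sub>C (\<phi> n * kcoef s n) *\<^sub>C kexp n)"
    by (simp add: kcoef_scale scaleC_scaleC mult.left_commute)
  finally show ?thesis by (simp add: kmul_def ksum_scale)
qed

lemma kmul_kexp: "kmul \<phi> (kexp n) = \<phi> n *\<^sub>C kexp n"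
  by (subst kmul_eq_sum[of "{n}"]) (auto simp: kcoef_kexp)

lemma kmul_mult_1: "kmul (\<lambda>_. 1) s = s"
  by (induction s rule: ktest_induct) (simp_all add: kmul_add kmul_scale kmul_kexp scaleC_one)

lemma kmul_mult_0: "kmul (\<lambda>_. 0) s = 0"
  by (simp add: kmul_def kscale_0)

lemma kmul_mult_scale: "kmul (\<lambda>n. a * \<phi> n) s = a *\<^sub>C kmul \<phi> s"
  by (simp add: kmul_def ksum_scale mult.assoc flip: scaleC_scaleC)

lemma kmul_uminus: "kmul \<phi> (- s) = - kmul \<phi> s"
  using kmul_scale[of \<phi> "- 1" s] by (simp add: kscale_uminus scaleC_one)

lemma kmul_0: "kmul \<phi> 0 = 0"
  using kmul_scale[of \<phi> 0 0] by (simp add: kscale_0)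

lemma kmul_mult_add: "kmul (\<lambda>n. \<phi> n + \<psi> n) s = kmul \<phi> s + kmul \<psi> s"
  by (simp add: kmul_def distrib_right scaleC_add_left sum.distrib)

lemma kmul_mult_uminus: "kmul (\<lambda>n. - \<phi> n) s = - kmul \<phi> s"
  using kmul_mult_scale[of "- 1" \<phi> s] by (simp add: kscale_uminus scaleC_one)

lemma kmul_mult_diff: "kmul (\<lambda>n. \<phi> n - \<psi> n) s = kmul \<phi> s - kmul \<psi> s"
  using kmul_mult_add[of \<phi> "\<lambda>n. - \<psi> n" s] by (simp add: kmul_mult_uminus)

lemma kmul_1: "kmul \<phi> 1 = \<phi> 0 *\<^sub>C 1"
  using kmul_kexp[of \<phi> 0] by (simp add: kexp_0)

lemma kmul_adjoint: "sprod (kmul \<phi> s) t = sprod s (kmul (\<lambda>n. \<phi> (- n)) t)"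
proof (induction s rule: ktest_induct)
  case (kexp n)
  show ?case
    by (induction t rule: ktest_induct)
      (simp_all add: kmul_add kmul_scale kmul_kexp sprod_add_right sprod_scale_right
        sprod_scale_left sprod_kexp distrib_left add_eq_0_iff)
qed (simp_all add: kmul_add kmul_scale sprod_add_left sprod_scale_left)

text \<open>
  Nondegeneracy of the scalar product, which makes the partial actions of a kernel well defined: the
  products with the exponentials are the Fourier coefficients.
\<close>

lemma sprod_nondegenerate:
  assumes "\<And>t. sprod r t = sprod s t"
  shows "r = s"
proof -
  have "kcoef r = kcoef s" by (simp add: kcoef_def assms fun_eq_iff)
  then have "kmul (\<lambda>_. 1) r = kmul (\<lambda>_. 1) s" by (simp add: kmul_def)
  then show ?thesis by (simp add: kmul_mult_1)
qed

section \<open>Derivatives of families of test functions\<close>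

lemma ktest_null_add:
  assumes "ktest_null s" "ktest_null t"
  shows "ktest_null (\<lambda>n. s n + t n)"
proof -
  obtain C p where C: "C > 0" "p > 0" "\<And>n u. cmod (kapp (s n) u) \<le> C * exp (p * \<bar>Im u\<bar>)"
      "\<And>u. (\<lambda>n. kapp (s n) u) \<longlonglongrightarrow> 0"
    using assms(1) unfolding ktest_null_def by blast
  obtain D q where D: "D > 0" "q > 0" "\<And>n u. cmod (kapp (t n) u) \<le> D * exp (q * \<bar>Im u\<bar>)"
      "\<And>u. (\<lambda>n. kapp (t n) u) \<longlonglongrightarrow> 0"
    using assms(2) unfolding ktest_null_def by blast
  have "cmod (kapp (s n + t n) u) \<le> (C + D) * exp ((p + q) * \<bar>Im u\<bar>)" for n u
  proof -
    have "cmod (kapp (s n + t n) u) \<le> C * exp (p * \<bar>Im u\<bar>) + D * exp (q * \<bar>Im u\<bar>)"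
      using norm_triangle_ineq[of "kapp (s n) u" "kapp (t n) u"] C(3)[of n u] D(3)[of n u]
      by (simp add: plus_ktest.rep_eq)
    also have "\<dots> \<le> C * exp ((p + q) * \<bar>Im u\<bar>) + D * exp ((p + q) * \<bar>Im u\<bar>)"
      using C(1,2) D(1,2) by (intro add_mono mult_left_mono) (auto intro: mult_right_mono)
    finally show ?thesis by (simp add: distrib_right)
  qed
  moreover have "(\<lambda>n. kapp (s n + t n) u) \<longlonglongrightarrow> 0" for u
    using tendsto_add[OF C(4)[of u] D(4)[of u]] by (simp add: plus_ktest.rep_eq)
  ultimately show ?thesis
    unfolding ktest_null_def using C(1,2) D(1,2) by (meson add_pos_pos)
qed

lemma ktest_null_scale:
  assumes "x \<longlonglongrightarrow> 0"
  shows "ktest_null (\<lambda>n. x n *\<^sub>C s)"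
proof -
  obtain C p where C: "C > 0" "p > 0" "\<And>u. cmod (kapp s u) \<le> C * exp (p * \<bar>Im u\<bar>)"
    using kapp[of s] unfolding exp_bounded_def by blast
  obtain B where B: "B > 0" "\<And>n. cmod (x n) \<le> B"
    using convergent_imp_Bseq[OF convergentI[OF assms]] by (auto simp: Bseq_def)
  have "cmod (kapp (x n *\<^sub>C s) u) \<le> (B * C) * exp (p * \<bar>Im u\<bar>)" for n u
    using mult_mono[OF B(2)[of n] C(3)[of u]] B(1)
    by (simp add: scaleC_ktest.rep_eq norm_mult mult.assoc)
  moreover have "(\<lambda>n. kapp (x n *\<^sub>C s) u) \<longlonglongrightarrow> 0" for u
    using tendsto_mult_left_zero[OF assms, of "kapp s u"] by (simp add: scaleC_ktest.rep_eq)
  ultimately show ?thesis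
    unfolding ktest_null_def using B(1) C(1,2) by (meson mult_pos_pos)
qed

lemma ktest_null_cmult:
  assumes "ktest_null s"
  shows "ktest_null (\<lambda>n. a *\<^sub>C s n)"
proof -
  obtain C p where C: "C > 0" "p > 0" "\<And>n u. cmod (kapp (s n) u) \<le> C * exp (p * \<bar>Im u\<bar>)"
      "\<And>u. (\<lambda>n. kapp (s n) u) \<longlonglongrightarrow> 0"
    using assms unfolding ktest_null_def by blast
  have "cmod (kapp (a *\<^sub>C s n) u) \<le> ((cmod a + 1) * C) * exp (p * \<bar>Im u\<bar>)" for n u
    using mult_mono[OF _ C(3)[of n u], of "cmod a" "cmod a + 1"]
    by (simp add: scaleC_ktest.rep_eq norm_mult mult.assoc)
  moreover have "(\<lambda>n. kapp (a *\<^sub>C s n) u) \<longlonglongrightarrow> 0" for u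
    using tendsto_mult_right_zero[OF C(4)[of u], of a] by (simp add: scaleC_ktest.rep_eq)
  moreover have "(cmod a + 1) * C > 0" using C(1) by (simp add: add_nonneg_pos)
  ultimately show ?thesis
    unfolding ktest_null_def using C(2) by blast
qed

lemma has_kderiv_unique:
  assumes "has_kderiv F k l" "has_kderiv F k' l"
  shows "k = k'"
proof -
  \<comment> \<open>One admissible sequence suffices; along it both candidates are limits of the same quotients.\<close>
  define \<epsilon> :: "nat \<Rightarrow> complex" where "\<epsilon> n = 1 / of_nat (Suc n)" for n
  have \<epsilon>: "(\<forall>n. \<epsilon> n \<noteq> 0) \<and> \<epsilon> \<longlonglongrightarrow> 0"
    unfolding \<epsilon>_def using LIMSEQ_Suc[OF lim_1_over_n] by (auto simp del: of_nat_Suc)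
  have lim: "(\<lambda>n. kapp (inverse (\<epsilon> n) *\<^sub>C (F (l + \<epsilon> n) - F l) - k) u) \<longlonglongrightarrow> 0"
    if "has_kderiv F k l" for k u
  proof -
    have "ktest_null (\<lambda>n. inverse (\<epsilon> n) *\<^sub>C (F (l + \<epsilon> n) - F l) - k)"
      using that \<epsilon> unfolding has_kderiv_def by (elim allE[of _ \<epsilon>] impE)
    then show ?thesis unfolding ktest_null_def by (elim conjE allE[of _ u])
  qed
  have "(\<lambda>n. kapp k' u - kapp k u) \<longlonglongrightarrow> 0" for u
    using tendsto_diff[OF lim[OF assms(1), of u] lim[OF assms(2), of u]]
    by (simp add: kapp_diff)
  then have "kapp k' u - kapp k u = 0" for u using LIMSEQ_const_iff by blast
  then show ?thesis by (intro kapp_inject[THEN iffD1] ext) simp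
qed

lemma kderiv_eqI: "has_kderiv F k l \<Longrightarrow> kderiv F l = k"
  unfolding kderiv_def using has_kderiv_unique by blast

text \<open>
  A test function involves finitely many frequencies, so convergence of the difference quotients in each
  eigenvalue already gives convergence in the space of test functions.
\<close>

lemma has_kderiv_kmul:
  assumes "\<And>n. ((\<lambda>l. \<phi> l n) has_field_derivative \<phi>' n) (at l)"
  shows "has_kderiv (\<lambda>l. kmul (\<phi> l) s) (kmul \<phi>' s) l"
proof (induction s rule: ktest_induct)
  case (kexp m)
  show ?case
    unfolding has_kderiv_def
  proof (intro allI impI)
    fix \<epsilon> :: "nat \<Rightarrow> complex" assume \<epsilon>: "(\<forall>n. \<epsilon> n \<noteq> 0) \<and> \<epsilon> \<longlonglongrightarrow> 0"
    then have "filterlim \<epsilon> (at 0) sequentially" by (simp add: filterlim_at)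
    moreover have "((\<lambda>h. (\<phi> (l + h) m - \<phi> l m) / h) \<longlongrightarrow> \<phi>' m) (at 0)"
      using assms[of m] by (simp add: DERIV_def)
    ultimately have "(\<lambda>n. (\<phi> (l + \<epsilon> n) m - \<phi> l m) / \<epsilon> n) \<longlonglongrightarrow> \<phi>' m"
      using filterlim_compose by blast
    then have "(\<lambda>n. (\<phi> (l + \<epsilon> n) m - \<phi> l m) / \<epsilon> n - \<phi>' m) \<longlonglongrightarrow> 0"
      using LIM_zero by blast
    then have "ktest_null (\<lambda>n. ((\<phi> (l + \<epsilon> n) m - \<phi> l m) / \<epsilon> n - \<phi>' m) *\<^sub>C kexp m)"
      by (rule ktest_null_scale)
    then show "ktest_null (\<lambda>n. inverse (\<epsilon> n) *\<^sub>C (kmul (\<phi> (l + \<epsilon> n)) (kexp m) - kmul (\<phi> l) (kexp m)) - kmul \<phi>' (kexp m))"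
      by (simp add: kmul_kexp scaleC_scaleC mult.commute divide_inverse flip: kscale_diff)
  qed
next
  case (add s t)
  show ?case unfolding has_kderiv_def
  proof (intro allI impI)
    fix \<epsilon> :: "nat \<Rightarrow> complex" assume "(\<forall>n. \<epsilon> n \<noteq> 0) \<and> \<epsilon> \<longlonglongrightarrow> 0"
    then have "ktest_null (\<lambda>n. (inverse (\<epsilon> n) *\<^sub>C (kmul (\<phi> (l + \<epsilon> n)) s - kmul (\<phi> l) s) - kmul \<phi>' s)
        + (inverse (\<epsilon> n) *\<^sub>C (kmul (\<phi> (l + \<epsilon> n)) t - kmul (\<phi> l) t) - kmul \<phi>' t))"
      using add unfolding has_kderiv_def by (intro ktest_null_add) blast+
    then show "ktest_null (\<lambda>n. inverse (\<epsilon> n) *\<^sub>C (kmul (\<phi> (l + \<epsilon> n)) (s + t) - kmul (\<phi> l) (s + t)) - kmul \<phi>' (s + t))"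
      by (simp add: kmul_add kscale_diff scaleC_add_right algebra_simps)
  qed
next
  case (scale a s)
  show ?case unfolding has_kderiv_def
  proof (intro allI impI)
    fix \<epsilon> :: "nat \<Rightarrow> complex" assume "(\<forall>n. \<epsilon> n \<noteq> 0) \<and> \<epsilon> \<longlonglongrightarrow> 0"
    then have "ktest_null (\<lambda>n. a *\<^sub>C (inverse (\<epsilon> n) *\<^sub>C (kmul (\<phi> (l + \<epsilon> n)) s - kmul (\<phi> l) s) - kmul \<phi>' s))"
      using scale unfolding has_kderiv_def by (intro ktest_null_cmult) blast
    then show "ktest_null (\<lambda>n. inverse (\<epsilon> n) *\<^sub>C (kmul (\<phi> (l + \<epsilon> n)) (a *\<^sub>C s) - kmul (\<phi> l) (a *\<^sub>C s)) - kmul \<phi>' (a *\<^sub>C s))"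
      by (simp add: kmul_scale kscale_diff scaleC_scaleC mult.commute)
  qed
qed

text \<open>
  A bound that is uniform in \<open>n\<close> is required also for the finitely many initial terms, which need not
  be controlled by any limit.
\<close>

lemma ktest_null_eventually_0:
  assumes "\<forall>\<^sub>F n in sequentially. d n = 0"
  shows "ktest_null d"
proof -
  obtain N where N: "\<And>n. n \<ge> N \<Longrightarrow> d n = 0" using assms by (auto simp: eventually_sequentially)
  have bound: "\<exists>C>0. \<exists>p>0. \<forall>n<N. \<forall>u. cmod (kapp (d n) u) \<le> C * exp (p * \<bar>Im u\<bar>)" for N
  proof (induction N)
    case 0
    show ?case by (auto intro: exI[of _ 1])
  next
    case (Suc N)
    then obtain C p where C: "C > 0" "p > 0" "\<And>n u. n < N \<Longrightarrow> cmod (kapp (d n) u) \<le> C * exp (p * \<bar>Im u\<bar>)"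
      by blast
    obtain D q where D: "D > 0" "q > 0" "\<And>u. cmod (kapp (d N) u) \<le> D * exp (q * \<bar>Im u\<bar>)"
      using kapp[of "d N"] unfolding exp_bounded_def by blast
    have "cmod (kapp (d n) u) \<le> (C + D) * exp ((p + q) * \<bar>Im u\<bar>)" if "n < Suc N" for n u
    proof (cases "n = N")
      case True
      have "D * exp (q * \<bar>Im u\<bar>) \<le> (C + D) * exp ((p + q) * \<bar>Im u\<bar>)"
        using C(1,2) D(1,2) by (intro mult_mono) (auto intro: mult_right_mono)
      then show ?thesis using D(3)[of u] True by simp
    next
      case False
      have "C * exp (p * \<bar>Im u\<bar>) \<le> (C + D) * exp ((p + q) * \<bar>Im u\<bar>)"
        using C(1,2) D(1,2) by (intro mult_mono) (auto intro: mult_right_mono)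
      then show ?thesis using C(3)[of n u] False that by simp
    qed
    then show ?case using C(1,2) D(1,2) by (meson add_pos_pos)
  qed
  obtain C p where C: "C > 0" "p > 0" "\<And>n u. n < N \<Longrightarrow> cmod (kapp (d n) u) \<le> C * exp (p * \<bar>Im u\<bar>)"
    using bound[of N] by blast
  have "cmod (kapp (d n) u) \<le> C * exp (p * \<bar>Im u\<bar>)" for n u
    using C(1) C(3)[of n u] N[of n] by (cases "n < N") (simp_all add: zero_ktest.rep_eq)
  moreover have "(\<lambda>n. kapp (d n) u) \<longlonglongrightarrow> 0" for u
    using assms by (intro tendsto_eventually) (auto elim!: eventually_mono simp: zero_ktest.rep_eq)
  ultimately show ?thesis unfolding ktest_null_def using C(1,2) by blast
qed

text \<open>
  The sequences that define a derivative may start far from the base point, where the two families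
  differ; this affects finitely many terms only.  It is needed because the eigenvalue formula for the
  twisted Green distribution fails at the lattice points.
\<close>

lemma has_kderiv_transform_eventually:
  assumes "has_kderiv G k l" "\<forall>\<^sub>F x in nhds l. F x = G x"
  shows "has_kderiv F k l"
  unfolding has_kderiv_def
proof (intro allI impI)
  fix \<epsilon> :: "nat \<Rightarrow> complex" assume \<epsilon>: "(\<forall>n. \<epsilon> n \<noteq> 0) \<and> \<epsilon> \<longlonglongrightarrow> 0"
  define q where "q F n = inverse (\<epsilon> n) *\<^sub>C (F (l + \<epsilon> n) - F l) - k" for F n
  have "(\<lambda>n. l + \<epsilon> n) \<longlonglongrightarrow> l" using tendsto_add[OF tendsto_const[of l], of \<epsilon> 0] \<epsilon> by simp
  then have "\<forall>\<^sub>F n in sequentially. F (l + \<epsilon> n) = G (l + \<epsilon> n)"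
    using assms(2) by (rule eventually_compose_filterlim[rotated])
  moreover have "F l = G l" using assms(2) by (rule eventually_nhds_x_imp_x)
  ultimately have "\<forall>\<^sub>F n in sequentially. q F n - q G n = 0"
    by (auto elim!: eventually_mono simp: q_def)
  then have "ktest_null (\<lambda>n. q F n - q G n)" by (rule ktest_null_eventually_0)
  moreover have "ktest_null (q G)"
    using assms(1) \<epsilon> unfolding has_kderiv_def q_def by (elim allE[of _ \<epsilon>] impE)
  ultimately have "ktest_null (\<lambda>n. (q F n - q G n) + q G n)" by (rule ktest_null_add)
  then show "ktest_null (\<lambda>n. inverse (\<epsilon> n) *\<^sub>C (F (l + \<epsilon> n) - F l) - k)" by (simp add: q_def)
qed

lemma has_kderiv_cmult:
  assumes "has_kderiv F k l"
  shows "has_kderiv (\<lambda>l. a *\<^sub>C F l) (a *\<^sub>C k) l"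
  unfolding has_kderiv_def
proof (intro allI impI)
  fix \<epsilon> :: "nat \<Rightarrow> complex" assume \<epsilon>: "(\<forall>n. \<epsilon> n \<noteq> 0) \<and> \<epsilon> \<longlonglongrightarrow> 0"
  then have "ktest_null (\<lambda>n. inverse (\<epsilon> n) *\<^sub>C (F (l + \<epsilon> n) - F l) - k)"
    using assms unfolding has_kderiv_def by (elim allE[of _ \<epsilon>] impE)
  then have "ktest_null (\<lambda>n. a *\<^sub>C (inverse (\<epsilon> n) *\<^sub>C (F (l + \<epsilon> n) - F l) - k))"
    by (rule ktest_null_cmult)
  then show "ktest_null (\<lambda>n. inverse (\<epsilon> n) *\<^sub>C (a *\<^sub>C F (l + \<epsilon> n) - a *\<^sub>C F l) - a *\<^sub>C k)"
    by (simp add: kscale_diff scaleC_scaleC mult.commute)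
qed

lemma has_kderiv_const: "has_kderiv (\<lambda>_. k) 0 l"
proof -
  have "ktest_null (\<lambda>n. 0)" by (rule ktest_null_eventually_0) simp
  then show ?thesis by (simp add: has_kderiv_def kscale_0)
qed

lemma sprod_kmul_has_field_derivative:
  assumes "\<And>n. ((\<lambda>l. \<phi> l n) has_field_derivative \<phi>' n) (at l)"
  shows "((\<lambda>l. sprod (kmul (\<phi> l) s) t) has_field_derivative sprod (kmul \<phi>' s) t) (at l)"
proof (induction s rule: ktest_induct)
  case (kexp n)
  show ?case
    using DERIV_cmult_right[OF assms[of n], of "sprod (kexp n) t"]
    by (simp add: kmul_kexp sprod_scale_left)
next
  case (add s r)
  then show ?case by (simp add: kmul_add sprod_add_left DERIV_add)
next
  case (scale a s)
  then show ?case by (simp add: kmul_scale sprod_scale_left DERIV_cmult)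
qed

section \<open>Difference kernels\<close>

definition klinear :: "dist \<Rightarrow> bool"
  where "klinear a \<longleftrightarrow> (\<forall>s t. a (s + t) = a s + a t) \<and> (\<forall>x s. a (x *\<^sub>C s) = x * a s)"

text \<open>
  The kernel of convolution type with eigenvalues \<open>\<phi>\<close>.  The Green kernels turn out to be of this form.
\<close>

definition conv_kernel :: "(int \<Rightarrow> complex) \<Rightarrow> kernel"
  where "conv_kernel \<phi> s t = sprod (kmul \<phi> s) t"

lemma kshift_add: "kshift z (s + t) = kshift z s + kshift z t"
  by transfer simp

lemma kshift_scale: "kshift z (x *\<^sub>C s) = x *\<^sub>C kshift z s"
  by transfer simp

lemma kshift_kexp: "kshift z (kexp n) = kapp (kexp n) z *\<^sub>C kexp n"
  by transfer (simp add: fun_eq_iff algebra_simps flip: exp_add)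

text \<open>
  A shift multiplies \<open>e\<^sub>n\<close> by a scalar, so a kernel that depends on \<open>u - z\<close> is diagonal; its
  eigenvalues are the values of the one-variable distribution on the exponentials.
\<close>

lemma diff_kernel_eq_conv_kernel:
  assumes "klinear a" "\<And>n. a (kexp n) = \<phi> n"
  shows "diff_kernel a = conv_kernel \<phi>"
proof -
  have "a (kshift z s) = kapp (kmul \<phi> s) z" for z s
    using assms
    by (induction s rule: ktest_induct)
      (simp_all add: kshift_add kshift_scale kshift_kexp kmul_add kmul_scale kmul_kexp klinear_def
        plus_ktest.rep_eq scaleC_ktest.rep_eq)
  then show ?thesis by (simp add: fun_eq_iff diff_kernel_def conv_kernel_def sprod_def)
qed

lemma part_act_u_conv_kernel: "part_act_u (conv_kernel \<phi>) s = kmul \<phi> s"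
  unfolding part_act_u_def conv_kernel_def
  by (rule the_equality) (simp_all add: sprod_nondegenerate)

text \<open>
  Since \<open>e\<^sub>n\<close> pairs with \<open>e\<^sub>-\<^sub>n\<close>, exchanging the variables reflects the symbol.
\<close>

lemma conv_kernel_commute: "conv_kernel \<phi> t s = conv_kernel (\<lambda>n. \<phi> (- n)) s t"
  unfolding conv_kernel_def by (subst kmul_adjoint[of \<phi> t s]) (rule sprod_commute)

lemma part_act_v_conv_kernel: "part_act_v (conv_kernel \<phi>) t = kmul (\<lambda>n. \<phi> (- n)) t"
  proof -
  have "conv_kernel \<phi> s t = sprod (kmul (\<lambda>n. \<phi> (- n)) t) s" for s
    using conv_kernel_commute[of \<phi> s t] by (simp add: conv_kernel_def)
  then show ?thesis
    unfolding part_act_v_def by (intro the_equality) (simp_all add: sprod_nondegenerate)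
qed

section \<open>Integrals over horizontal segments\<close>

definition horizontal_strip :: "real \<Rightarrow> real \<Rightarrow> complex set"
  where "horizontal_strip a b = {w. a < Im w \<and> Im w < b}"

lemma horizontal_strip_convex_open: "convex (horizontal_strip a b)" "open (horizontal_strip a b)"
proof -
  have eq: "horizontal_strip a b = {w. Im w > a} \<inter> {w. Im w < b}" by (auto simp: horizontal_strip_def)
  show "convex (horizontal_strip a b)" unfolding eq
    by (intro convex_Int convex_halfspace_Im_gt convex_halfspace_Im_lt)
  show "open (horizontal_strip a b)" unfolding eq
    by (intro open_Int open_halfspace_Im_gt open_halfspace_Im_lt)
qed

text \<open>
  For a primitive \<open>P\<close> of \<open>f\<close>, the derivative of \<open>P (w + 1) - P w\<close> vanishes by periodicity.  This covers
  vertical and horizontal displacements of the segment simultaneously.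
\<close>

lemma period_integral_const:
  assumes hol: "f holomorphic_on horizontal_strip a b" and per: "\<And>w. f (w + 1) = f w"
    and z: "z \<in> horizontal_strip a b" "z' \<in> horizontal_strip a b"
  shows "contour_integral (linepath z (z + 1)) f = contour_integral (linepath z' (z' + 1)) f"
proof -
  let ?S = "horizontal_strip a b"
  have shift: "w + 1 \<in> ?S" if "w \<in> ?S" for w using that by (simp add: horizontal_strip_def)
  obtain P where P: "\<And>w. w \<in> ?S \<Longrightarrow> (P has_field_derivative f w) (at w within ?S)"
    using holomorphic_convex_primitive'[OF horizontal_strip_convex_open hol] by blast
  have int: "contour_integral (linepath w (w + 1)) f = P (w + 1) - P w" if "w \<in> ?S" for w
  proof -
    have "closed_segment w (w + 1) \<subseteq> ?S"
      by (rule closed_segment_subset[OF that shift[OF that] horizontal_strip_convex_open(1)])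
    then have "(f has_contour_integral P (pathfinish (linepath w (w + 1))) - P (pathstart (linepath w (w + 1))))
        (linepath w (w + 1))"
      by (intro contour_integral_primitive[of ?S] P) simp_all
    then show ?thesis by (simp add: contour_integral_unique)
  qed
  have "((\<lambda>w. P (w + 1) - P w) has_field_derivative 0) (at w within ?S)" if w: "w \<in> ?S" for w
  proof -
    have at: "(P has_field_derivative f v) (at v)" if "v \<in> ?S" for v
      using P[OF that] at_within_open[OF that horizontal_strip_convex_open(2)] by simp
    have "((\<lambda>w. P (w + 1)) has_field_derivative f (w + 1)) (at w)"
      using at[OF shift[OF w]] by (simp add: DERIV_shift)
    then have "((\<lambda>w. P (w + 1) - P w) has_field_derivative f (w + 1) - f w) (at w)"
      using at[OF w] by (rule DERIV_diff)
    then show ?thesis by (simp add: per has_field_derivative_at_within)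
  qed
  then obtain c where "\<forall>w\<in>?S. P (w + 1) - P w = c"
    using has_field_derivative_zero_constant[OF horizontal_strip_convex_open(1)] by blast
  then show ?thesis using z by (simp add: int)
qed

lemma seg_int_eq: "seg_int y f =
    contour_integral (linepath (Complex (- 1/2) y) (Complex (- 1/2) y + 1)) f / (2 * of_real pi * \<i>)"
proof -
  have "Complex (1/2) y = Complex (- 1/2) y + 1" by (simp add: complex_eq_iff)
  then show ?thesis by (simp add: seg_int_def)
qed

lemma seg_int_translate:
  assumes "f holomorphic_on horizontal_strip 0 (Im \<tau>)" "\<And>w. f (w + 1) = f w" "0 < y" "y < Im \<tau>"
  shows "seg_int y f = seg_int (y - Im \<tau>) (\<lambda>w. f (w + \<tau>))"
proof -
  let ?z = "Complex (- 1/2) (y - Im \<tau>)"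
  have "contour_integral (linepath (Complex (- 1/2) y) (Complex (- 1/2) y + 1)) f =
      contour_integral (linepath (?z + \<tau>) (?z + \<tau> + 1)) f"
    by (rule period_integral_const[OF assms(1,2)]) (use assms(3,4) in \<open>auto simp: horizontal_strip_def\<close>)
  also have "\<dots> = contour_integral ((+) \<tau> \<circ> linepath ?z (?z + 1)) f"
    by (simp add: linepath_translate algebra_simps)
  also have "\<dots> = contour_integral (linepath ?z (?z + 1)) (\<lambda>w. f (w + \<tau>))"
    by (rule contour_integral_translate)
  finally show ?thesis by (simp add: seg_int_eq)
qed

lemma seg_int_reflect: "seg_int y (\<lambda>w. f (- w)) = seg_int (- y) f"
proof -
  let ?a = "Complex (- 1/2) y" and ?b = "Complex (1/2) y"
  have "contour_integral (uminus \<circ> linepath ?a ?b) f = - contour_integral (linepath ?a ?b) (\<lambda>w. f (- w))"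
    by (rule contour_integral_negatepath) simp
  moreover have "uminus \<circ> linepath ?a ?b = reversepath (linepath (Complex (- 1/2) (- y)) (Complex (1/2) (- y)))"
    unfolding reversepath_linepath by (simp add: fun_eq_iff linepath_def complex_eq_iff algebra_simps)
  moreover have "contour_integral (reversepath (linepath (Complex (- 1/2) (- y)) (Complex (1/2) (- y)))) f =
      - contour_integral (linepath (Complex (- 1/2) (- y)) (Complex (1/2) (- y))) f"
    by (rule contour_integral_reversepath) simp
  ultimately show ?thesis by (simp add: seg_int_def)
qed

text \<open>
  The residue theorem on the rectangle between the two segments.  The pole is described by the
  holomorphic function \<open>\<Phi>\<close>, so Cauchy's integral formula suffices; the vertical sides cancel by
  periodicity.
\<close>

lemma seg_int_jump:
  assumes hol: "\<Phi> holomorphic_on {w. \<bar>Re w\<bar> < 1 \<and> \<bar>Im w\<bar> < Y}"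
    and f: "\<And>w. w \<noteq> 0 \<Longrightarrow> \<bar>Re w\<bar> < 1 \<Longrightarrow> \<bar>Im w\<bar> < Y \<Longrightarrow> f w = \<Phi> w / w"
    and per: "\<And>w. f (w + 1) = f w" and y: "0 < y" "y < Y"
  shows "seg_int (- y) f - seg_int y f = \<Phi> 0"
proof -
  let ?S = "{w. \<bar>Re w\<bar> < 1 \<and> \<bar>Im w\<bar> < Y}"
  let ?a = "Complex (- 1/2) (- y)" and ?b = "Complex (1/2) (- y)"
    and ?c = "Complex (1/2) y" and ?d = "Complex (- 1/2) y"
  have S: "?S = box (Complex (-1) (-Y)) (Complex 1 Y)"
    by (auto simp: in_box_complex_iff)
  have conv: "convex ?S" "open ?S" unfolding S by (simp_all add: open_box)
  have inS: "?a \<in> ?S" "?b \<in> ?S" "?c \<in> ?S" "?d \<in> ?S" using y by simp_all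
  have path: "path_image (rectpath ?a ?c) \<subseteq> ?S - {0}"
    using y by (subst path_image_rectpath) auto
  have "((\<lambda>w. \<Phi> w / (w - 0)) has_contour_integral (2 * pi * \<i> * winding_number (rectpath ?a ?c) 0 * \<Phi> 0))
      (rectpath ?a ?c)"
    using path y conv hol
    by (intro Cauchy_integral_formula_convex_simple[of ?S]) (auto simp: interior_open)
  moreover have "winding_number (rectpath ?a ?c) 0 = 1"
    using y by (intro winding_number_rectpath) (simp add: in_box_complex_iff)
  ultimately have "((\<lambda>w. \<Phi> w / w) has_contour_integral 2 * pi * \<i> * \<Phi> 0) (rectpath ?a ?c)" by simp
  then have "(f has_contour_integral 2 * pi * \<i> * \<Phi> 0) (rectpath ?a ?c)"
  proof (rule has_contour_integral_eq)
    fix w assume "w \<in> path_image (rectpath ?a ?c)"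
    then have "w \<in> ?S - {0}" using path by blast
    then show "\<Phi> w / w = f w" using f by simp
  qed
  then have total: "contour_integral (rectpath ?a ?c) f = 2 * pi * \<i> * \<Phi> 0"
    by (rule contour_integral_unique)
  have rect: "rectpath ?a ?c = linepath ?a ?b +++ linepath ?b ?c +++ linepath ?c ?d +++ linepath ?d ?a"
    by (simp add: rectpath_def Let_def)
  have segs: "closed_segment ?a ?b \<subseteq> ?S - {0}" "closed_segment ?b ?c \<subseteq> ?S - {0}"
    "closed_segment ?c ?d \<subseteq> ?S - {0}" "closed_segment ?d ?a \<subseteq> ?S - {0}"
    using path unfolding rect by (simp_all add: path_image_join)
  have "(\<lambda>w. \<Phi> w / w) holomorphic_on ?S - {0}"
    using hol by (intro holomorphic_intros) (auto intro: holomorphic_on_subset)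
  then have "f holomorphic_on ?S - {0}"
    by (rule holomorphic_transform) (simp add: f)
  then have integ: "f contour_integrable_on linepath p r" if "closed_segment p r \<subseteq> ?S - {0}" for p r
    using that by (meson contour_integrable_continuous_linepath continuous_on_subset
        holomorphic_on_imp_continuous_on)
  have "contour_integral (rectpath ?a ?c) f = contour_integral (linepath ?a ?b) f +
      (contour_integral (linepath ?b ?c) f +
      (contour_integral (linepath ?c ?d) f + contour_integral (linepath ?d ?a) f))"
    unfolding rect using segs by (simp add: integ contour_integrable_joinI)
  moreover have "contour_integral (linepath ?d ?a) f = - contour_integral (linepath ?a ?d) f"
    using contour_integral_reversepath[of "linepath ?a ?d" f] by simp
  moreover have "contour_integral (linepath ?c ?d) f = - contour_integral (linepath ?d ?c) f"
    using contour_integral_reversepath[of "linepath ?d ?c" f] by simp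
  moreover have "contour_integral (linepath ?b ?c) f = contour_integral (linepath ?a ?d) f"
  proof -
    have "linepath ?b ?c = linepath (?a + 1) (?d + 1)"
      by (intro arg_cong2[where f = linepath]) (simp_all add: complex_eq_iff)
    then have "linepath ?b ?c = (+) 1 \<circ> linepath ?a ?d" by (simp only: linepath_translate)
    then show ?thesis using contour_integral_translate[of 1 "linepath ?a ?d" f] by (simp add: per)
  qed
  ultimately have "contour_integral (linepath ?a ?b) f - contour_integral (linepath ?d ?c) f = 2 * pi * \<i> * \<Phi> 0"
    using total by simp
  then have "(contour_integral (linepath ?a ?b) f - contour_integral (linepath ?d ?c) f) / (2 * of_real pi * \<i>)
      = \<Phi> 0"
    by simp
  then show ?thesis by (simp add: seg_int_def diff_divide_distrib)
qed

section \<open>The Green distributions on exponentials\<close>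

lemma theta_holomorphic: "Im \<tau> > 0 \<Longrightarrow> theta \<tau> holomorphic_on A"
  using is_theta_theta unfolding is_theta_def by (meson holomorphic_on_subset subset_UNIV)

lemma theta_translate_holomorphic:
  assumes "Im \<tau> > 0"
  shows "(\<lambda>w. theta \<tau> (w + l)) holomorphic_on A"
proof -
  have "(\<lambda>w. w + l) holomorphic_on A" by (intro holomorphic_intros)
  from holomorphic_on_compose_gen[OF this theta_holomorphic[OF assms, of UNIV]]
  show ?thesis by (simp add: comp_def)
qed

lemma theta_0: "Im \<tau> > 0 \<Longrightarrow> theta \<tau> 0 = 0"
  by (simp add: theta_eq_0_iff zero_in_period_lattice)

lemma theta_uminus: "Im \<tau> > 0 \<Longrightarrow> theta \<tau> (- u) = - theta \<tau> u"
  and theta_add_1: "Im \<tau> > 0 \<Longrightarrow> theta \<tau> (u + 1) = - theta \<tau> u"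
  and theta_add_tau: "Im \<tau> > 0 \<Longrightarrow>
    theta \<tau> (u + \<tau>) = - exp (- 2 * of_real pi * \<i> * u - of_real pi * \<i> * \<tau>) * theta \<tau> u"
  and deriv_theta_0: "Im \<tau> > 0 \<Longrightarrow> deriv (theta \<tau>) 0 = 1"
  using is_theta_theta unfolding is_theta_def by blast+

lemma theta_has_derivative:
  "Im \<tau> > 0 \<Longrightarrow> (theta \<tau> has_field_derivative deriv (theta \<tau>) u) (at u)"
  by (rule holomorphic_derivI[OF theta_holomorphic[of \<tau> UNIV]]) auto

lemma deriv_theta_uminus:
  assumes "Im \<tau> > 0"
  shows "deriv (theta \<tau>) (- u) = deriv (theta \<tau>) u"
proof -
  have "((\<lambda>v. theta \<tau> (- v)) has_field_derivative deriv (theta \<tau>) (- u) * - 1) (at u)"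
    by (rule DERIV_chain2[OF theta_has_derivative[OF assms]]) (auto intro!: derivative_eq_intros)
  then have "((\<lambda>v. - theta \<tau> v) has_field_derivative - deriv (theta \<tau>) (- u)) (at u)"
    by (simp add: theta_uminus[OF assms])
  moreover have "((\<lambda>v. - theta \<tau> v) has_field_derivative - deriv (theta \<tau>) u) (at u)"
    by (rule DERIV_minus[OF theta_has_derivative[OF assms]])
  ultimately show ?thesis using DERIV_unique by fastforce
qed

lemma deriv_theta_add_1:
  assumes "Im \<tau> > 0"
  shows "deriv (theta \<tau>) (u + 1) = - deriv (theta \<tau>) u"
proof -
  have "((\<lambda>v. theta \<tau> (v + 1)) has_field_derivative deriv (theta \<tau>) (u + 1)) (at u)"
    using theta_has_derivative[OF assms, of "u + 1"] by (simp add: DERIV_shift)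
  then have "((\<lambda>v. - theta \<tau> v) has_field_derivative deriv (theta \<tau>) (u + 1)) (at u)"
    by (simp add: theta_add_1[OF assms])
  then show ?thesis
    using DERIV_minus[OF theta_has_derivative[OF assms, of u]] DERIV_unique by blast
qed

lemma deriv_theta_add_tau:
  assumes "Im \<tau> > 0"
  shows "deriv (theta \<tau>) (u + \<tau>) = - exp (- 2 * of_real pi * \<i> * u - of_real pi * \<i> * \<tau>) *
    (deriv (theta \<tau>) u - 2 * of_real pi * \<i> * theta \<tau> u)"
proof -
  have "((\<lambda>v. theta \<tau> (v + \<tau>)) has_field_derivative deriv (theta \<tau>) (u + \<tau>)) (at u)"
    using theta_has_derivative[OF assms, of "u + \<tau>"] by (simp add: DERIV_shift)
  then have "((\<lambda>v. - exp (- 2 * of_real pi * \<i> * v - of_real pi * \<i> * \<tau>) * theta \<tau> v)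
      has_field_derivative deriv (theta \<tau>) (u + \<tau>)) (at u)"
    by (simp only: theta_add_tau[OF assms])
  moreover have "((\<lambda>v. - exp (- 2 * of_real pi * \<i> * v - of_real pi * \<i> * \<tau>) * theta \<tau> v)
      has_field_derivative - exp (- 2 * of_real pi * \<i> * u - of_real pi * \<i> * \<tau>) *
        (deriv (theta \<tau>) u - 2 * of_real pi * \<i> * theta \<tau> u)) (at u)"
    by (rule derivative_eq_intros theta_has_derivative[OF assms] refl | simp add: algebra_simps)+
  ultimately show ?thesis by (rule DERIV_unique)
qed

lemma theta_nonzero_strip:
  assumes "Im \<tau> > 0" "\<bar>Im w\<bar> < Im \<tau>" "\<And>m::int. w \<noteq> of_int m"
  shows "theta \<tau> w \<noteq> 0"
proof
  assume "theta \<tau> w = 0"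
  then obtain m n :: int where w: "w = of_int m + of_int n * \<tau>"
    using theta_eq_0_iff[OF assms(1)] by (auto simp: period_lattice_def)
  then have "\<bar>real_of_int n\<bar> * Im \<tau> < 1 * Im \<tau>" using assms(1,2) by (simp add: abs_mult)
  then have "\<bar>real_of_int n\<bar> < 1" using assms(1) by (simp only: mult_less_cancel_right_pos)
  then have "n = 0" by linarith
  then show False using w assms(3) by simp
qed

lemma theta_nonzero_open_strip:
  assumes "Im \<tau> > 0" "0 < \<bar>Im w\<bar>" "\<bar>Im w\<bar> < Im \<tau>"
  shows "theta \<tau> w \<noteq> 0"
  by (rule theta_nonzero_strip[OF assms(1,3)]) (use assms(2) in auto)

text \<open>
  The zero of \<open>\<theta>\<close> at 0 is simple, and no other lattice point lies in the rectangle that is crossed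
  by the contour shift.
\<close>

lemma theta_factor:
  assumes "Im \<tau> > 0"
  obtains h where "h holomorphic_on UNIV" "\<And>w. theta \<tau> w = w * h w" "h 0 = 1"
    "\<And>w. \<bar>Re w\<bar> < 1 \<Longrightarrow> \<bar>Im w\<bar> < Im \<tau> \<Longrightarrow> h w \<noteq> 0"
proof -
  define h where "h w = (if w = 0 then deriv (theta \<tau>) 0 else theta \<tau> w / (w - 0))" for w
  have "h holomorphic_on UNIV"
    unfolding h_def by (intro entire_divided_difference theta_holomorphic theta_0 assms)
  moreover have "theta \<tau> w = w * h w" for w
    by (simp add: h_def theta_0[OF assms])
  moreover have "h 0 = 1" by (simp add: h_def deriv_theta_0[OF assms])
  moreover have "h w \<noteq> 0" if w: "\<bar>Re w\<bar> < 1" "\<bar>Im w\<bar> < Im \<tau>" for w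
  proof (cases "w = 0")
    case False
    have "theta \<tau> w \<noteq> 0"
    proof (rule theta_nonzero_strip[OF assms w(2)])
      fix m :: int
      show "w \<noteq> of_int m"
      proof
        assume m: "w = of_int m"
        then have "\<bar>m\<bar> < 1" using w(1) by simp
        then show False using False m by simp
      qed
    qed
    then show ?thesis using False by (simp add: h_def)
  qed (simp add: h_def deriv_theta_0[OF assms])
  ultimately show ?thesis using that by blast
qed

lemma exp2pi_multiple_ne_1:
  assumes "Im \<tau> > 0" "n \<noteq> 0"
  shows "exp2pi (of_int n * \<tau>) \<noteq> 1"
proof
  assume "exp2pi (of_int n * \<tau>) = 1"
  then obtain m :: int where "of_int n * \<tau> = of_int m" using exp2pi_eq_1_iff by blast
  then have "Im (of_int n * \<tau>) = 0" by simp
  then show False using assms by simp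
qed

lemma kexp_add_tau: "kapp (kexp n) (w + \<tau>) = exp2pi (of_int n * \<tau>) * kapp (kexp n) w"
  by (simp add: kapp_kexp exp2pi_def algebra_simps flip: exp_add)

lemma kapp_add_1: "kapp s (w + 1) = kapp s w"
  using kapp[of s] by blast

lemma seg_int_eq_0_kexp:
  assumes "n \<noteq> 0"
  shows "seg_int y (kapp (kexp n)) = 0"
proof -
  have "seg_int y (kapp (kexp n)) = seg_int 0 (kapp (kexp n))"
    unfolding seg_int_eq
    by (intro arg_cong2[where f = "(/)"] refl period_integral_const[of _ "- \<bar>y\<bar> - 1" "\<bar>y\<bar> + 1"]
      kapp_holomorphic kapp_add_1) (auto simp: horizontal_strip_def)
  also have "\<dots> = sprod (kexp n) (kexp 0)" by (simp add: sprod_eq kexp_mult)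
  finally show ?thesis using assms by (simp add: sprod_kexp)
qed

lemma seg_int_lmul:
  assumes "f holomorphic_on {w. Im w = y}"
  shows "seg_int y (\<lambda>w. a * f w) = a * seg_int y f"
proof -
  have "f contour_integrable_on linepath (Complex (- 1/2) y) (Complex (1/2) y)"
    using assms by (intro contour_integrable_continuous_linepath)
      (auto intro!: continuous_on_subset[OF holomorphic_on_imp_continuous_on] simp: closed_segment_same_Im)
  then show ?thesis by (simp add: seg_int_def contour_integral_lmul)
qed

lemma seg_int_add:
  assumes "f holomorphic_on {w. Im w = y}" "g holomorphic_on {w. Im w = y}"
  shows "seg_int y (\<lambda>w. f w + g w) = seg_int y f + seg_int y g"
proof -
  have "f contour_integrable_on linepath (Complex (- 1/2) y) (Complex (1/2) y)"
    "g contour_integrable_on linepath (Complex (- 1/2) y) (Complex (1/2) y)"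
    using assms by (intro contour_integrable_continuous_linepath;
      auto intro!: continuous_on_subset[OF holomorphic_on_imp_continuous_on] simp: closed_segment_same_Im)+
  then show ?thesis by (simp add: seg_int_def contour_integral_add add_divide_distrib)
qed

lemma klinear_seg_int:
  assumes "g holomorphic_on {w. Im w = y}"
  shows "klinear (\<lambda>s. seg_int y (\<lambda>w. g w * kapp s w))"
proof -
  have hol: "(\<lambda>w. g w * kapp s w) holomorphic_on {w. Im w = y}" for s
    by (intro holomorphic_intros assms kapp_holomorphic)
  show ?thesis
    unfolding klinear_def plus_ktest.rep_eq scaleC_ktest.rep_eq
    using seg_int_add[OF hol hol] seg_int_lmul[OF hol]
    by (simp add: distrib_left mult.left_commute)
qed

text \<open>
  The eigenvalues of the twisted Green kernels.  Here and in the next definition the two signs differ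
  by 1, which reflects that the difference of the two half-currents is the total current.
\<close>

definition twisted_mult :: "sign \<Rightarrow> complex \<Rightarrow> complex \<Rightarrow> int \<Rightarrow> complex"
  where "twisted_mult \<sigma> \<tau> l n = 1 / (1 - exp2pi (of_int n * \<tau> - l)) - (if \<sigma> = Minus then 1 else 0)"

text \<open>
  The eigenvalues of the half-currents of \<open>h\<close>: for \<open>Plus\<close> those of the Green kernel itself, for \<open>Minus\<close>
  those of its transpose with the opposite sign.
\<close>

definition cartan_mult :: "sign \<Rightarrow> complex \<Rightarrow> int \<Rightarrow> complex"
  where "cartan_mult \<sigma> \<tau> n = (if n = 0 then 1/2 else 1 / (1 - exp2pi (of_int n * \<tau>)))
    - (if \<sigma> = Minus then 1 else 0)"

lemma twisted_integrand_holomorphic: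
  assumes "Im \<tau> > 0" "l \<notin> period_lattice \<tau>" "\<And>w. w \<in> A \<Longrightarrow> 0 < \<bar>Im w\<bar> \<and> \<bar>Im w\<bar> < Im \<tau>"
  shows "(\<lambda>w. theta \<tau> (w + l) / (theta \<tau> w * theta \<tau> l)) holomorphic_on A"
proof -
  have "(\<lambda>w. theta \<tau> (w + l)) holomorphic_on A"
    by (rule theta_translate_holomorphic[OF assms(1)])
  moreover have "theta \<tau> l \<noteq> 0" using assms(1,2) by (simp add: theta_eq_0_iff)
  ultimately show ?thesis
    using theta_nonzero_open_strip[OF assms(1)] assms(3)
    by (intro holomorphic_intros theta_holomorphic assms(1)) auto
qed

text \<open>
  With \<open>b\<close> and \<open>t\<close> the integrals below and above the pole, the residue gives \<open>b - t = 1\<close> and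
  translation by \<open>\<tau>\<close> gives \<open>t = \<mu> b\<close>.
\<close>

lemma green_twisted_kexp:
  assumes "Im \<tau> > 0" "l \<notin> period_lattice \<tau>"
  shows "green_twisted \<sigma> \<tau> l (kexp n) = twisted_mult \<sigma> \<tau> l n"
proof -
  define y where "y = Im \<tau> / 2"
  define f where "f w = theta \<tau> (w + l) / (theta \<tau> w * theta \<tau> l) * kapp (kexp n) w" for w
  define \<mu> where "\<mu> = exp2pi (of_int n * \<tau> - l)"
  have y: "0 < y" "y < Im \<tau>" "y - Im \<tau> = - y" using assms(1) by (auto simp: y_def)
  have l: "theta \<tau> l \<noteq> 0" using assms by (simp add: theta_eq_0_iff)
  have hol: "f holomorphic_on A" if "\<And>w. w \<in> A \<Longrightarrow> 0 < \<bar>Im w\<bar> \<and> \<bar>Im w\<bar> < Im \<tau>" for A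
    unfolding f_def
    by (intro holomorphic_on_mult twisted_integrand_holomorphic[OF assms that] kapp_holomorphic)
  have per: "f (w + 1) = f w" for w
  proof -
    have "theta \<tau> (w + 1 + l) = - theta \<tau> (w + l)"
      using theta_add_1[OF assms(1), of "w + l"] by (simp add: add_ac)
    then show ?thesis by (simp add: f_def kapp_add_1 theta_add_1[OF assms(1)])
  qed
  have quasi: "f (w + \<tau>) = \<mu> * f w" for w
  proof -
    have "theta \<tau> (w + \<tau> + l) = - exp (- 2 * of_real pi * \<i> * (w + l) - of_real pi * \<i> * \<tau>) * theta \<tau> (w + l)"
      using theta_add_tau[OF assms(1), of "w + l"] by (simp add: add_ac)
    also have "exp (- 2 * of_real pi * \<i> * (w + l) - of_real pi * \<i> * \<tau>) =
        exp2pi (- l) * exp (- 2 * of_real pi * \<i> * w - of_real pi * \<i> * \<tau>)"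
      by (simp add: exp2pi_def algebra_simps flip: exp_add)
    finally have ratio: "theta \<tau> (w + \<tau> + l) / theta \<tau> (w + \<tau>) = exp2pi (- l) * (theta \<tau> (w + l) / theta \<tau> w)"
      by (simp add: theta_add_tau[OF assms(1), of w])
    have \<mu>: "\<mu> = exp2pi (- l) * exp2pi (of_int n * \<tau>)"
      by (simp add: \<mu>_def flip: exp2pi_add)
    have f: "f v = theta \<tau> (v + l) / theta \<tau> v * (kapp (kexp n) v / theta \<tau> l)" for v
      by (simp add: f_def)
    show ?thesis
      unfolding f ratio \<mu> kexp_add_tau by (simp add: mult_ac)
  qed
  obtain h where h: "h holomorphic_on UNIV" "\<And>w. theta \<tau> w = w * h w" "h 0 = 1"
    "\<And>w. \<bar>Re w\<bar> < 1 \<Longrightarrow> \<bar>Im w\<bar> < Im \<tau> \<Longrightarrow> h w \<noteq> 0"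
    using theta_factor[OF assms(1)] by blast
  define \<Phi> where "\<Phi> w = theta \<tau> (w + l) / (h w * theta \<tau> l) * kapp (kexp n) w" for w
  have "(\<lambda>w. theta \<tau> (w + l)) holomorphic_on UNIV"
    by (rule theta_translate_holomorphic[OF assms(1)])
  then have "\<Phi> holomorphic_on {w. \<bar>Re w\<bar> < 1 \<and> \<bar>Im w\<bar> < Im \<tau>}"
    unfolding \<Phi>_def using h(1,4) l
    by (intro holomorphic_intros kapp_holomorphic) (auto intro: holomorphic_on_subset)
  then have "seg_int (- y) f - seg_int y f = \<Phi> 0"
    by (rule seg_int_jump[where f = f, OF _ _ per y(1,2)]) (simp add: f_def \<Phi>_def h(2))
  also have "\<Phi> 0 = 1" using l by (simp add: \<Phi>_def h(3) kapp_kexp)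
  finally have jump: "seg_int (- y) f - seg_int y f = 1" .
  have "f holomorphic_on horizontal_strip 0 (Im \<tau>)"
    by (rule hol) (simp add: horizontal_strip_def)
  from seg_int_translate[where f = f, OF this per y(1,2)]
  have "seg_int y f = seg_int (- y) (\<lambda>w. f (w + \<tau>))" by (simp only: y(3))
  also have "\<dots> = \<mu> * seg_int (- y) f"
    unfolding quasi using y by (intro seg_int_lmul hol) auto
  finally have top: "seg_int y f = \<mu> * seg_int (- y) f" .
  have "seg_int (- y) f * (1 - \<mu>) = 1" using jump top by (simp add: algebra_simps)
  then have bot: "seg_int (- y) f = 1 / (1 - \<mu>)"
    by (metis divide_eq_eq mult_zero_right zero_neq_one)
  have top: "seg_int y f = 1 / (1 - \<mu>) - 1" using jump bot by (metis add_diff_cancel_left' diff_add_cancel)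
  have "green_twisted \<sigma> \<tau> l (kexp n) = seg_int (strip_height \<sigma> \<tau>) f"
    by (simp add: green_twisted_def f_def[abs_def])
  then show ?thesis
    using bot top by (cases \<sigma>) (simp_all add: twisted_mult_def \<mu>_def y_def)
qed

lemma klinear_green_twisted:
  assumes "Im \<tau> > 0" "l \<notin> period_lattice \<tau>"
  shows "klinear (green_twisted \<sigma> \<tau> l)"
  unfolding green_twisted_def[abs_def]
  by (rule klinear_seg_int, rule twisted_integrand_holomorphic[OF assms])
    (use assms(1) in \<open>cases \<sigma>; simp\<close>)

text \<open>
  Again \<open>b - t = 1\<close>.  Translation by \<open>\<tau>\<close> gives \<open>t = q^n b\<close> if \<open>n \<noteq> 0\<close>: the constant by which the
  logarithmic derivative of \<open>\<theta>\<close> changes integrates to 0 against \<open>e\<^sub>n\<close>.  For \<open>n = 0\<close> this equation would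
  repeat the first one, and \<open>t = - b\<close> by oddness takes its place.
\<close>

lemma green_kexp:
  assumes "Im \<tau> > 0"
  shows "green \<tau> (kexp n) = cartan_mult Plus \<tau> n"
proof -
  define y where "y = Im \<tau> / 2"
  define f where "f w = deriv (theta \<tau>) w / theta \<tau> w * kapp (kexp n) w" for w
  define \<mu> where "\<mu> = exp2pi (of_int n * \<tau>)"
  have y: "0 < y" "y < Im \<tau>" "y - Im \<tau> = - y" using assms(1) by (auto simp: y_def)
  have dhol: "deriv (theta \<tau>) holomorphic_on A" for A
    using holomorphic_deriv[OF theta_holomorphic[OF assms, of UNIV]] by (auto intro: holomorphic_on_subset)
  have hol: "f holomorphic_on A" if "\<And>w. w \<in> A \<Longrightarrow> 0 < \<bar>Im w\<bar> \<and> \<bar>Im w\<bar> < Im \<tau>" for A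
    unfolding f_def using theta_nonzero_open_strip[OF assms] that
    by (intro holomorphic_intros dhol theta_holomorphic[OF assms] kapp_holomorphic) auto
  have per: "f (w + 1) = f w" for w
    by (simp add: f_def kapp_add_1 theta_add_1[OF assms] deriv_theta_add_1[OF assms])
  have quasi: "f (w + \<tau>) = \<mu> * f w + (- 2 * of_real pi * \<i> * \<mu>) * kapp (kexp n) w" if "Im w = - y" for w
  proof -
    have "theta \<tau> w \<noteq> 0" using that y by (intro theta_nonzero_open_strip[OF assms]) auto
    then have ratio: "deriv (theta \<tau>) (w + \<tau>) / theta \<tau> (w + \<tau>) = deriv (theta \<tau>) w / theta \<tau> w - 2 * of_real pi * \<i>"
      by (simp add: theta_add_tau[OF assms] deriv_theta_add_tau[OF assms] diff_divide_distrib)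
    show ?thesis unfolding f_def \<mu>_def kexp_add_tau ratio by (simp add: algebra_simps)
  qed
  obtain h where h: "h holomorphic_on UNIV" "\<And>w. theta \<tau> w = w * h w" "h 0 = 1"
    "\<And>w. \<bar>Re w\<bar> < 1 \<Longrightarrow> \<bar>Im w\<bar> < Im \<tau> \<Longrightarrow> h w \<noteq> 0"
    using theta_factor[OF assms(1)] by blast
  define \<Phi> where "\<Phi> w = deriv (theta \<tau>) w / h w * kapp (kexp n) w" for w
  have "\<Phi> holomorphic_on {w. \<bar>Re w\<bar> < 1 \<and> \<bar>Im w\<bar> < Im \<tau>}"
    unfolding \<Phi>_def using h(1,4)
    by (intro holomorphic_intros dhol kapp_holomorphic) (auto intro: holomorphic_on_subset)
  then have "seg_int (- y) f - seg_int y f = \<Phi> 0"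
    by (rule seg_int_jump[where f = f, OF _ _ per y(1,2)]) (simp add: f_def \<Phi>_def h(2))
  also have "\<Phi> 0 = 1" by (simp add: \<Phi>_def h(3) kapp_kexp deriv_theta_0[OF assms])
  finally have jump: "seg_int (- y) f - seg_int y f = 1" .
  have "seg_int (- y) f = cartan_mult Plus \<tau> n"
  proof (cases "n = 0")
    case True
    have "f (- w) = - 1 * f w" for w
      using True by (simp add: f_def theta_uminus[OF assms] deriv_theta_uminus[OF assms] kapp_kexp)
    then have "seg_int (- y) f = seg_int y (\<lambda>w. - 1 * f w)"
      using seg_int_reflect[of y f] by simp
    also have "\<dots> = - 1 * seg_int y f" using y by (intro seg_int_lmul hol) auto
    finally have "2 * seg_int (- y) f = 1" using jump by simp
    then show ?thesis using True by (simp add: cartan_mult_def field_simps)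
  next
    case False
    have "f holomorphic_on horizontal_strip 0 (Im \<tau>)"
      by (rule hol) (simp add: horizontal_strip_def)
    from seg_int_translate[where f = f, OF this per y(1,2)]
    have "seg_int y f = seg_int (- y) (\<lambda>w. f (w + \<tau>))" by (simp only: y(3))
    also have "\<dots> = seg_int (- y) (\<lambda>w. \<mu> * f w + (- 2 * of_real pi * \<i> * \<mu>) * kapp (kexp n) w)"
      unfolding seg_int_def
      by (intro arg_cong2[where f = "(/)"] refl contour_integral_cong quasi)
        (auto simp: closed_segment_same_Im)
    also have "\<dots> = seg_int (- y) (\<lambda>w. \<mu> * f w) + seg_int (- y) (\<lambda>w. (- 2 * of_real pi * \<i> * \<mu>) * kapp (kexp n) w)"
      using y by (intro seg_int_add holomorphic_intros hol kapp_holomorphic) auto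
    also have "\<dots> = \<mu> * seg_int (- y) f + (- 2 * of_real pi * \<i> * \<mu>) * seg_int (- y) (kapp (kexp n))"
      using y by (intro arg_cong2[where f = "(+)"] seg_int_lmul hol kapp_holomorphic) auto
    finally have "seg_int y f = \<mu> * seg_int (- y) f" using seg_int_eq_0_kexp[OF False] by simp
    then have "seg_int (- y) f * (1 - \<mu>) = 1" using jump by (simp add: algebra_simps)
    then show ?thesis using False exp2pi_multiple_ne_1[OF assms False]
      by (simp add: cartan_mult_def \<mu>_def divide_simps)
  qed
  moreover have "green \<tau> (kexp n) = seg_int (- y) f"
    by (simp add: green_def f_def[abs_def] y_def)
  ultimately show ?thesis by simp
qed

lemma klinear_green:
  assumes "Im \<tau> > 0"
  shows "klinear (green \<tau>)"
  unfolding green_def[abs_def]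
proof (intro klinear_seg_int holomorphic_on_divide theta_holomorphic assms)
  show "deriv (theta \<tau>) holomorphic_on {w. Im w = strip_height Plus \<tau>}"
    using holomorphic_deriv[OF theta_holomorphic[OF assms, of UNIV]] by (auto intro: holomorphic_on_subset)
qed (use assms theta_nonzero_open_strip[OF assms] in auto)

lemma diff_kernel_green_twisted:
  assumes "Im \<tau> > 0" "l \<notin> period_lattice \<tau>"
  shows "diff_kernel (green_twisted \<sigma> \<tau> l) = conv_kernel (twisted_mult \<sigma> \<tau> l)"
  by (rule diff_kernel_eq_conv_kernel[OF klinear_green_twisted green_twisted_kexp]) (rule assms)+

lemma diff_kernel_green:
  assumes "Im \<tau> > 0"
  shows "diff_kernel (green \<tau>) = conv_kernel (cartan_mult Plus \<tau>)"
  by (rule diff_kernel_eq_conv_kernel[OF klinear_green green_kexp]) (rule assms)+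

text \<open>
  The lattice condition is open in \<open>l\<close> and \<open>\<tau>\<close> jointly: in the real coordinates with respect to 1 and \<open>\<tau>\<close>,
  which depend continuously on both, the lattice is the closed set of pairs of integers.
\<close>

lemma eventually_not_lattice:
  assumes "Im \<tau> > 0" "l \<notin> period_lattice \<tau>" "(f \<longlongrightarrow> l) F" "(g \<longlongrightarrow> \<tau>) F"
  shows "\<forall>\<^sub>F x in F. Im (g x) > 0 \<and> f x \<notin> period_lattice (g x)"
proof -
  define \<beta> where "\<beta> m p = Im m / Im p" for m p :: complex
  define \<alpha> where "\<alpha> m p = Re m - \<beta> m p * Re p" for m p :: complex
  have coords: "m = of_real (\<alpha> m p) + of_real (\<beta> m p) * p" if "Im p > 0" for m p
    using that by (simp add: complex_eq_iff \<alpha>_def \<beta>_def)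
  have lattice: "m \<in> period_lattice p \<longleftrightarrow> (\<alpha> m p, \<beta> m p) \<in> \<int> \<times> \<int>" if p: "Im p > 0" for m p
  proof
    assume "m \<in> period_lattice p"
    then obtain a b :: int where "m = of_int a + of_int b * p" by (auto simp: period_lattice_def)
    then have "\<beta> m p = of_int b" "\<alpha> m p = of_int a" using p by (simp_all add: \<alpha>_def \<beta>_def)
    then show "(\<alpha> m p, \<beta> m p) \<in> \<int> \<times> \<int>" by simp
  next
    assume "(\<alpha> m p, \<beta> m p) \<in> \<int> \<times> \<int>"
    then obtain a b where "\<alpha> m p = of_int a" "\<beta> m p = of_int b" by (auto elim!: Ints_cases)
    then have "m = of_int a + of_int b * p" using coords[OF p, of m] by simp
    then show "m \<in> period_lattice p" unfolding period_lattice_def by blast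
  qed
  have "((\<lambda>x. (\<alpha> (f x) (g x), \<beta> (f x) (g x))) \<longlongrightarrow> (\<alpha> l \<tau>, \<beta> l \<tau>)) F"
    unfolding \<alpha>_def \<beta>_def using assms by (intro tendsto_intros) auto
  moreover have "open (- (\<int> \<times> \<int> :: (real \<times> real) set))"
    by (simp add: open_Compl closed_Times)
  moreover have "(\<alpha> l \<tau>, \<beta> l \<tau>) \<in> - (\<int> \<times> \<int>)" using lattice[OF assms(1)] assms(2) by simp
  ultimately have "\<forall>\<^sub>F x in F. (\<alpha> (f x) (g x), \<beta> (f x) (g x)) \<in> - (\<int> \<times> \<int>)"
    by (rule topological_tendstoD)
  moreover have "\<forall>\<^sub>F x in F. Im (g x) > 0"
    using tendsto_Im[OF assms(4)] assms(1) by (rule order_tendstoD)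
  ultimately show ?thesis
    by eventually_elim (auto simp: lattice)
qed

section \<open>Identities and derivatives of the multipliers\<close>

lemma twisted_mult_Minus: "twisted_mult Minus \<tau> l n = twisted_mult Plus \<tau> l n - 1"
  and cartan_mult_Minus: "cartan_mult Minus \<tau> n = cartan_mult Plus \<tau> n - 1"
  by (simp_all add: twisted_mult_def cartan_mult_def)

lemma exp2pi_uminus: "exp2pi (- u) = 1 / exp2pi u"
  by (simp add: exp2pi_def exp_minus divide_simps)

lemma exp2pi_nonzero: "exp2pi u \<noteq> 0"
  by (simp add: exp2pi_def)

lemma exp2pi_ne_1_lattice:
  assumes "l \<notin> period_lattice \<tau>"
  shows "exp2pi (of_int n * \<tau> - l) \<noteq> 1"
proof
  assume "exp2pi (of_int n * \<tau> - l) = 1"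
  then obtain m :: int where "of_int n * \<tau> - l = of_int m" using exp2pi_eq_1_iff by blast
  then have "l = of_int (- m) + of_int n * \<tau>" by (simp add: algebra_simps)
  then show False using assms unfolding period_lattice_def by blast
qed

text \<open>
  The identity \<open>1 / (1 - 1/z) = 1 - 1 / (1 - z)\<close>, the source of all reflection formulas.
\<close>

lemma geometric_reflect:
  assumes "exp2pi u \<noteq> 1"
  shows "1 / (1 - exp2pi (- u)) = 1 - 1 / (1 - exp2pi u)"
proof -
  have "1 / (1 - 1 / z) = 1 - 1 / (1 - z)" if "z \<noteq> 0" "z \<noteq> 1" for z :: complex
    using that by (simp add: divide_simps) (simp add: algebra_simps)
  then show ?thesis unfolding exp2pi_uminus using exp2pi_nonzero assms by blast
qed

lemma twisted_mult_reflect: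
  assumes "l \<notin> period_lattice \<tau>"
  shows "twisted_mult Plus \<tau> (- l) (- n) = - twisted_mult Minus \<tau> l n"
  using geometric_reflect[OF exp2pi_ne_1_lattice[OF assms, of n]] by (simp add: twisted_mult_def)

lemma cartan_mult_reflect:
  assumes "Im \<tau> > 0"
  shows "cartan_mult Plus \<tau> (- n) = - cartan_mult Minus \<tau> n"
proof (cases "n = 0")
  case False
  then show ?thesis
    using geometric_reflect[OF exp2pi_multiple_ne_1[OF assms False]] by (simp add: cartan_mult_def)
qed (simp add: cartan_mult_def)

text \<open>
  With \<open>Q = q^n\<close> and \<open>y = q^m / x\<close> this is the decomposition of \<open>1 / ((1 - Q) (1 - y))\<close> into terms with
  the denominator \<open>1 - Q y\<close>; for \<open>n = 0\<close>, where \<open>1 / (1 - Q)\<close> is replaced by \<open>1/2\<close>, a correction is left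
  over that is proportional to the derivative of the twisted eigenvalue.
\<close>

lemma multiplier_addition:
  assumes "Im \<tau> > 0" "l \<notin> period_lattice \<tau>"
  shows "cartan_mult Plus \<tau> n * twisted_mult Plus \<tau> l m =
    twisted_mult Plus \<tau> l (n + m) * (cartan_mult Plus \<tau> n + twisted_mult Minus \<tau> l m)
    - (if n = 0 then twisted_mult Plus \<tau> l m * twisted_mult Minus \<tau> l m else 0)"
proof (cases "n = 0")
  case True
  then show ?thesis by (simp add: cartan_mult_def algebra_simps)
next
  case False
  define Q y where "Q = exp2pi (of_int n * \<tau>)" and "y = exp2pi (of_int m * \<tau> - l)"
  have "Q * y = exp2pi (of_int (n + m) * \<tau> - l)"
    by (simp add: Q_def y_def algebra_simps flip: exp2pi_add)
  moreover have "Q \<noteq> 1" "y \<noteq> 1" "exp2pi (of_int (n + m) * \<tau> - l) \<noteq> 1"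
    using exp2pi_multiple_ne_1[OF assms(1) False] exp2pi_ne_1_lattice[OF assms(2)] by (auto simp: Q_def y_def simp del: of_int_add)
  ultimately have ne: "1 - Q \<noteq> 0" "1 - y \<noteq> 0" "1 - Q * y \<noteq> 0"
    and eq: "twisted_mult Plus \<tau> l (n + m) = 1 / (1 - Q * y)" by (auto simp: twisted_mult_def)
  have "1 / (1 - Q) * (1 / (1 - y)) = 1 / (1 - Q * y) * (1 / (1 - Q) + (1 / (1 - y) - 1))"
    using ne by (simp add: divide_simps) (simp add: algebra_simps)
  then show ?thesis
    using False eq by (simp add: cartan_mult_def twisted_mult_def Q_def y_def)
qed

lemma exp2pi_has_field_derivative:
  assumes "(f has_field_derivative D) (at x)"
  shows "((\<lambda>x. exp2pi (f x)) has_field_derivative 2 * of_real pi * \<i> * D * exp2pi (f x)) (at x)"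
  unfolding exp2pi_def by (rule derivative_eq_intros assms refl | simp)+

lemma geometric_has_field_derivative:
  assumes "(f has_field_derivative D) (at x)" "exp2pi (f x) \<noteq> 1"
  shows "((\<lambda>x. 1 / (1 - exp2pi (f x)) - a) has_field_derivative
    2 * of_real pi * \<i> * D * (1 / (1 - exp2pi (f x))) * (1 / (1 - exp2pi (f x)) - 1)) (at x)"
proof -
  have ne: "1 - exp2pi (f x) \<noteq> 0" using assms(2) by simp
  have "((\<lambda>x. 1 / (1 - exp2pi (f x)) - a) has_field_derivative
      2 * of_real pi * \<i> * D * exp2pi (f x) / (1 - exp2pi (f x))\<^sup>2) (at x)"
    using ne by (auto intro!: derivative_eq_intros exp2pi_has_field_derivative[OF assms(1)]
        simp: power2_eq_square)
  also have "2 * of_real pi * \<i> * D * exp2pi (f x) / (1 - exp2pi (f x))\<^sup>2 =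
      2 * of_real pi * \<i> * D * (1 / (1 - exp2pi (f x))) * (1 / (1 - exp2pi (f x)) - 1)"
    using ne by (simp add: divide_simps power2_eq_square)
  finally show ?thesis .
qed

text \<open>
  The derivative of \<open>1 / (1 - exp (2 \<pi> \<i> w))\<close> with respect to \<open>w\<close>, expressed through the function itself.
  The derivatives with respect to \<open>l\<close> and \<open>\<tau>\<close> are its multiples by \<open>-1\<close> and \<open>n\<close>, and are the same for both
  signs.
\<close>

definition twisted_slope :: "complex \<Rightarrow> complex \<Rightarrow> int \<Rightarrow> complex"
  where "twisted_slope \<tau> l n = 2 * of_real pi * \<i> * twisted_mult Plus \<tau> l n * twisted_mult Minus \<tau> l n"

definition cartan_slope :: "complex \<Rightarrow> int \<Rightarrow> complex"
  where "cartan_slope \<tau> n = 2 * of_real pi * \<i> * cartan_mult Plus \<tau> n * cartan_mult Minus \<tau> n"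

lemma twisted_mult_deriv_l:
  assumes "l \<notin> period_lattice \<tau>"
  shows "((\<lambda>l. twisted_mult \<sigma> \<tau> l n) has_field_derivative - twisted_slope \<tau> l n) (at l)"
proof -
  have "((\<lambda>l. of_int n * \<tau> - l) has_field_derivative - 1) (at l)"
    by (auto intro!: derivative_eq_intros)
  from geometric_has_field_derivative[OF this exp2pi_ne_1_lattice[OF assms], of "if \<sigma> = Minus then 1 else 0"]
  show ?thesis by (simp add: twisted_mult_def twisted_slope_def)
qed

lemma twisted_mult_deriv_tau:
  assumes "l \<notin> period_lattice \<tau>"
  shows "((\<lambda>\<tau>. twisted_mult \<sigma> \<tau> l n) has_field_derivative of_int n * twisted_slope \<tau> l n) (at \<tau>)"
proof -
  have "((\<lambda>\<tau>. of_int n * \<tau> - l) has_field_derivative of_int n) (at \<tau>)"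
    by (auto intro!: derivative_eq_intros)
  from geometric_has_field_derivative[OF this exp2pi_ne_1_lattice[OF assms], of "if \<sigma> = Minus then 1 else 0"]
  show ?thesis by (simp add: twisted_mult_def twisted_slope_def mult_ac)
qed

lemma cartan_mult_deriv_tau:
  assumes "Im \<tau> > 0"
  shows "((\<lambda>\<tau>. cartan_mult \<sigma> \<tau> n) has_field_derivative of_int n * cartan_slope \<tau> n) (at \<tau>)"
proof (cases "n = 0")
  case True
  then show ?thesis by (simp add: cartan_mult_def)
next
  case False
  have "((\<lambda>\<tau>. of_int n * \<tau>) has_field_derivative of_int n) (at \<tau>)"
    by (auto intro!: derivative_eq_intros)
  from geometric_has_field_derivative[OF this exp2pi_multiple_ne_1[OF assms False], of "if \<sigma> = Minus then 1 else 0"]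
  show ?thesis using False by (simp add: cartan_mult_def cartan_slope_def mult_ac)
qed

section \<open>Products of multiplier images\<close>

lemma sprod_1_kexp: "sprod 1 (kexp n) = (if n = 0 then 1 / (2 * of_real pi * \<i>) else 0)"
  using sprod_kexp[of 0 n] by (simp add: kexp_0)

lemma kmul_kdiff: "kmul \<phi> (kdiff s) = kmul (\<lambda>n. 2 * of_real pi * \<i> * of_int n * \<phi> n) s"
  by (induction s rule: ktest_induct)
    (simp_all add: kdiff_add kdiff_scale kdiff_kexp kmul_add kmul_scale kmul_kexp scaleC_scaleC mult_ac)

text \<open>
  The shape in which the cocycle of the central extension meets two half-currents.
\<close>

lemma sprod_kdiff_kmul:
  "sprod (kdiff (kmul \<phi> s)) (kmul \<psi> t) =
    sprod (kmul (\<lambda>n. 2 * of_real pi * \<i> * of_int n * (\<phi> n * \<psi> (- n))) s) t"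
proof -
  have *: "kmul (\<lambda>n. \<psi> (- n)) (kdiff (kmul \<phi> s)) = kmul (\<lambda>n. 2 * of_real pi * \<i> * of_int n * (\<phi> n * \<psi> (- n))) s"
    by (induction s rule: ktest_induct)
      (simp_all add: kdiff_add kdiff_scale kdiff_kexp kmul_add kmul_scale kmul_kexp scaleC_scaleC mult_ac)
  have "sprod (kdiff (kmul \<phi> s)) (kmul \<psi> t) = sprod (kmul \<psi> t) (kdiff (kmul \<phi> s))" by (rule sprod_commute)
  also have "\<dots> = sprod (kmul (\<lambda>n. \<psi> (- n)) (kdiff (kmul \<phi> s))) t"
    unfolding kmul_adjoint[of \<psi>] by (rule sprod_commute)
  finally show ?thesis by (simp only: *)
qed

lemma ktest_induct2 [case_names kexp add_left scale_left add_right scale_right]: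
  assumes "\<And>n m. P (kexp n) (kexp m)"
    and "\<And>s s' t. P s t \<Longrightarrow> P s' t \<Longrightarrow> P (s + s') t" "\<And>a s t. P s t \<Longrightarrow> P (a *\<^sub>C s) t"
    and "\<And>s t t'. P s t \<Longrightarrow> P s t' \<Longrightarrow> P s (t + t')" "\<And>a s t. P s t \<Longrightarrow> P s (a *\<^sub>C t)"
  shows "P s t"
proof (induction s rule: ktest_induct)
  case (kexp n)
  show ?case by (induction t rule: ktest_induct) (auto intro: assms)
qed (auto intro: assms)

text \<open>
  The combinations of signs that occur in the relations.  Replacing the eigenvalues for \<open>Plus\<close> by those for
  \<open>Minus\<close> lowers them by 1, and the addition formula survives this in all cases but the excluded one.
\<close>

definition compatible :: "sign \<Rightarrow> sign \<Rightarrow> bool"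
  where "compatible \<rho> \<sigma> \<longleftrightarrow> \<not> (\<rho> = Minus \<and> \<sigma> = Plus)"

lemma compatible_cases:
  assumes "compatible \<rho> \<sigma>"
  obtains "\<rho> = Plus" "\<sigma> = Plus" | "\<rho> = Minus" "\<sigma> = Minus" | "\<rho> = Plus" "\<sigma> = Minus"
  using assms by (cases \<rho>; cases \<sigma>) (auto simp: compatible_def)

text \<open>
  This and the following two lemmas are \<open>multiplier_addition\<close>, transported from exponentials to arbitrary
  test functions by bilinearity; they govern the brackets of \<open>h\<close> with \<open>e\<close> or \<open>f\<close>, of \<open>e\<close> or \<open>f\<close>
  with \<open>h\<close>, and of \<open>e\<close> with \<open>f\<close>.  The term with the scalar product is the contribution of frequency 0,
  where \<open>multiplier_addition\<close> has its correction.
\<close>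

lemma kmul_cartan_twisted:
  assumes "Im \<tau> > 0" "x \<notin> period_lattice \<tau>" "compatible \<rho> \<sigma>"
  shows "kmul (cartan_mult \<rho> \<tau>) s * kmul (twisted_mult \<sigma> \<tau> x) t =
    kmul (twisted_mult \<sigma> \<tau> x) (kmul (cartan_mult Plus \<tau>) s * t)
    + kmul (twisted_mult \<rho> \<tau> x) (s * kmul (twisted_mult Minus \<tau> x) t)
    - sprod 1 s *\<^sub>C kmul (twisted_slope \<tau> x) t"
proof (induction s t rule: ktest_induct2)
  case (kexp n m)
  have "cartan_mult \<rho> \<tau> n * twisted_mult \<sigma> \<tau> x m = twisted_mult \<sigma> \<tau> x (n + m) * cartan_mult Plus \<tau> n
      + twisted_mult \<rho> \<tau> x (n + m) * twisted_mult Minus \<tau> x m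
      - (if n = 0 then twisted_mult Plus \<tau> x m * twisted_mult Minus \<tau> x m else 0)"
    using assms(3) multiplier_addition[OF assms(1,2), of n m]
    by (cases rule: compatible_cases) (simp_all add: twisted_mult_Minus cartan_mult_Minus algebra_simps)
  then have "(cartan_mult \<rho> \<tau> n * twisted_mult \<sigma> \<tau> x m) *\<^sub>C kexp (n + m) =
      (twisted_mult \<sigma> \<tau> x (n + m) * cartan_mult Plus \<tau> n
      + twisted_mult \<rho> \<tau> x (n + m) * twisted_mult Minus \<tau> x m
      - (if n = 0 then twisted_mult Plus \<tau> x m * twisted_mult Minus \<tau> x m else 0)) *\<^sub>C kexp (n + m)"
    by simp
  then show ?case
    by (cases "n = 0") (simp_all add: add.commute kmul_kexp kmul_scale kmult_scaleC_left kmult_scaleC_right kexp_mult scaleC_scaleC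
        scaleC_add_left kscale_diff kscale_0 sprod_1_kexp twisted_slope_def mult_ac)
qed (simp_all add: kmul_add kmul_scale distrib_left distrib_right kmult_scaleC_left kmult_scaleC_right
    sprod_add_right sprod_scale_right scaleC_add_right scaleC_add_left kscale_diff scaleC_scaleC mult_ac)

lemma kmul_twisted_cartan:
  assumes "Im \<tau> > 0" "x \<notin> period_lattice \<tau>" "compatible \<rho> \<sigma>"
  shows "kmul (twisted_mult \<rho> \<tau> x) s * kmul (cartan_mult \<sigma> \<tau>) t =
    kmul (twisted_mult \<rho> \<tau> x) (s * kmul (cartan_mult Minus \<tau>) t)
    + kmul (twisted_mult \<sigma> \<tau> x) (kmul (twisted_mult Plus \<tau> x) s * t)
    - sprod 1 t *\<^sub>C kmul (twisted_slope \<tau> x) s"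
proof (induction s t rule: ktest_induct2)
  case (kexp n m)
  have "twisted_mult \<rho> \<tau> x n * cartan_mult \<sigma> \<tau> m = twisted_mult \<rho> \<tau> x (n + m) * cartan_mult Minus \<tau> m
      + twisted_mult \<sigma> \<tau> x (n + m) * twisted_mult Plus \<tau> x n
      - (if m = 0 then twisted_mult Plus \<tau> x n * twisted_mult Minus \<tau> x n else 0)"
    using assms(3) multiplier_addition[OF assms(1,2), of m n]
    by (cases rule: compatible_cases) (simp_all add: twisted_mult_Minus cartan_mult_Minus algebra_simps)
  then have "(twisted_mult \<rho> \<tau> x n * cartan_mult \<sigma> \<tau> m) *\<^sub>C kexp (n + m) =
      (twisted_mult \<rho> \<tau> x (n + m) * cartan_mult Minus \<tau> m
      + twisted_mult \<sigma> \<tau> x (n + m) * twisted_mult Plus \<tau> x n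
      - (if m = 0 then twisted_mult Plus \<tau> x n * twisted_mult Minus \<tau> x n else 0)) *\<^sub>C kexp (n + m)"
    by simp
  then show ?case
    by (cases "m = 0") (simp_all add: add.commute kmul_kexp kmul_scale kmult_scaleC_left kmult_scaleC_right kexp_mult scaleC_scaleC
        scaleC_add_left kscale_diff kscale_0 sprod_1_kexp twisted_slope_def mult_ac)
qed (simp_all add: kmul_add kmul_scale distrib_left distrib_right kmult_scaleC_left kmult_scaleC_right
    sprod_add_right sprod_scale_right scaleC_add_right scaleC_add_left kscale_diff scaleC_scaleC mult_ac)

text \<open>
  Here the addition formula is used with the frequencies \<open>n + m\<close> and \<open>- n\<close>, and the correction sits at
  \<open>n + m = 0\<close>.
\<close>

lemma kmul_twisted_twisted:
  assumes "Im \<tau> > 0" "x \<notin> period_lattice \<tau>" "compatible \<rho> \<sigma>"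
  shows "kmul (twisted_mult \<rho> \<tau> (- x)) s * kmul (twisted_mult \<sigma> \<tau> x) t =
    kmul (cartan_mult \<rho> \<tau>) (s * kmul (twisted_mult Minus \<tau> x) t)
    + kmul (cartan_mult \<sigma> \<tau>) (kmul (twisted_mult Plus \<tau> (- x)) s * t)
    - sprod (kmul (twisted_slope \<tau> (- x)) s) t *\<^sub>C 1"
proof (induction s t rule: ktest_induct2)
  case (kexp n m)
  have x: "- x \<notin> period_lattice \<tau>" using assms(2) period_lattice_uminus by fastforce
  have refl: "twisted_mult Plus \<tau> (- x) n = 1 - twisted_mult Plus \<tau> x (- n)"
    using twisted_mult_reflect[OF assms(2), of "- n"] by (simp add: twisted_mult_Minus)
  have "twisted_mult \<rho> \<tau> (- x) n * twisted_mult \<sigma> \<tau> x m =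
      cartan_mult \<rho> \<tau> (n + m) * twisted_mult Minus \<tau> x m
      + cartan_mult \<sigma> \<tau> (n + m) * twisted_mult Plus \<tau> (- x) n
      - (if n + m = 0 then twisted_mult Plus \<tau> (- x) n * twisted_mult Minus \<tau> (- x) n else 0)"
  proof (cases "n + m = 0")
    case True
    then have m: "m = - n" by simp
    show ?thesis
      using assms(3) by (cases rule: compatible_cases)
        (simp_all add: m twisted_mult_Minus cartan_mult_Minus refl algebra_simps)
  next
    case False
    then have key: "cartan_mult Plus \<tau> (n + m) * twisted_mult Plus \<tau> x (- n) =
        twisted_mult Plus \<tau> x m * (cartan_mult Plus \<tau> (n + m) + twisted_mult Plus \<tau> x (- n) - 1)"
      using multiplier_addition[OF assms(1,2), of "n + m" "- n"] by (simp add: twisted_mult_Minus)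
    show ?thesis
      using assms(3) by (cases rule: compatible_cases)
        (use key False in \<open>simp_all add: twisted_mult_Minus cartan_mult_Minus refl algebra_simps\<close>)
  qed
  then have "(twisted_mult \<rho> \<tau> (- x) n * twisted_mult \<sigma> \<tau> x m) *\<^sub>C kexp (n + m) =
      (cartan_mult \<rho> \<tau> (n + m) * twisted_mult Minus \<tau> x m
      + cartan_mult \<sigma> \<tau> (n + m) * twisted_mult Plus \<tau> (- x) n
      - (if n + m = 0 then twisted_mult Plus \<tau> (- x) n * twisted_mult Minus \<tau> (- x) n else 0)) *\<^sub>C kexp (n + m)"
    by simp
  then show ?case
    by (cases "n + m = 0") (simp_all add: add.commute kmul_kexp kmul_scale kmult_scaleC_left kmult_scaleC_right kexp_mult scaleC_scaleC
        scaleC_add_left kscale_diff kscale_0 sprod_kexp sprod_scale_left twisted_slope_def mult_ac kexp_0 kmul_1)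
qed (simp_all add: kmul_add kmul_scale distrib_left distrib_right kmult_scaleC_left kmult_scaleC_right
    sprod_add_right sprod_scale_right sprod_add_left sprod_scale_left
    scaleC_add_right scaleC_add_left kscale_diff scaleC_scaleC mult_ac)

section \<open>Half-currents and the r-matrix as multipliers\<close>

lemma smear_conv_kernel: "smear (conv_kernel \<phi>) x s = hat x (kmul \<phi> s)"
  by (simp add: smear_def part_act_u_conv_kernel)

lemma hat_uminus: "hat x (- s) = - hat x s"
  by (simp add: hat_def uminus_affine_sl2_def kscale_uminus)

lemma half_h_eq:
  assumes "Im \<tau> > 0"
  shows "half_h \<sigma> \<tau> s = hat sl2_h (kmul (cartan_mult \<sigma> \<tau>) s)"
proof (cases \<sigma>)
  case Plus
  then show ?thesis by (simp add: diff_kernel_green[OF assms] smear_conv_kernel)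
next
  case Minus
  have "(\<lambda>s t. diff_kernel (green \<tau>) t s) = conv_kernel (\<lambda>n. - cartan_mult Minus \<tau> n)"
    unfolding diff_kernel_green[OF assms]
    by (intro ext, subst conv_kernel_commute) (simp add: cartan_mult_reflect[OF assms])
  then show ?thesis using Minus
    by (simp add: smear_conv_kernel kmul_mult_uminus hat_uminus)
qed

lemma half_e_eq:
  assumes "Im \<tau> > 0" "l \<notin> period_lattice \<tau>"
  shows "half_e \<sigma> \<tau> l s = hat sl2_e (kmul (twisted_mult \<sigma> \<tau> l) s)"
  by (simp add: half_e_def diff_kernel_green_twisted[OF assms] smear_conv_kernel)

lemma period_lattice_uminus_iff: "- l \<in> period_lattice \<tau> \<longleftrightarrow> l \<in> period_lattice \<tau>"
  using period_lattice_uminus[of l] period_lattice_uminus[of "- l"] by auto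

lemma half_f_eq:
  assumes "Im \<tau> > 0" "l \<notin> period_lattice \<tau>"
  shows "half_f \<sigma> \<tau> l s = hat sl2_f (kmul (twisted_mult \<sigma> \<tau> (- l)) s)"
  using assms by (simp add: half_f_def diff_kernel_green_twisted period_lattice_uminus_iff smear_conv_kernel)

definition r_mult :: "complex \<Rightarrow> complex \<Rightarrow> 2 \<times> 2 \<Rightarrow> 2 \<times> 2 \<Rightarrow> int \<Rightarrow> complex"
  where "r_mult \<tau> l i j =
    (if i = j then (\<lambda>n. (if fst i = snd i then 1/2 else - 1/2) * cartan_mult Plus \<tau> n)
     else if i = (1, 2) \<and> j = (2, 1) then twisted_mult Plus \<tau> (- l)
     else if i = (2, 1) \<and> j = (1, 2) then twisted_mult Plus \<tau> l
     else (\<lambda>n. 0))"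

lemma conv_kernel_cmult: "(\<lambda>s t. a * conv_kernel \<phi> s t) = conv_kernel (\<lambda>n. a * \<phi> n)"
  by (simp add: conv_kernel_def fun_eq_iff kmul_mult_scale sprod_scale_left)

lemma conv_kernel_0: "(\<lambda>s t. 0) = conv_kernel (\<lambda>n. 0)"
  by (simp add: conv_kernel_def fun_eq_iff kmul_mult_0 sprod_0)

lemma r_mat_eq:
  assumes "Im \<tau> > 0" "l \<notin> period_lattice \<tau>"
  shows "r_mat \<tau> l $ i $ j = conv_kernel (r_mult \<tau> l i j)"
  using assms period_lattice_uminus_iff[of l \<tau>]
  by (auto simp: r_mat_def r_mult_def diff_kernel_green diff_kernel_green_twisted
      conv_kernel_cmult conv_kernel_0)

section \<open>Derivatives of the half-currents and of the r-matrix\<close>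

lemma aff_deriv_hat:
  assumes "has_kderiv F k l"
  shows "aff_deriv (\<lambda>l. hat x (F l)) l = hat x k"
  by (simp add: aff_deriv_def hat_def kderiv_eqI has_kderiv_cmult assms)

lemma aff_deriv_const: "aff_deriv (\<lambda>_. X) l = 0"
  by (simp add: aff_deriv_def zero_affine_sl2_def kderiv_eqI[OF has_kderiv_const])

text \<open>
  The eigenvalue formula is assumed only near the base point, which is all that is available.
\<close>

lemma aff_deriv_smear:
  assumes "\<forall>\<^sub>F m in nhds l. diff_kernel (a m) = conv_kernel (\<phi> m)"
    and "\<And>n. ((\<lambda>m. \<phi> m n) has_field_derivative \<phi>' n) (at l)"
  shows "aff_deriv (\<lambda>m. smear (diff_kernel (a m)) x s) l = hat x (kmul \<phi>' s)"
  unfolding smear_def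
proof (rule aff_deriv_hat, rule has_kderiv_transform_eventually)
  show "has_kderiv (\<lambda>m. kmul (\<phi> m) s) (kmul \<phi>' s) l" by (rule has_kderiv_kmul[OF assms(2)])
  show "\<forall>\<^sub>F m in nhds l. part_act_u (diff_kernel (a m)) s = kmul (\<phi> m) s"
    using assms(1) by (rule eventually_mono) (simp add: part_act_u_conv_kernel)
qed

lemma eventually_diff_kernel_l:
  assumes "Im \<tau> > 0" "l \<notin> period_lattice \<tau>"
  shows "\<forall>\<^sub>F m in nhds l. diff_kernel (green_twisted \<sigma> \<tau> m) = conv_kernel (twisted_mult \<sigma> \<tau> m)"
    and "\<forall>\<^sub>F m in nhds l. diff_kernel (green_twisted \<sigma> \<tau> (- m)) = conv_kernel (twisted_mult \<sigma> \<tau> (- m))"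
proof -
  have "((\<lambda>m. m) \<longlongrightarrow> l) (nhds l)" by (rule filterlim_ident)
  from eventually_not_lattice[OF assms this tendsto_const]
  have ev: "\<forall>\<^sub>F m in nhds l. m \<notin> period_lattice \<tau>" by (rule eventually_mono) simp
  then show "\<forall>\<^sub>F m in nhds l. diff_kernel (green_twisted \<sigma> \<tau> m) = conv_kernel (twisted_mult \<sigma> \<tau> m)"
    by (rule eventually_mono) (simp add: diff_kernel_green_twisted assms(1))
  from ev show "\<forall>\<^sub>F m in nhds l. diff_kernel (green_twisted \<sigma> \<tau> (- m)) = conv_kernel (twisted_mult \<sigma> \<tau> (- m))"
    by (rule eventually_mono) (simp add: diff_kernel_green_twisted assms(1) period_lattice_uminus_iff)
qed

lemma twisted_mult_deriv_uminus_l: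
  assumes "l \<notin> period_lattice \<tau>"
  shows "((\<lambda>l. twisted_mult \<sigma> \<tau> (- l) n) has_field_derivative twisted_slope \<tau> (- l) n) (at l)"
  using DERIV_chain2[OF twisted_mult_deriv_l[of "- l" \<tau> \<sigma> n] DERIV_minus[OF DERIV_ident]] assms
  by (simp add: period_lattice_uminus_iff)

lemma aff_deriv_half_e:
  assumes "Im \<tau> > 0" "l \<notin> period_lattice \<tau>"
  shows "aff_deriv (\<lambda>l. half_e \<sigma> \<tau> l s) l = hat sl2_e (- kmul (twisted_slope \<tau> l) s)"
  unfolding half_e_def kmul_mult_uminus[symmetric]
  by (rule aff_deriv_smear[OF eventually_diff_kernel_l(1)[OF assms] twisted_mult_deriv_l[OF assms(2)]])

lemma aff_deriv_half_f:
  assumes "Im \<tau> > 0" "l \<notin> period_lattice \<tau>"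
  shows "aff_deriv (\<lambda>l. half_f \<sigma> \<tau> l s) l = hat sl2_f (kmul (twisted_slope \<tau> (- l)) s)"
  unfolding half_f_def
  by (rule aff_deriv_smear[OF eventually_diff_kernel_l(2)[OF assms] twisted_mult_deriv_uminus_l[OF assms(2)]])

definition r_slope_l :: "complex \<Rightarrow> complex \<Rightarrow> 2 \<times> 2 \<Rightarrow> 2 \<times> 2 \<Rightarrow> int \<Rightarrow> complex"
  where "r_slope_l \<tau> l i j =
    (if i = j then (\<lambda>n. 0)
     else if i = (1, 2) \<and> j = (2, 1) then twisted_slope \<tau> (- l)
     else if i = (2, 1) \<and> j = (1, 2) then (\<lambda>n. - twisted_slope \<tau> l n)
     else (\<lambda>n. 0))"

definition r_slope_tau :: "complex \<Rightarrow> complex \<Rightarrow> 2 \<times> 2 \<Rightarrow> 2 \<times> 2 \<Rightarrow> int \<Rightarrow> complex"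
  where "r_slope_tau \<tau> l i j =
    (if i = j then (\<lambda>n. (if fst i = snd i then 1/2 else - 1/2) * (of_int n * cartan_slope \<tau> n))
     else if i = (1, 2) \<and> j = (2, 1) then (\<lambda>n. of_int n * twisted_slope \<tau> (- l) n)
     else if i = (2, 1) \<and> j = (1, 2) then (\<lambda>n. of_int n * twisted_slope \<tau> l n)
     else (\<lambda>n. 0))"

lemma r_mult_deriv_l:
  assumes "l \<notin> period_lattice \<tau>"
  shows "((\<lambda>l. r_mult \<tau> l i j n) has_field_derivative r_slope_l \<tau> l i j n) (at l)"
proof -
  consider "i = j" | "i = (1, 2)" "j = (2, 1)" | "i = (2, 1)" "j = (1, 2)"
    | "i \<noteq> j" "\<not> (i = (1, 2) \<and> j = (2, 1))" "\<not> (i = (2, 1) \<and> j = (1, 2))"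
    by blast
  then show ?thesis
  proof cases
    case 4
    then have "r_mult \<tau>' l' i j = (\<lambda>n. 0)" "r_slope_l \<tau>' l' i j = (\<lambda>n. 0)" for \<tau>' l'
      by (auto simp: r_mult_def r_slope_l_def)
    then show ?thesis by simp
  qed (use twisted_mult_deriv_l[OF assms, of Plus n]
      twisted_mult_deriv_uminus_l[OF assms, of Plus n] in \<open>simp_all add: r_mult_def r_slope_l_def\<close>)
qed

lemma r_mult_deriv_tau:
  assumes "Im \<tau> > 0" "l \<notin> period_lattice \<tau>"
  shows "((\<lambda>\<tau>. r_mult \<tau> l i j n) has_field_derivative r_slope_tau \<tau> l i j n) (at \<tau>)"
proof -
  consider "i = j" | "i = (1, 2)" "j = (2, 1)" | "i = (2, 1)" "j = (1, 2)"
    | "i \<noteq> j" "\<not> (i = (1, 2) \<and> j = (2, 1))" "\<not> (i = (2, 1) \<and> j = (1, 2))"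
    by blast
  then show ?thesis
  proof cases
    case 4
    then have "r_mult \<tau>' l' i j = (\<lambda>n. 0)" "r_slope_tau \<tau>' l' i j = (\<lambda>n. 0)" for \<tau>' l'
      by (auto simp: r_mult_def r_slope_tau_def)
    then show ?thesis by simp
  qed (use twisted_mult_deriv_tau[OF assms(2), of Plus n] twisted_mult_deriv_tau[of "- l" \<tau> Plus n]
      assms(2) DERIV_cmult[OF cartan_mult_deriv_tau[OF assms(1), of Plus n]] in \<open>simp_all add: r_mult_def r_slope_tau_def period_lattice_uminus_iff\<close>)
qed

lemma dlambda_r_mat_eq:
  assumes "Im \<tau> > 0" "l \<notin> period_lattice \<tau>"
  shows "(dlambda_r_mat \<tau> l $ i $ j) s t = sprod (kmul (r_slope_l \<tau> l i j) s) t"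
proof -
  have "\<forall>\<^sub>F m in nhds l. m \<notin> period_lattice \<tau>"
    using eventually_not_lattice[OF assms filterlim_ident tendsto_const] by (rule eventually_mono) simp
  then have ev: "\<forall>\<^sub>F m in nhds l. (r_mat \<tau> m $ i $ j) s t = sprod (kmul (r_mult \<tau> m i j) s) t"
    by (rule eventually_mono) (simp add: r_mat_eq[OF assms(1)] conv_kernel_def)
  have "dlambda_r_mat \<tau> l $ i $ j = (\<lambda>s t. deriv (\<lambda>l. (r_mat \<tau> l $ i $ j) s t) l)"
    by (simp add: dlambda_r_mat_def)
  moreover have "deriv (\<lambda>l. (r_mat \<tau> l $ i $ j) s t) l = deriv (\<lambda>l. sprod (kmul (r_mult \<tau> l i j) s) t) l"
    by (rule deriv_cong_ev[OF ev refl])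
  moreover have "\<dots> = sprod (kmul (r_slope_l \<tau> l i j) s) t"
    by (intro DERIV_imp_deriv sprod_kmul_has_field_derivative r_mult_deriv_l assms)
  ultimately show ?thesis by simp
qed

lemma dtau_r_mat_eq:
  assumes "Im \<tau> > 0" "l \<notin> period_lattice \<tau>"
  shows "(dtau_r_mat \<tau> l $ i $ j) s t = sprod (kmul (r_slope_tau \<tau> l i j) s) t"
proof -
  have "\<forall>\<^sub>F m in nhds \<tau>. Im m > 0 \<and> l \<notin> period_lattice m"
    by (rule eventually_not_lattice[OF assms tendsto_const filterlim_ident])
  then have ev: "\<forall>\<^sub>F m in nhds \<tau>. (r_mat m l $ i $ j) s t = sprod (kmul (r_mult m l i j) s) t"
    by (rule eventually_mono) (simp add: r_mat_eq conv_kernel_def)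
  have "dtau_r_mat \<tau> l $ i $ j = (\<lambda>s t. deriv (\<lambda>\<tau>. (r_mat \<tau> l $ i $ j) s t) \<tau>)"
    by (simp add: dtau_r_mat_def)
  moreover have "deriv (\<lambda>\<tau>. (r_mat \<tau> l $ i $ j) s t) \<tau> = deriv (\<lambda>\<tau>. sprod (kmul (r_mult \<tau> l i j) s) t) \<tau>"
    by (rule deriv_cong_ev[OF ev refl])
  moreover have "\<dots> = sprod (kmul (r_slope_tau \<tau> l i j) s) t"
    by (intro DERIV_imp_deriv sprod_kmul_has_field_derivative r_mult_deriv_tau assms)
  ultimately show ?thesis by simp
qed

section \<open>Linearity of the enveloping algebra\<close>

lemma uea_of_add: "uea_of (x + y) = uea_of x + uea_of y"
proof transfer
  fix x y :: 'a
  show "uea_ideal (free_gen (x + y) - (free_gen x + free_gen y))"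
    using uea_ideal.intros(1)[of x y] by (simp add: diff_diff_add)
qed

lemma uea_of_scale: "uea_of (a *\<^sub>C x) = a *\<^sub>C uea_of x"
  by transfer (rule uea_ideal.intros(2))

lemma uea_of_0: "uea_of 0 = 0"
  using uea_of_add[of 0 0] by simp

lemma uea_of_uminus: "uea_of (- x) = - uea_of x"
  using uea_of_add[of x "- x"] by (simp add: uea_of_0 add_eq_0_iff)

lemma uea_of_diff: "uea_of (x - y) = uea_of x - uea_of y"
  using uea_of_add[of x "- y"] by (simp add: uea_of_uminus)

lemma uea_scale_0: "0 *\<^sub>C x = (0 :: 'a::complex_lie_algebra uea)" "a *\<^sub>C (0 :: 'a uea) = 0"
  using scaleC_add_left[of 0 0 x] scaleC_add_right[of a 0 "0 :: 'a uea"] by simp_all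

lemma uea_scale_uminus: "(- a) *\<^sub>C x = - (a *\<^sub>C x)" "a *\<^sub>C (- x) = - (a *\<^sub>C x)"
  for x :: "'a::complex_lie_algebra uea"
  using scaleC_add_left[of a "- a" x] scaleC_add_right[of a x "- x"]
  by (simp_all add: uea_scale_0 add_eq_0_iff)

lemma uea_of_sum: "uea_of (\<Sum>k\<in>A. f k) = (\<Sum>k\<in>A. uea_of (f k))"
  by (induction A rule: infinite_finite_induct) (simp_all add: uea_of_0 uea_of_add)

section \<open>The relations entry by entry\<close>

lemma L_op_entries:
  assumes "Im \<tau> > 0" "l \<notin> period_lattice \<tau>"
  shows "L_op \<sigma> \<tau> l s $ 1 $ 1 = (1/2) *\<^sub>C hat sl2_h (kmul (cartan_mult \<sigma> \<tau>) s)"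
    and "L_op \<sigma> \<tau> l s $ 1 $ 2 = hat sl2_f (kmul (twisted_mult \<sigma> \<tau> (- l)) s)"
    and "L_op \<sigma> \<tau> l s $ 2 $ 1 = hat sl2_e (kmul (twisted_mult \<sigma> \<tau> l) s)"
    and "L_op \<sigma> \<tau> l s $ 2 $ 2 = - ((1/2) *\<^sub>C hat sl2_h (kmul (cartan_mult \<sigma> \<tau>) s))"
  by (simp_all add: L_op_def half_h_eq half_e_eq half_f_eq assms)

text \<open>
  The derivative of the \<open>L\<close>-operator with respect to \<open>l\<close>.  It does not depend on the sign, because the
  eigenvalues for the two signs differ by a constant.
\<close>

definition L_slope :: "complex \<Rightarrow> complex \<Rightarrow> ktest \<Rightarrow> affine_sl2^2^2"
  where "L_slope \<tau> l s = vector
    [vector [0, hat sl2_f (kmul (twisted_slope \<tau> (- l)) s)],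
     vector [hat sl2_e (- kmul (twisted_slope \<tau> l) s), 0]]"

lemma dlambda_L_mat_eq:
  assumes "Im \<tau> > 0" "l \<notin> period_lattice \<tau>"
  shows "dlambda_L_mat \<sigma> \<tau> l s $ i $ j = uea_of (L_slope \<tau> l s $ i $ j)"
  using exhaust_2[of i] exhaust_2[of j]
  by (auto simp: dlambda_L_mat_def L_op_def L_slope_def aff_deriv_half_e aff_deriv_half_f
      aff_deriv_const assms)

text \<open>
  Multiplication by the entry of \<open>H\<close> at position \<open>i, j\<close>, available also in the Lie algebra, where
  there is no product.
\<close>

definition H_sign :: "2 \<Rightarrow> 2 \<Rightarrow> 'a::ab_group_add \<Rightarrow> 'a"
  where "H_sign i j x = (if i = j then if i = 1 then x else - x else 0)"

lemma sum_UNIV_2x2: "(\<Sum>k\<in>(UNIV :: (2 \<times> 2) set). g k) = g (1, 1) + g (1, 2) + g (2, 1) + g (2, 2)"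
  for g :: "2 \<times> 2 \<Rightarrow> 'a::ab_group_add"
  unfolding UNIV_Times_UNIV[symmetric] sum.cartesian_product[symmetric, where g = "\<lambda>x y. g (x, y)", simplified]
  by (simp add: sum_2 add.assoc)

lemma kmul_r_mult:
  "kmul (r_mult \<tau> l i j) s =
    (if i = j then (if fst i = snd i then 1/2 else - 1/2) *\<^sub>C kmul (cartan_mult Plus \<tau>) s
     else if i = (1, 2) \<and> j = (2, 1) then kmul (twisted_mult Plus \<tau> (- l)) s
     else if i = (2, 1) \<and> j = (1, 2) then kmul (twisted_mult Plus \<tau> l) s
     else 0)"
  by (simp only: r_mult_def kmul_mult_scale kmul_mult_0 if_distrib[of "\<lambda>\<phi>. kmul \<phi> s"])

lemma kmul_r_mult_reflect:
  assumes "Im \<tau> > 0" "l \<notin> period_lattice \<tau>"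
  shows "kmul (\<lambda>n. r_mult \<tau> l i j (- n)) s =
    (if i = j then (if fst i = snd i then - 1/2 else 1/2) *\<^sub>C kmul (cartan_mult Minus \<tau>) s
     else if i = (1, 2) \<and> j = (2, 1) then - kmul (twisted_mult Minus \<tau> l) s
     else if i = (2, 1) \<and> j = (1, 2) then - kmul (twisted_mult Minus \<tau> (- l)) s
     else 0)"
proof -
  have "(\<lambda>n. r_mult \<tau> l i j (- n)) =
    (if i = j then (\<lambda>n. (if fst i = snd i then - 1/2 else 1/2) * cartan_mult Minus \<tau> n)
     else if i = (1, 2) \<and> j = (2, 1) then (\<lambda>n. - twisted_mult Minus \<tau> l n)
     else if i = (2, 1) \<and> j = (1, 2) then (\<lambda>n. - twisted_mult Minus \<tau> (- l) n)
     else (\<lambda>n. 0))"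
    using twisted_mult_reflect[of l \<tau>] twisted_mult_reflect[of "- l" \<tau>] assms
    by (simp add: r_mult_def cartan_mult_reflect period_lattice_uminus_iff fun_eq_iff)
  then show ?thesis
    by (simp only: kmul_mult_scale kmul_mult_uminus kmul_mult_0 if_distrib[of "\<lambda>\<phi>. kmul \<phi> s"])
qed

lemma kmul_r_slope_l:
  "kmul (r_slope_l \<tau> l i j) s =
    (if i = j then 0
     else if i = (1, 2) \<and> j = (2, 1) then kmul (twisted_slope \<tau> (- l)) s
     else if i = (2, 1) \<and> j = (1, 2) then - kmul (twisted_slope \<tau> l) s
     else 0)"
  by (simp only: r_slope_l_def kmul_mult_uminus kmul_mult_0 if_distrib[of "\<lambda>\<phi>. kmul \<phi> s"])

lemma kmul_r_slope_tau:
  "kmul (r_slope_tau \<tau> l i j) s =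
    (if i = j then (if fst i = snd i then 1/2 else - 1/2) *\<^sub>C kmul (\<lambda>n. of_int n * cartan_slope \<tau> n) s
     else if i = (1, 2) \<and> j = (2, 1) then kmul (\<lambda>n. of_int n * twisted_slope \<tau> (- l) n) s
     else if i = (2, 1) \<and> j = (1, 2) then kmul (\<lambda>n. of_int n * twisted_slope \<tau> l n) s
     else 0)"
  by (simp only: r_slope_tau_def kmul_mult_scale kmul_mult_0 if_distrib[of "\<lambda>\<phi>. kmul \<phi> s"])

text \<open>
  The coefficient of the derivative with respect to \<open>u\<close>.  As a scalar it permits a common treatment of equal
  and of different signs.
\<close>

definition sign_diff :: "sign \<Rightarrow> sign \<Rightarrow> complex"
  where "sign_diff \<rho> \<sigma> = (if \<rho> = \<sigma> then 0 else 1)"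

text \<open>
  By reflection, the product of the eigenvalues at \<open>n\<close> and \<open>- n\<close> is minus the product for the two
  signs at \<open>n\<close>, hence a multiple of the derivative with respect to \<open>\<tau>\<close>; for different signs one factor
  is larger by 1, which adds the derivative of \<open>s\<close>.
\<close>

lemma sprod_kdiff_cartan:
  assumes "Im \<tau> > 0" "compatible \<rho> \<sigma>"
  shows "sprod (kdiff (kmul (cartan_mult \<rho> \<tau>) s)) (kmul (cartan_mult \<sigma> \<tau>) t) =
    - sprod (kmul (\<lambda>n. of_int n * cartan_slope \<tau> n) s) t
    - sign_diff \<rho> \<sigma> * sprod (kmul (cartan_mult Plus \<tau>) (kdiff s)) t"
proof -
  have refl: "cartan_mult Plus \<tau> (- n) = 1 - cartan_mult Plus \<tau> n" for n
    by (simp add: cartan_mult_reflect[OF assms(1)] cartan_mult_Minus)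
  have "(\<lambda>n. 2 * of_real pi * \<i> * of_int n * (cartan_mult \<rho> \<tau> n * cartan_mult \<sigma> \<tau> (- n))) =
    (\<lambda>n. - (of_int n * cartan_slope \<tau> n)
      + (if \<rho> = \<sigma> then 0 else - (2 * of_real pi * \<i> * of_int n * cartan_mult Plus \<tau> n)))"
    using assms(2) by (cases rule: compatible_cases)
      (simp_all add: fun_eq_iff cartan_slope_def cartan_mult_Minus refl algebra_simps)
  then show ?thesis
    by (simp add: sprod_kdiff_kmul kmul_mult_diff kmul_mult_uminus kmul_kdiff kmul_mult_0 sprod_0 sprod_uminus_left
        sprod_diff sign_diff_def)
qed

lemma sprod_kdiff_twisted:
  assumes "x \<notin> period_lattice \<tau>" "compatible \<rho> \<sigma>"
  shows "sprod (kdiff (kmul (twisted_mult \<rho> \<tau> (- x)) s)) (kmul (twisted_mult \<sigma> \<tau> x) t) =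
    - sprod (kmul (\<lambda>n. of_int n * twisted_slope \<tau> (- x) n) s) t
    - sign_diff \<rho> \<sigma> * sprod (kmul (twisted_mult Plus \<tau> (- x)) (kdiff s)) t"
proof -
  have "- x \<notin> period_lattice \<tau>" using assms(1) by (simp add: period_lattice_uminus_iff)
  from twisted_mult_reflect[OF this]
  have refl: "twisted_mult Plus \<tau> x (- n) = 1 - twisted_mult Plus \<tau> (- x) n" for n
    by (simp add: twisted_mult_Minus)
  have "(\<lambda>n. 2 * of_real pi * \<i> * of_int n * (twisted_mult \<rho> \<tau> (- x) n * twisted_mult \<sigma> \<tau> x (- n))) =
    (\<lambda>n. - (of_int n * twisted_slope \<tau> (- x) n)
      + (if \<rho> = \<sigma> then 0 else - (2 * of_real pi * \<i> * of_int n * twisted_mult Plus \<tau> (- x) n)))"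
    using assms(2) by (cases rule: compatible_cases)
      (simp_all add: fun_eq_iff twisted_slope_def twisted_mult_Minus refl algebra_simps)
  then show ?thesis
    by (simp add: sprod_kdiff_kmul kmul_mult_diff kmul_mult_uminus kmul_kdiff kmul_mult_0 sprod_0 sprod_uminus_left
        sprod_diff sign_diff_def)
qed

text \<open>
  The entry at position \<open>i, j\<close> of the right-hand side.  All its terms are linear in the generators, so
  it can be formed in the Lie algebra instead of the enveloping algebra.
\<close>

definition relation_rhs ::
    "sign \<Rightarrow> sign \<Rightarrow> complex \<Rightarrow> complex \<Rightarrow> ktest \<Rightarrow> ktest \<Rightarrow> 2 \<times> 2 \<Rightarrow> 2 \<times> 2 \<Rightarrow> affine_sl2"
  where "relation_rhs \<rho> \<sigma> \<tau> l s t i j =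
    ((\<Sum>k\<in>UNIV. tensor1 (L_op \<rho> \<tau> l (s * kmul (\<lambda>n. r_mult \<tau> l k j (- n)) t)) $ i $ k)
      - (\<Sum>k\<in>UNIV. tensor1 (L_op \<rho> \<tau> l (s * kmul (\<lambda>n. r_mult \<tau> l i k (- n)) t)) $ k $ j))
    + ((\<Sum>k\<in>UNIV. tensor2 (L_op \<sigma> \<tau> l (t * kmul (r_mult \<tau> l k j) s)) $ i $ k)
      - (\<Sum>k\<in>UNIV. tensor2 (L_op \<sigma> \<tau> l (t * kmul (r_mult \<tau> l i k) s)) $ k $ j))
    + sprod 1 s *\<^sub>C H_sign (fst i) (fst j) (L_slope \<tau> l t $ snd i $ snd j)
    - sprod 1 t *\<^sub>C H_sign (snd i) (snd j) (L_slope \<tau> l s $ fst i $ fst j)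
    + sprod (kmul (r_slope_l \<tau> l i j) s) t *\<^sub>C aff_h0
    - sprod (kmul (r_slope_tau \<tau> l i j) s) t *\<^sub>C aff_c
    - (sign_diff \<rho> \<sigma> * sprod (kmul (r_mult \<tau> l i j) (kdiff s)) t) *\<^sub>C aff_c"

text \<open>
  Both relations entry by entry, inside the Lie algebra.  The three bilinear identities and the two
  evaluations of the cocycle, for \<open>l\<close> and for \<open>- l\<close>, cover all sixteen entries.
\<close>

lemma lie_L_op:
  assumes "Im \<tau> > 0" "l \<notin> period_lattice \<tau>" "compatible \<rho> \<sigma>"
  shows "lie (L_op \<rho> \<tau> l s $ fst i $ fst j) (L_op \<sigma> \<tau> l t $ snd i $ snd j) =
    relation_rhs \<rho> \<sigma> \<tau> l s t i j"
proof -
  have l': "- l \<notin> period_lattice \<tau>" using assms(2) by (simp add: period_lattice_uminus_iff)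
  note com = mult.commute[of "kmul _ s" t]
  note bil =
    kmul_cartan_twisted[OF assms(1,2,3), of s t, unfolded com]
    kmul_cartan_twisted[OF assms(1) l' assms(3), of s t, unfolded com]
    kmul_twisted_cartan[OF assms(1,2,3), of s t, unfolded com]
    kmul_twisted_cartan[OF assms(1) l' assms(3), of s t, unfolded com]
    kmul_twisted_twisted[OF assms(1,2,3), of s t, unfolded com]
    kmul_twisted_twisted[OF assms(1) l' assms(3), of s t, unfolded minus_minus com]
  note central = sprod_kdiff_cartan[OF assms(1,3)] sprod_kdiff_twisted[OF assms(2,3)]
    sprod_kdiff_twisted[OF l' assms(3), unfolded minus_minus]
  note entries = L_op_entries[OF assms(1,2)]
  have i: "i = (1, 1) \<or> i = (1, 2) \<or> i = (2, 1) \<or> i = (2, 2)"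
    using exhaust_2[of "fst i"] exhaust_2[of "snd i"] by (cases i) auto
  have j: "j = (1, 1) \<or> j = (1, 2) \<or> j = (2, 1) \<or> j = (2, 2)"
    using exhaust_2[of "fst j"] exhaust_2[of "snd j"] by (cases j) auto
  show ?thesis
    using i j
    apply (elim disjE)
    (* the matrix sums collapse, and all operators become Fourier multipliers *)
    apply (simp_all add: relation_rhs_def sum_UNIV_2x2 tensor1_def tensor2_def entries H_sign_def
      L_slope_def kmul_r_mult kmul_r_mult_reflect[OF assms(1,2)] kmul_r_slope_l kmul_r_slope_tau)
    (* the components of the bracket; the identities turn every product into multiplier images *)
    apply (simp_all add: hat_def zero_affine_sl2_def plus_affine_sl2_def uminus_affine_sl2_def
      minus_affine_sl2_def scaleC_affine_sl2_def lie_affine_sl2_def aff_h0_def aff_c_def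
      sl2_h_def sl2_e_def sl2_f_def kscale_0 kdiff_0 sprod_0 scaleC_one kmul_uminus kmul_0
      kmult_scaleC_left kmult_scaleC_right kmul_scale sprod_scale_left sprod_scale_right
      sprod_uminus_left sprod_uminus_right kdiff_scale kdiff_uminus kscale_uminus
      bil central)
    (* only linear combinations are left, which are compared pointwise *)
    apply (simp_all add: ktest_eq_iff zero_ktest.rep_eq plus_ktest.rep_eq uminus_ktest.rep_eq kapp_diff
      scaleC_ktest.rep_eq kapp_two_mult)
    apply (simp_all add: field_simps)
    done
qed

lemma tensor_map_matrix_uea_of:
  "tensor1 (map_matrix uea_of M) = map_matrix uea_of (tensor1 M)"
  "tensor2 (map_matrix uea_of M) = map_matrix uea_of (tensor2 M)"
  by (simp_all add: vec_eq_iff tensor1_def tensor2_def uea_of_0)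

lemma tensor_mult_nth:
  fixes M N :: "'a::ring_1^2^2"
  shows "(tensor1 M ** tensor2 N) $ i $ j = M $ fst i $ fst j * N $ snd i $ snd j"
    and "(tensor2 N ** tensor1 M) $ i $ j = N $ snd i $ snd j * M $ fst i $ fst j"
proof -
  obtain a b c d where ij: "i = (a, b)" "j = (c, d)" by (cases i; cases j)
  have 2: "x = 1 \<or> x = 2" for x :: 2 by (rule exhaust_2)
  show "(tensor1 M ** tensor2 N) $ i $ j = M $ fst i $ fst j * N $ snd i $ snd j"
    and "(tensor2 N ** tensor1 M) $ i $ j = N $ snd i $ snd j * M $ fst i $ fst j"
    using 2[of a] 2[of b] 2[of c] 2[of d]
    by (auto simp: ij matrix_matrix_mult_def sum_UNIV_2x2 tensor1_def tensor2_def)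
qed

lemma commutator_tensor_uea_of:
  "commutator (tensor1 (map_matrix uea_of M)) (tensor2 (map_matrix uea_of N)) $ i $ j =
    uea_of (lie (M $ fst i $ fst j) (N $ snd i $ snd j))"
  by (simp add: commutator_def tensor_mult_nth uea_of_lie)

lemma H_mat_mult_nth: "H_mat $ i $ j * x = H_sign i j x"
  using exhaust_2[of i] exhaust_2[of j] by (auto simp: H_mat_def H_sign_def)

lemma uea_of_H_sign: "uea_of (H_sign i j x) = H_sign i j (uea_of x)"
  by (simp add: H_sign_def uea_of_0 uea_of_uminus)

lemma comm_kernel_uea_of:
  assumes "\<And>i j. R $ i $ j = conv_kernel (\<phi> i j)"
  shows "comm_kernel_u (\<lambda>s. map_matrix uea_of (M s)) R s t $ i $ j =
      uea_of ((\<Sum>k\<in>UNIV. M (s * kmul (\<lambda>n. \<phi> k j (- n)) t) $ i $ k)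
        - (\<Sum>k\<in>UNIV. M (s * kmul (\<lambda>n. \<phi> i k (- n)) t) $ k $ j))"
    and "comm_kernel_v (\<lambda>t. map_matrix uea_of (M t)) R s t $ i $ j =
      uea_of ((\<Sum>k\<in>UNIV. M (t * kmul (\<phi> k j) s) $ i $ k)
        - (\<Sum>k\<in>UNIV. M (t * kmul (\<phi> i k) s) $ k $ j))"
  by (simp_all add: comm_kernel_u_def comm_kernel_v_def kernel_mult_u_def kernel_mult_v_def assms
      part_act_u_conv_kernel part_act_v_conv_kernel uea_of_diff uea_of_sum)

text \<open>
  The passage from the Lie algebra to the enveloping algebra: the two matrices act in different tensor
  factors, so each entry of the commutator is a single commutator of generators.
\<close>

lemma exchange_relation:
  assumes "Im \<tau> > 0" "l \<notin> period_lattice \<tau>" "compatible \<rho> \<sigma>"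
  shows "commutator (tensor1 (L_mat \<rho> \<tau> l s)) (tensor2 (L_mat \<sigma> \<tau> l t)) =
      comm_kernel_u (\<lambda>s. tensor1 (L_mat \<rho> \<tau> l s)) (r_mat \<tau> l) s t
    + comm_kernel_v (\<lambda>t. tensor2 (L_mat \<sigma> \<tau> l t)) (r_mat \<tau> l) s t
    + const_u (\<lambda>t. tensor1 H_mat ** tensor2 (dlambda_L_mat \<sigma> \<tau> l t)) s t
    - const_v (\<lambda>s. tensor2 H_mat ** tensor1 (dlambda_L_mat \<rho> \<tau> l s)) s t
    + kernel_times aff_h0 (dlambda_r_mat \<tau> l) s t
    + (map_matrix ((*\<^sub>C) (sign_diff \<rho> \<sigma>)) (kernel_times aff_c (du_r_mat \<tau> l) s t)
      - kernel_times aff_c (dtau_r_mat \<tau> l) s t)" (is "?lhs = ?rhs")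
proof -
  have "?lhs $ i $ j = ?rhs $ i $ j" for i j
  proof -
    have du: "(du_r_mat \<tau> l $ i $ j) s t = - sprod (kmul (r_mult \<tau> l i j) (kdiff s)) t"
      by (simp add: du_r_mat_def r_mat_eq[OF assms(1,2)] conv_kernel_def)
    have "?lhs $ i $ j = uea_of (relation_rhs \<rho> \<sigma> \<tau> l s t i j)"
      unfolding L_mat_def commutator_tensor_uea_of lie_L_op[OF assms] ..
    also have "\<dots> = ?rhs $ i $ j"
      unfolding L_mat_def tensor_map_matrix_uea_of vector_add_component vector_minus_component
        comm_kernel_uea_of[OF r_mat_eq[OF assms(1,2)]]
      by (simp add: relation_rhs_def const_u_def const_v_def kernel_times_def tensor_mult_nth
          H_mat_mult_nth dlambda_L_mat_eq[OF assms(1,2)] dlambda_r_mat_eq[OF assms(1,2)]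
          dtau_r_mat_eq[OF assms(1,2)] du uea_of_add uea_of_diff uea_of_scale uea_of_H_sign
          scaleC_scaleC uea_scale_uminus)
    finally show ?thesis .
  qed
  then show ?thesis by (simp add: vec_eq_iff)
qed

text \<open>
  Each entry of the \<open>L\<close>-operator is a weight vector for \<open>h\<close>, with a weight opposite to the one under
  the adjoint action of \<open>H\<close>.
\<close>

lemma weight_relation:
  assumes "Im \<tau> > 0" "l \<notin> period_lattice \<tau>"
  shows "commutator (H_mat + mat (uea_of aff_h0)) (L_mat \<sigma> \<tau> l s) = 0"
proof -
  have entry: "commutator (H_mat + mat (uea_of aff_h0)) (L_mat \<sigma> \<tau> l s) $ i $ j =
      uea_of (H_sign i i (L_op \<sigma> \<tau> l s $ i $ j) - H_sign j j (L_op \<sigma> \<tau> l s $ i $ j)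
        + lie aff_h0 (L_op \<sigma> \<tau> l s $ i $ j))" for i j
    using exhaust_2[of i] exhaust_2[of j]
    by (auto simp: commutator_def matrix_matrix_mult_def sum_2 mat_def L_mat_def H_mat_def H_sign_def
        uea_of_add uea_of_diff uea_of_uminus distrib_left distrib_right simp flip: uea_of_lie)
  have "H_sign i i X - H_sign j j X + lie aff_h0 X = 0" if "X = L_op \<sigma> \<tau> l s $ i $ j" for i j X
    using exhaust_2[of i] exhaust_2[of j]
    by (auto simp: that L_op_entries[OF assms] H_sign_def hat_def aff_h0_def sl2_h_def sl2_e_def sl2_f_def
        zero_affine_sl2_def plus_affine_sl2_def uminus_affine_sl2_def minus_affine_sl2_def
        scaleC_affine_sl2_def lie_affine_sl2_def kscale_0 kdiff_0 sprod_0 scaleC_one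
        kdiff_1 kscale_uminus ktest_eq_iff zero_ktest.rep_eq plus_ktest.rep_eq uminus_ktest.rep_eq kapp_diff
        scaleC_ktest.rep_eq kapp_two_mult)
  then have "commutator (H_mat + mat (uea_of aff_h0)) (L_mat \<sigma> \<tau> l s) $ i $ j = 0" for i j
    by (simp add: entry uea_of_0)
  then show ?thesis by (simp add: vec_eq_iff)
qed

theorem proposition4:
  fixes \<tau> l :: complex
  assumes "Im \<tau> > 0"
    and "\<forall>m n :: int. l \<noteq> of_int m + of_int n * \<tau>"
  shows
   "(\<forall>\<sigma> s t.
      commutator (tensor1 (L_mat \<sigma> \<tau> l s)) (tensor2 (L_mat \<sigma> \<tau> l t)) =
        comm_kernel_u (\<lambda>s. tensor1 (L_mat \<sigma> \<tau> l s)) (r_mat \<tau> l) s t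
      + comm_kernel_v (\<lambda>t. tensor2 (L_mat \<sigma> \<tau> l t)) (r_mat \<tau> l) s t
      + const_u (\<lambda>t. tensor1 H_mat ** tensor2 (dlambda_L_mat \<sigma> \<tau> l t)) s t
      - const_v (\<lambda>s. tensor2 H_mat ** tensor1 (dlambda_L_mat \<sigma> \<tau> l s)) s t
      + kernel_times aff_h0 (dlambda_r_mat \<tau> l) s t
      - kernel_times aff_c (dtau_r_mat \<tau> l) s t)
  \<and> (\<forall>s t.
      commutator (tensor1 (L_mat Plus \<tau> l s)) (tensor2 (L_mat Minus \<tau> l t)) =
        comm_kernel_u (\<lambda>s. tensor1 (L_mat Plus \<tau> l s)) (r_mat \<tau> l) s t
      + comm_kernel_v (\<lambda>t. tensor2 (L_mat Minus \<tau> l t)) (r_mat \<tau> l) s t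
      + const_u (\<lambda>t. tensor1 H_mat ** tensor2 (dlambda_L_mat Minus \<tau> l t)) s t
      - const_v (\<lambda>s. tensor2 H_mat ** tensor1 (dlambda_L_mat Plus \<tau> l s)) s t
      + kernel_times aff_h0 (dlambda_r_mat \<tau> l) s t
      + (kernel_times aff_c (du_r_mat \<tau> l) s t - kernel_times aff_c (dtau_r_mat \<tau> l) s t))
  \<and> (\<forall>\<sigma> s. commutator (H_mat + mat (uea_of aff_h0)) (L_mat \<sigma> \<tau> l s) = 0)"
proof -
  have l: "l \<notin> period_lattice \<tau>" using assms(2) by (auto simp: period_lattice_def)
  have scale: "map_matrix ((*\<^sub>C) (0::complex)) M = 0" "map_matrix ((*\<^sub>C) (1::complex)) M = M"
    for M :: "affine_sl2 uea^(2 \<times> 2)^(2 \<times> 2)"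
    by (simp_all add: vec_eq_iff scaleC_one uea_scale_0)
  show ?thesis
    using exchange_relation[OF assms(1) l] weight_relation[OF assms(1) l]
    by (auto simp: compatible_def sign_diff_def scale)
qed

end
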